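(* Let $G$ be a unicyclic graph whose unique cycle is the odd cycle $C_{2n+1}=(x_1,\ldots,x_{2n+1})$, $n\ge 1$, let $l=|E(G)\setminus E(C_{2n+1})|$, and let $I=I(G)$ be its edge ideal. Let $s\in\mathbb{N}$. Let the numbers $d_{n+1},\ldots,d_{2n+1+l}$ and $|\mathscr{G}_j|$ ($j\ge 0$) be as defined in the context. Then: (1) for $n+1\le s\le 2n+1$, $$\operatorname{sdefect}(I,s)=|\mathscr{G}_{s-(n+1)}|=\left(\!\!\binom{2n+1+l}{s-(n+1)}\!\!\right);$$ (2) for $s\ge 2n+2$, $$\operatorname{sdefect}(I,s)=|\mathscr{G}_{s-(n+1)}|+\operatorname{sdefect}(I,s-(n+1)).$$
   Context: A unicyclic graph is a finite simple connected graph containing exactly one cycle. $R=\mathbb{K}[V(G)]$ is the polynomial ring over a field $\mathbb{K}$ whose variables are the vertices of $G$; the edge ideal is $I(G)=\langle uv : \{u,v\}\in E(G)\rangle\subset R$. The $s$-th symbolic power of $I$ is $I^{(s)}=\bigcap_{p\in\operatorname{Ass} I}(I^sR_p\cap R)$, and $\operatorname{sdefect}(I,s)=\mu(I^{(s)}/I^s)$ is the minimal number of generators of the $R$-module $I^{(s)}/I^s$. Multichoose notation: $\left(\!\!\binom{a}{b}\!\!\right)=\binom{a+b-1}{b}$ for $b\ge 0$, and $\left(\!\!\binom{a}{b}\!\!\right)=0$ if $b<0$. Edge covers for the cycle in $G$: an edge cover for $C_{2n+1}$ in $G$ is a set $L\subseteq E(G)$ such that every vertex of $C_{2n+1}$ is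 incident to some edge of $L$. It is Type-I if $L\subseteq E(C_{2n+1})$, and Type-II if $L$ contains some edge of $E(G)\setminus E(C_{2n+1})$. A Type-I (resp. Type-II) minimum edge cover for $C_{2n+1}$ in $G$ is a Type-I (resp. Type-II) edge cover of smallest possible cardinality among all Type-I (resp. Type-II) edge covers for $C_{2n+1}$ in $G$. For $n+1\le j\le 2n+1+l$, $d_j$ is the number of subsets of $E(G)$ of cardinality $j$ that contain a Type-I or a Type-II minimum edge cover for $C_{2n+1}$ in $G$. The numbers $|\mathscr{G}_j|$: for $n+1\le s\le 2n+1$, $|\mathscr{G}_{s-(n+1)}|=\left(\!\!\binom{2n+1+l}{s-(n+1)}\!\!\right)$; for $s\ge 2n+2$, $$|\mathscr{G}_{s-(n+1)}|=\left(\!\!\binom{2n+1+l}{s-(n+1)}\!\!\right)-\sum_{i=0}^{n+l} d_{n+1+i}\left(\!\!\binom{n+1+i}{s-2(n+1)-i}\!\!\right).$$ *)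

theory Defs
  imports Complex_Main "HOL-Library.Poly_Mapping" "HOL-Library.Set_Algebras"
begin

section \<open>Ideals of a commutative ring\<close>

text \<open>Ideals are the submodules of the ring over itself: \<open>ideal.subspace I\<close> says that \<open>I\<close> is an
  ideal, and \<open>ideal.span S\<close> is the ideal generated by \<open>S\<close>.\<close>

interpretation ideal: module "(*) :: 'a::comm_ring_1 \<Rightarrow> 'a \<Rightarrow> 'a"
  by unfold_locales (auto simp: algebra_simps)

definition ideal_prod :: "'a::comm_ring_1 set \<Rightarrow> 'a set \<Rightarrow> 'a set" where
  "ideal_prod I J = ideal.span {a * b |a b. a \<in> I \<and> b \<in> J}"

primrec ideal_power :: "'a::comm_ring_1 set \<Rightarrow> nat \<Rightarrow> 'a set" where
  "ideal_power I 0 = UNIV"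
| "ideal_power I (Suc s) = ideal_prod I (ideal_power I s)"

definition is_prime_ideal :: "'a::comm_ring_1 set \<Rightarrow> bool" where
  "is_prime_ideal p \<longleftrightarrow>
     ideal.subspace p \<and> p \<noteq> UNIV \<and> (\<forall>a b. a * b \<in> p \<longrightarrow> a \<in> p \<or> b \<in> p)"

text \<open>\<open>Ass I\<close> is the set of associated primes of the module \<open>R/I\<close>, i.e. the prime ideals that are
  the annihilator of a residue class \<open>f + I\<close>.\<close>

definition Ass :: "'a::comm_ring_1 set \<Rightarrow> 'a set set" where
  "Ass I = {p. is_prime_ideal p \<and> (\<exists>f. p = {r. r * f \<in> I})}"


section \<open>Localization at a prime and symbolic powers\<close>

text \<open>For a prime \<open>p\<close>, the elements of \<open>R\<^sub>p\<close> are the classes \<open>loc_frac p a t\<close> (the fraction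
  \<open>a/t\<close> with \<open>t \<notin> p\<close>) of the usual equivalence relation on numerator-denominator pairs.\<close>

definition loc_rel :: "'a::comm_ring_1 set \<Rightarrow> (('a \<times> 'a) \<times> ('a \<times> 'a)) set" where
  "loc_rel p = {((a, t), (b, u)). t \<notin> p \<and> u \<notin> p \<and> (\<exists>w. w \<notin> p \<and> w * (a * u - b * t) = 0)}"

definition loc_frac :: "'a::comm_ring_1 set \<Rightarrow> 'a \<Rightarrow> 'a \<Rightarrow> ('a \<times> 'a) set" where
  "loc_frac p a t = loc_rel p `` {(a, t)}"

text \<open>The ideal \<open>J R\<^sub>p\<close>, for an ideal \<open>J\<close> of \<open>R\<close>, and the contraction \<open>K \<inter> R\<close> of a subset
  \<open>K\<close> of \<open>R\<^sub>p\<close> along \<open>r \<mapsto> r/1\<close>.\<close>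

definition loc_ideal :: "'a::comm_ring_1 set \<Rightarrow> 'a set \<Rightarrow> ('a \<times> 'a) set set" where
  "loc_ideal p J = {loc_frac p a t |a t. a \<in> J \<and> t \<notin> p}"

definition loc_contract :: "'a::comm_ring_1 set \<Rightarrow> ('a \<times> 'a) set set \<Rightarrow> 'a set" where
  "loc_contract p K = {r. loc_frac p r 1 \<in> K}"

definition symbolic_power :: "'a::comm_ring_1 set \<Rightarrow> nat \<Rightarrow> 'a set" where
  "symbolic_power I s = (\<Inter>p\<in>Ass I. loc_contract p (loc_ideal p (ideal_power I s)))"


section \<open>Minimal number of generators of a quotient module; symbolic defect\<close>

text \<open>For ideals \<open>N \<subseteq> M\<close>, the elements of \<open>M/N\<close> are the cosets \<open>m +o N\<close>. The sum of two cosets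
  is their elementwise sum, and the scalar multiple of \<open>m +o N\<close> by \<open>r\<close> is \<open>(r * m) +o N\<close>.\<close>

definition quot_module :: "'a::comm_ring_1 set \<Rightarrow> 'a set \<Rightarrow> 'a set set" where
  "quot_module M N = {m +o N |m. m \<in> M}"

definition quot_scale :: "'a::comm_ring_1 set \<Rightarrow> 'a \<Rightarrow> 'a set \<Rightarrow> 'a set" where
  "quot_scale N r X = (r *o X) + N"

text \<open>The submodule of \<open>M/N\<close> generated by a set \<open>B\<close> of cosets.\<close>

inductive_set quot_span :: "'a::comm_ring_1 set \<Rightarrow> 'a set set \<Rightarrow> 'a set set"
  for N :: "'a set" and B :: "'a set set" where
  zero: "N \<in> quot_span N B"
| gen: "X \<in> B \<Longrightarrow> X \<in> quot_span N B"
| add: "X \<in> quot_span N B \<Longrightarrow> Y \<in> quot_span N B \<Longrightarrow> X + Y \<in> quot_span N B"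
| scale: "X \<in> quot_span N B \<Longrightarrow> quot_scale N r X \<in> quot_span N B"

text \<open>Only meaningful when \<open>M/N\<close> is finitely generated, as is always the case over the Noetherian
  ring considered here.\<close>

definition min_num_gens :: "'a::comm_ring_1 set \<Rightarrow> 'a set \<Rightarrow> nat" where
  "min_num_gens M N =
     (LEAST k. \<exists>B \<subseteq> quot_module M N. finite B \<and> card B = k \<and> quot_span N B = quot_module M N)"

definition sdefect :: "'a::comm_ring_1 set \<Rightarrow> nat \<Rightarrow> nat" where
  "sdefect I s = min_num_gens (symbolic_power I s) (ideal_power I s)"


section \<open>Graphs and edge ideals\<close>

text \<open>A graph is given by its set \<open>E\<close> of edges; its vertex set is the whole finite type \<open>'v\<close>, which
  is also the set of variables of the polynomial ring \<open>('v, 'k) mpoly\<close>.\<close>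

type_synonym ('v, 'k) mpoly = "('v \<Rightarrow>\<^sub>0 nat) \<Rightarrow>\<^sub>0 'k"

definition Var :: "'v \<Rightarrow> ('v, 'k::field) mpoly" where
  "Var v = Poly_Mapping.single (Poly_Mapping.single v 1) 1"

definition edge_ideal :: "'v set set \<Rightarrow> ('v, 'k::field) mpoly set" where
  "edge_ideal E = ideal.span {Var u * Var v |u v. {u, v} \<in> E}"

definition simple_graph :: "'v::finite set set \<Rightarrow> bool" where
  "simple_graph E \<longleftrightarrow> (\<forall>e\<in>E. card e = 2)"

definition connected_graph :: "'v::finite set set \<Rightarrow> bool" where
  "connected_graph E \<longleftrightarrow> (\<forall>u v. (u, v) \<in> {(a, b). {a, b} \<in> E}\<^sup>*)"

text \<open>A cycle is presented by the list of its vertices in cyclic order. As a subgraph it is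
  determined by its set of edges, so cycles that differ by rotation or reversal of the list are
  identified by comparing \<open>cycle_edges\<close>.\<close>

definition cycle_edges :: "'v list \<Rightarrow> 'v set set" where
  "cycle_edges xs = {{xs ! i, xs ! (Suc i mod length xs)} |i. i < length xs}"

definition is_cycle :: "'v set set \<Rightarrow> 'v list \<Rightarrow> bool" where
  "is_cycle E xs \<longleftrightarrow> distinct xs \<and> length xs \<ge> 3 \<and> cycle_edges xs \<subseteq> E"

definition unicyclic :: "'v::finite set set \<Rightarrow> bool" where
  "unicyclic E \<longleftrightarrow>
     simple_graph E \<and> connected_graph E \<and> (\<exists>!F. \<exists>xs. is_cycle E xs \<and> F = cycle_edges xs)"


section \<open>Edge covers of the cycle\<close>

definition cycle_edge_cover :: "'v set set \<Rightarrow> 'v list \<Rightarrow> 'v set set \<Rightarrow> bool" where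
  "cycle_edge_cover E xs L \<longleftrightarrow> L \<subseteq> E \<and> (\<forall>x\<in>set xs. \<exists>e\<in>L. x \<in> e)"

definition type_I_cover :: "'v set set \<Rightarrow> 'v list \<Rightarrow> 'v set set \<Rightarrow> bool" where
  "type_I_cover E xs L \<longleftrightarrow> cycle_edge_cover E xs L \<and> L \<subseteq> cycle_edges xs"

definition type_II_cover :: "'v set set \<Rightarrow> 'v list \<Rightarrow> 'v set set \<Rightarrow> bool" where
  "type_II_cover E xs L \<longleftrightarrow> cycle_edge_cover E xs L \<and> L \<inter> (E - cycle_edges xs) \<noteq> {}"

definition type_I_min_cover :: "'v set set \<Rightarrow> 'v list \<Rightarrow> 'v set set \<Rightarrow> bool" where
  "type_I_min_cover E xs L \<longleftrightarrow> is_arg_min card (type_I_cover E xs) L"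

definition type_II_min_cover :: "'v set set \<Rightarrow> 'v list \<Rightarrow> 'v set set \<Rightarrow> bool" where
  "type_II_min_cover E xs L \<longleftrightarrow> is_arg_min card (type_II_cover E xs) L"

definition cover_count :: "'v set set \<Rightarrow> 'v list \<Rightarrow> nat \<Rightarrow> nat" where
  "cover_count E xs j =
     card {S. S \<subseteq> E \<and> card S = j \<and>
       (\<exists>L\<subseteq>S. type_I_min_cover E xs L \<or> type_II_min_cover E xs L)}"

definition multichoose :: "nat \<Rightarrow> int \<Rightarrow> nat" where
  "multichoose a b = (if b < 0 then 0 else (a + nat b - 1) choose (nat b))"

text \<open>\<open>script_G E xs n l j\<close> is the number \<open>|\<G>\<^sub>j|\<close>, for a cycle \<open>xs\<close> of length \<open>2 * n + 1\<close> and \<open>l\<close>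
  edges outside it. With \<open>j = s - (n + 1)\<close>, the case \<open>j \<le> n\<close> is \<open>n + 1 \<le> s \<le> 2 * n + 1\<close>, and
  \<open>j - (n + 1) - i\<close> is \<open>s - 2 * (n + 1) - i\<close>. Integers avoid truncated subtraction.\<close>

definition script_G :: "'v set set \<Rightarrow> 'v list \<Rightarrow> nat \<Rightarrow> nat \<Rightarrow> nat \<Rightarrow> int" where
  "script_G E xs n l j =
     (if j \<le> n then int (multichoose (2 * n + 1 + l) (int j))
      else int (multichoose (2 * n + 1 + l) (int j))
        - (\<Sum>i = 0..n + l. int (cover_count E xs (n + 1 + i))
              * int (multichoose (n + 1 + i) (int j - int (n + 1) - int i))))"

end

theory Submission
  imports Defs
begin

text \<open>Work with exponent vectors \<open>m\<close>. A monomial lies in \<open>I\<^sup>s\<close> iff \<open>packs E s m\<close>: some multiset of \<open>s\<close>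
  edges has all its vertex degrees bounded by \<open>m\<close>. It lies in the symbolic power iff \<open>heavy E s m\<close>:
  every vertex cover has weight at least \<open>s\<close>. On an odd unicyclic graph the two notions differ only by
  the cycle: a heavy \<open>m\<close> that does not pack is the indicator of the cycle plus a vector that is heavy
  for \<open>s - (n + 1)\<close>. This follows by removing one edge at a time, at a leaf of the support, or at a cycle
  edge where an alternating sum of weights is maximal.

  By degree reasons, the minimal generators of \<open>I\<^sup>(\<^sup>s\<^sup>)/I\<^sup>s\<close> are therefore the products of the cycle monomial
  with the minimal generators of \<open>I\<^sup>(\<^sup>t\<^sup>)\<close>, \<open>t = s - (n + 1)\<close>. These are the minimal generators of
  \<open>I\<^sup>(\<^sup>t\<^sup>)/I\<^sup>t\<close> together with the products of \<open>t\<close> edges that are not divisible by the cycle monomial times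
  an element of \<open>I\<^sup>(\<^sup>t\<^sup>-\<^sup>n\<^sup>-\<^sup>1\<^sup>)\<close>. Products of edges are pairwise distinct, and the excluded ones are those
  whose edges include an edge cover of the cycle of size \<open>n + 1\<close>.\<close>

section \<open>Vertex covers and edge packings\<close>

text \<open>Taking one edge out of \<open>m\<close> lowers the weight of a cover by 1, or by 2 if
  both ends lie in it, so heaviness is lost only through a cover of least possible weight that
  contains both ends. At a leaf of the support such covers can be improved. On the cycle, the safe
  edge comes from fractional packings: an odd cycle carries exactly one real edge weighting with
  prescribed vertex sums, \<open>zsum\<close> is twice that weighting, and an edge of largest weight
  can go. If no edge is preferred, \<open>m\<close> is constant on the cycle, and the whole cycle is
  taken out. The degree argument rests on one unit: the cycle monomial has degree 2n + 1, while n +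
  1 edges have degree 2n + 2. Hence minimal generators of the t-th symbolic power have degree at
  most 2t, and multiplied by the cycle they are too small for a product of t + n + 1 edges. The sum
  in the definition of \<open>script_G\<close> groups the excluded multisets of edges by their
  support S: one copy of each edge of S is forced, the other t - |S| are free. Supports are counted
  by \<open>cover_count\<close> because minimum covers of both types have n + 1 edges.\<close>

definition vertex_cover :: "'v set set \<Rightarrow> 'v set \<Rightarrow> bool" where
  "vertex_cover E C \<longleftrightarrow> (\<forall>e\<in>E. e \<inter> C \<noteq> {})"

definition heavy :: "'v::finite set set \<Rightarrow> nat \<Rightarrow> ('v \<Rightarrow> nat) \<Rightarrow> bool" where
  "heavy E s m \<longleftrightarrow> (\<forall>C. vertex_cover E C \<longrightarrow> s \<le> sum m C)"

definition edge_degree :: "'v::finite set set \<Rightarrow> ('v set \<Rightarrow> nat) \<Rightarrow> 'v \<Rightarrow> nat" where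
  "edge_degree E a v = (\<Sum>e\<in>E. a e * of_bool (v \<in> e))"

definition packs :: "'v::finite set set \<Rightarrow> nat \<Rightarrow> ('v \<Rightarrow> nat) \<Rightarrow> bool" where
  "packs E s m \<longleftrightarrow> (\<exists>a. sum a E = s \<and> (\<forall>v. edge_degree E a v \<le> m v))"

abbreviation add_set :: "('v \<Rightarrow> nat) \<Rightarrow> 'v set \<Rightarrow> 'v \<Rightarrow> nat" where
  "add_set m A \<equiv> (\<lambda>v. m v + of_bool (v \<in> A))"

lemma sum_add_set:
  fixes C :: "'v::finite set"
  shows "sum (add_set m A) C = sum m C + card (A \<inter> C)"
  by (simp add: sum.distrib of_bool_def sum.If_cases Int_commute)

lemma packs_0 [simp]: "packs E 0 m"
  unfolding packs_def by (rule exI[of _ "\<lambda>_. 0"]) (simp add: edge_degree_def)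

lemma packs_mono: "packs E s m \<Longrightarrow> (\<And>v. m v \<le> m' v) \<Longrightarrow> packs E s m'"
  unfolding packs_def using le_trans by blast

lemma heavy_mono: "heavy E s m \<Longrightarrow> (\<And>v. m v \<le> m' v) \<Longrightarrow> heavy E s m'"
  unfolding heavy_def using le_trans[OF _ sum_mono] by blast

lemma edge_degree_add:
  "edge_degree E (\<lambda>e. a e + b e) v = edge_degree E a v + edge_degree E b v"
  by (simp add: edge_degree_def algebra_simps sum.distrib)

lemma edge_degree_single:
  assumes "e \<in> E"
  shows "edge_degree E (\<lambda>x. of_bool (x = e)) v = of_bool (v \<in> e)"
proof -
  have "edge_degree E (\<lambda>x. of_bool (x = e)) v = (\<Sum>x\<in>E. if x = e then of_bool (v \<in> e) else 0)"
    unfolding edge_degree_def by (rule sum.cong) auto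
  then show ?thesis using assms by (simp add: sum.delta)
qed

lemma split_off_edge:
  fixes E :: "'v::finite set set"
  assumes "e \<in> E" "0 < a e"
  obtains a' where "sum a E = Suc (sum a' E)"
    and "\<And>v. edge_degree E a v = edge_degree E a' v + of_bool (v \<in> e)"
proof
  let ?a' = "\<lambda>x. a x - of_bool (x = e)"
  have a: "a = (\<lambda>x. ?a' x + of_bool (x = e))" using assms by (auto simp: fun_eq_iff)
  have "sum a E = sum ?a' E + (\<Sum>x\<in>E. of_bool (x = e))" by (subst a) (simp add: sum.distrib)
  then show "sum a E = Suc (sum ?a' E)" using assms by (simp add: of_bool_def sum.delta)
  show "edge_degree E a v = edge_degree E ?a' v + of_bool (v \<in> e)" for v
    by (subst a) (simp only: edge_degree_add edge_degree_single[OF assms(1)])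
qed

text \<open>The recursion matches both the recursion of \<open>ideal_power\<close> and the removal
  of one edge at a time. Writing \<open>m\<close> as \<open>add_set m' e\<close> keeps truncated
  subtraction out of the statement.\<close>

lemma packs_Suc_iff:
  fixes E :: "'v::finite set set"
  shows "packs E (Suc s) m \<longleftrightarrow> (\<exists>e\<in>E. \<exists>m'. m = add_set m' e \<and> packs E s m')"
proof
  assume "packs E (Suc s) m"
  then obtain a where a: "sum a E = Suc s" "\<And>v. edge_degree E a v \<le> m v"
    unfolding packs_def by blast
  have "\<exists>e\<in>E. a e \<noteq> 0"
  proof (rule ccontr)
    assume "\<not> ?thesis"
    then have "sum a E = 0" by simp
    then show False using a(1) by simp
  qed
  then obtain e where e: "e \<in> E" "0 < a e" by auto
  then obtain a' where a': "sum a E = Suc (sum a' E)"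
    "\<And>v. edge_degree E a v = edge_degree E a' v + of_bool (v \<in> e)"
    by (rule split_off_edge) blast
  have le: "edge_degree E a' v + of_bool (v \<in> e) \<le> m v" for v using a(2)[of v] a'(2)[of v] by simp
  have "m = add_set (\<lambda>v. m v - of_bool (v \<in> e)) e"
    by (intro ext le_add_diff_inverse2[symmetric] add_leD2[OF le])
  moreover have "packs E s (\<lambda>v. m v - of_bool (v \<in> e))"
    unfolding packs_def using a(1) a'(1) by (intro exI[of _ a'] conjI allI add_le_imp_le_diff le) simp
  ultimately show "\<exists>e\<in>E. \<exists>m'. m = add_set m' e \<and> packs E s m'" using e(1) by (intro bexI exI conjI)
next
  assume "\<exists>e\<in>E. \<exists>m'. m = add_set m' e \<and> packs E s m'"
  then obtain e m' a where *: "e \<in> E" "m = add_set m' e" "sum a E = s" "\<And>v. edge_degree E a v \<le> m' v"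
    unfolding packs_def by blast
  have "(\<Sum>x\<in>E. of_bool (x = e)) = (1::nat)" using * by (simp add: of_bool_def sum.delta)
  then show "packs E (Suc s) m" unfolding packs_def
    using * by (intro exI[of _ "\<lambda>x. a x + of_bool (x = e)"])
      (simp add: edge_degree_add edge_degree_single[OF *(1)] sum.distrib)
qed

lemma heavy_add_edge:
  assumes "heavy E s m" "e \<in> E"
  shows "heavy E (Suc s) (add_set m e)"
  unfolding heavy_def
proof (intro allI impI)
  fix C assume C: "vertex_cover E C"
  then have "card (e \<inter> C) > 0" using assms(2) by (auto simp: vertex_cover_def card_gt_0_iff)
  moreover have "s \<le> sum m C" using C assms(1) by (simp add: heavy_def)
  ultimately show "Suc s \<le> sum (add_set m e) C" by (simp add: sum_add_set)
qed

lemma heavy_0 [simp]: "heavy E 0 m" by (simp add: heavy_def)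

lemma packs_imp_heavy: "packs E s m \<Longrightarrow> heavy E s m"
proof (induction s arbitrary: m)
  case (Suc s)
  then show ?case using heavy_add_edge unfolding packs_Suc_iff by blast
qed simp

lemma heavy_zero_set: "heavy E (Suc s) m \<Longrightarrow> \<not> vertex_cover E {v. m v = 0}"
  by (auto simp: heavy_def)

lemma sum_edge_degree:
  fixes E :: "'v::finite set set"
  shows "sum (edge_degree E a) C = (\<Sum>e\<in>E. a e * card (e \<inter> C))"
proof -
  have "sum (edge_degree E a) C = (\<Sum>e\<in>E. \<Sum>v\<in>C. a e * of_bool (v \<in> e))"
    unfolding edge_degree_def by (rule sum.swap)
  also have "\<dots> = (\<Sum>e\<in>E. a e * card (e \<inter> C))"
    by (rule sum.cong) (simp_all add: sum_distrib_left[symmetric] of_bool_def sum.If_cases Int_commute)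
  finally show ?thesis .
qed

text \<open>If \<open>u\<close> is a leaf of the support of \<open>m\<close>, then a cover containing both ends of the leaf edge may
  drop \<open>u\<close> at the expense of vertices of weight zero.\<close>

lemma heavy_remove_leaf:
  fixes E :: "'v::finite set set"
  assumes hv: "heavy E (Suc s) m"
    and uw: "{u, w} \<in> E" "u \<noteq> w" "0 < m u" "0 < m w"
    and two: "\<And>e. e \<in> E \<Longrightarrow> card e = 2"
    and leaf: "\<And>x. {u, x} \<in> E \<Longrightarrow> x \<noteq> w \<Longrightarrow> m x = 0"
  shows "\<exists>m'. m = add_set m' {u, w} \<and> heavy E s m'"
proof (intro exI conjI)
  let ?m' = "\<lambda>v. m v - of_bool (v \<in> {u, w})"
  show meq: "m = add_set ?m' {u, w}" using uw by (auto simp: fun_eq_iff)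
  show "heavy E s ?m'" unfolding heavy_def
  proof (intro allI impI)
    fix C assume C: "vertex_cover E C"
    have sm: "sum m D = sum ?m' D + card ({u, w} \<inter> D)" for D
      by (subst meq) (simp only: sum_add_set)
    show "s \<le> sum ?m' C"
    proof (cases "u \<in> C \<and> w \<in> C")
      case False
      then have "card ({u, w} \<inter> C) \<le> 1" by (cases "u \<in> C"; cases "w \<in> C") auto
      then show ?thesis using sm[of C] hv C by (force simp: heavy_def)
    next
      case True
      let ?C = "(C - {u}) \<union> {v. m v = 0}"
      have "vertex_cover E ?C" unfolding vertex_cover_def
      proof
        fix e assume e: "e \<in> E"
        show "e \<inter> ?C \<noteq> {}"
        proof
          assume emp: "e \<inter> ?C = {}"
          then have "u \<in> e" using C e by (auto simp: vertex_cover_def)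
          then obtain x where x: "e = {u, x}" using two[OF e] by (auto simp: card_2_iff)
          show False using leaf[of x] emp True uw e by (cases "x = w") (auto simp: x)
        qed
      qed
      then have "Suc s \<le> sum m ?C" using hv by (simp add: heavy_def)
      also have "\<dots> = sum m (C - {u})"
        by (rule sum.mono_neutral_right) auto
      also have "\<dots> = sum m C - m u" using True by (simp add: sum_diff1_nat)
      finally have "Suc s + m u \<le> sum m C" using uw by linarith
      moreover have "card ({u, w} \<inter> C) = 2" using True uw by (simp add: Int_absorb2)
      ultimately show ?thesis using sm[of C] uw by linarith
    qed
  qed
qed

text \<open>\<open>c\<close> runs periodically through the cycle, and \<open>p\<close> sends a vertex of the cycle to the next one and
  any other vertex \<open>v\<close> to a neighbour closer to the cycle (at distance \<open>d v\<close>). So \<open>v \<mapsto> {v, p v}\<close> is a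
  bijection from the vertices to the edges.\<close>

locale odd_unicyclic =
  fixes E :: "'v::finite set set" and c :: "nat \<Rightarrow> 'v" and n :: nat
    and p :: "'v \<Rightarrow> 'v" and d :: "'v \<Rightarrow> nat"
  assumes n: "1 \<le> n"
    and c_eq_iff: "c i = c j \<longleftrightarrow> i mod (2 * n + 1) = j mod (2 * n + 1)"
    and E_eq: "E = range (\<lambda>v. {v, p v})"
    and p_c: "p (c i) = c (Suc i)"
    and d_p: "v \<notin> range c \<Longrightarrow> d (p v) < d v"
begin

lemma c_periodic: "c (i + (2 * n + 1)) = c i"
  unfolding c_eq_iff by (rule mod_add_self2)

lemma c_add_eq_iff: 
  assumes "i < 2 * n + 1" "j < 2 * n + 1"
  shows "c (f + i) = c (f + j) \<longleftrightarrow> i = j"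
proof
  assume "c (f + i) = c (f + j)"
  \<comment> \<open>In the integers \<open>f\<close> can be cancelled modulo the cycle
    length.\<close>
  then have "(int f + int i) mod int (2 * n + 1) = (int f + int j) mod int (2 * n + 1)"
    unfolding c_eq_iff by (simp only: of_nat_add[symmetric] zmod_int[symmetric])
  then have "(int f + int i - int f) mod int (2 * n + 1) = (int f + int j - int f) mod int (2 * n + 1)"
    by (rule mod_diff_cong) simp
  then show "i = j" using assms by simp
qed simp

lemma c_mod: "c (i mod (2 * n + 1)) = c i" unfolding c_eq_iff by (rule mod_mod_trivial)

lemma range_c_shift: "(\<lambda>i. c (f + i)) ` {..<2 * n + 1} = range c"
proof -
  have "inj_on (\<lambda>i. c (f + i)) {..<2 * n + 1}" by (rule inj_onI) (simp only: c_add_eq_iff lessThan_iff)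
  then have "card ((\<lambda>i. c (f + i)) ` {..<2 * n + 1}) = 2 * n + 1" by (simp only: card_image card_lessThan)
  moreover have "range c \<subseteq> c ` {..<2 * n + 1}"
  proof
    fix v assume "v \<in> range c"
    then obtain i where "v = c i" by auto
    then have "v = c (i mod (2 * n + 1))" by (simp only: c_mod)
    then show "v \<in> c ` {..<2 * n + 1}" by (intro image_eqI) auto
  qed
  then have "card (range c) \<le> 2 * n + 1"
    using card_mono[of "c ` {..<2 * n + 1}" "range c"] card_image_le[of "{..<2 * n + 1}" c] by simp
  ultimately show ?thesis by (intro card_seteq) auto
qed

lemma c_bij: "bij_betw (\<lambda>i. c (f + i)) {..<2 * n + 1} (range c)"
  unfolding bij_betw_def range_c_shift by (auto simp only: inj_on_def c_add_eq_iff lessThan_iff)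

lemma sum_cycle: "sum g (range c) = (\<Sum>i<2 * n + 1. g (c (f + i)))"
  by (rule sum.reindex_bij_betw[OF c_bij, symmetric])

lemma card_range_c: "card (range c) = 2 * n + 1"
  using bij_betw_same_card[OF c_bij] by simp

lemma c_cases:
  assumes "v \<in> range c"
  obtains i where "i < 2 * n + 1" "v = c (f + i)"
  using assms by (auto simp only: range_c_shift[of f, symmetric] image_iff lessThan_iff)

lemma c_shift_back: obtains j where "c i = c (f + j)"
  by (rule c_cases[of "c i" f]) blast+

lemma p_neq: "p v \<noteq> v"
proof
  assume pv: "p v = v"
  show False
  proof (cases "v \<in> range c")
    case True
    then obtain i where "v = c i" by auto
    then have "c (i + 1) = c (i + 0)" using pv p_c[of i] by simp
    then show False using c_add_eq_iff[of 1 0 i] n by simp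
  next
    case False then show False using d_p[of v] pv by simp
  qed
qed

lemma p_range: "v \<in> range c \<Longrightarrow> p v \<in> range c" using p_c by auto

text \<open>On the cycle, running back and forth along one edge is excluded by the length being at
  least 3; off the cycle, by the strict decrease of \<open>d\<close>. This is what makes
  \<open>ed\<close> injective, so that sums over edges become sums over vertices.\<close>

lemma p_p_neq: "p (p v) \<noteq> v"
proof
  assume pv: "p (p v) = v"
  show False
  proof (cases "v \<in> range c")
    case True
    then obtain i where "v = c i" by auto
    then have "c (i + 2) = c (i + 0)" using pv p_c by simp
    then show False using c_add_eq_iff[of 2 0 i] n by simp
  next
    case False
    then have "p v \<notin> range c" using p_range[of "p v"] pv by auto
    then show False using d_p[of v] d_p[of "p v"] pv False by simp
  qed
qed

definition ed :: "'v \<Rightarrow> 'v set" where "ed v = {v, p v}"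

lemma inj_ed: "inj ed"
proof (rule injI)
  fix v w assume "ed v = ed w"
  then show "v = w" using p_p_neq[of v] by (auto simp: ed_def doubleton_eq_iff)
qed

lemma E_ed: "E = range ed" by (auto simp: E_eq ed_def)

lemma ed_in_E: "ed v \<in> E" by (simp add: E_ed)

lemma card_edge: "e \<in> E \<Longrightarrow> card e = 2" using p_neq[symmetric] by (auto simp: E_eq)

lemma cover_iff: "vertex_cover E C \<longleftrightarrow> (\<forall>v. v \<in> C \<or> p v \<in> C)"
  by (auto simp: vertex_cover_def E_eq)

lemma sum_E: "sum g E = (\<Sum>v\<in>UNIV. g (ed v))"
  unfolding E_ed by (rule sum.reindex[OF inj_ed, unfolded comp_def])

lemma mem_ed: "w \<in> ed v \<longleftrightarrow> w = v \<or> w = p v" by (auto simp: ed_def)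

lemma edge_neighbour: "{u, x} \<in> E \<Longrightarrow> x = p u \<or> u = p x"
  by (auto simp: E_eq doubleton_eq_iff)

text \<open>Each of the 2n + 1 cycle edges has an end in \<open>C\<close>, and each cycle vertex is
  an end of two of them; the odd number 2n + 1 is therefore at most twice the cardinality.\<close>

lemma card_cover_cycle:
  assumes "vertex_cover E C"
  shows "n + 1 \<le> card (range c \<inter> C)"
proof -
  let ?g = "\<lambda>v. of_bool (v \<in> C) :: nat"
  have eq: "card (range c \<inter> C) = sum ?g (range c)" by (simp add: of_bool_def sum.If_cases)
  have "2 * n + 1 = (\<Sum>i<2 * n + 1. 1)" by simp
  also have "\<dots> \<le> (\<Sum>i<2 * n + 1. ?g (c i) + ?g (c (Suc i)))"
  proof (rule sum_mono)
    fix i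
    have "c i \<in> C \<or> c (Suc i) \<in> C" using assms unfolding cover_iff p_c[symmetric] by blast
    then show "1 \<le> ?g (c i) + ?g (c (Suc i))" by auto
  qed
  also have "\<dots> = sum ?g (range c) + sum ?g (range c)"
    using sum_cycle[of ?g 0] sum_cycle[of ?g 1] by (simp add: sum.distrib)
  finally show ?thesis unfolding eq by linarith
qed

end

section \<open>Covers of the odd cycle, alternating sums, and the removal of an edge\<close>

lemma alternating_telescope:
  fixes g :: "nat \<Rightarrow> int"
  shows "(\<Sum>k<N. (-1) ^ k * (g k + g (Suc k))) = g 0 - (-1) ^ N * g N"
  by (induction N) (simp_all add: algebra_simps)

context odd_unicyclic
begin

lemma c_Suc_inj: "c (Suc i) = c (Suc j) \<Longrightarrow> c i = c j"
proof -
  assume "c (Suc i) = c (Suc j)"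
  then have "(2 * n + Suc i) mod (2 * n + 1) = (2 * n + Suc j) mod (2 * n + 1)"
    unfolding c_eq_iff by (metis mod_add_right_eq)
  then have "c (i + (2 * n + 1)) = c (j + (2 * n + 1))"
    unfolding c_eq_iff by (simp only: ac_simps Suc_eq_plus1)
  then show ?thesis by (simp only: c_periodic)
qed

text \<open>Vertices of weight zero are free, and by \<open>off\<close> they already cover all edges
  that leave vertices off the cycle. So a cheap cover may be prescribed by its positions on the
  cycle alone. \<open>P\<close> is a predicate on the window of positions 0 to 2n and is not
  periodic, hence the separate condition for the closing edge.\<close>

lemma cycle_cover:
  fixes m :: "'v \<Rightarrow> nat" and g :: nat and P :: "nat \<Rightarrow> bool"
  assumes off: "\<And>v. v \<notin> range c \<Longrightarrow> m v = 0 \<or> m (p v) = 0"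
    and P: "\<And>i. i < 2 * n \<Longrightarrow> P i \<or> P (Suc i)" "P (2 * n) \<or> P 0"
  defines "D \<equiv> {v. m v = 0} \<union> {c (g + i) |i. i < 2 * n + 1 \<and> P i}"
  shows "vertex_cover E D"
    and "sum m D = (\<Sum>i<2 * n + 1. if P i then m (c (g + i)) else 0)"
proof -
  have D: "c (g + i) \<in> D" if "i < 2 * n + 1" "P i" for i
    using that unfolding D_def by blast
  show "vertex_cover E D"
    unfolding cover_iff
  proof
    fix v
    show "v \<in> D \<or> p v \<in> D"
    proof (cases "v \<in> range c")
      case False then show ?thesis using off[OF False] unfolding D_def by blast
    next
      case True
      then obtain i where i: "i < 2 * n + 1" "v = c (g + i)" by (rule c_cases)
      then have pv: "p v = c (g + Suc i)" by (simp add: p_c)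
      show ?thesis
      proof (cases "i < 2 * n")
        case True
        then have "Suc i < 2 * n + 1" by simp
        then show ?thesis using P(1)[OF True] D[OF i(1)] D[of "Suc i"] i(2) pv by auto
      next
        case False
        then have "i = 2 * n" using i by simp
        then have "p v = c (g + 0)" using pv c_periodic[of g] by simp
        then show ?thesis using P(2) D[OF i(1)] D[of 0] i(2) \<open>i = 2 * n\<close> by auto
      qed
    qed
  qed
  have "sum m D = sum m {c (g + i) |i. i < 2 * n + 1 \<and> P i}"
    unfolding D_def by (rule sum.mono_neutral_right) auto
  also have "{c (g + i) |i. i < 2 * n + 1 \<and> P i} = (\<lambda>i. c (g + i)) ` {i\<in>{..<2 * n + 1}. P i}" by auto
  also have "sum m \<dots> = sum (\<lambda>i. m (c (g + i))) {i\<in>{..<2 * n + 1}. P i}"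
    using c_bij[of g] by (subst sum.reindex) (auto simp: bij_betw_def intro: inj_on_subset)
  also have "\<dots> = (\<Sum>i<2 * n + 1. if P i then m (c (g + i)) else 0)"
    by (rule sum.inter_filter) simp
  finally show "sum m D = (\<Sum>i<2 * n + 1. if P i then m (c (g + i)) else 0)" .
qed

text \<open>Among the edges off the cycle with both ends in the support, take one whose outer end is
  farthest from the cycle. The second support neighbour that \<open>noleaf\<close> gives to this end
  lies still farther out, with the same property.\<close>

lemma off_cycle_isolated:
  assumes noleaf: "\<And>u w. {u, w} \<in> E \<Longrightarrow> 0 < m u \<Longrightarrow> 0 < m w \<Longrightarrow> \<exists>x. {u, x} \<in> E \<and> x \<noteq> w \<and> 0 < m x"
    and v: "v \<notin> range c"
  shows "m v = 0 \<or> m (p v) = (0::nat)"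
proof (rule ccontr)
  assume neg: "\<not> ?thesis"
  let ?B = "{v. v \<notin> range c \<and> 0 < m v \<and> 0 < m (p v)}"
  have "finite (d ` ?B)" "d ` ?B \<noteq> {}" using neg v by auto
  from Max_in[OF this] obtain u where u: "u \<in> ?B" "d u = Max (d ` ?B)" by auto
  have "{u, p u} \<in> E" by (auto simp: E_eq)
  then obtain x where x: "{u, x} \<in> E" "x \<noteq> p u" "0 < m x" using noleaf u by blast
  then have ux: "u = p x" using edge_neighbour by blast
  then have "x \<notin> range c" using u p_range by auto
  then have "x \<in> ?B" "d u < d x" using x u ux d_p[of x] by auto
  moreover have "d x \<le> Max (d ` ?B)" using \<open>x \<in> ?B\<close> by (intro Max_ge) auto
  ultimately show False using u by simp
qed

text \<open>Going round from a cycle vertex of weight zero, the first cycle edge with both ends in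
  the support would start at a leaf of the support: the predecessor of its first end has weight
  zero, and so have the neighbours of that end off the cycle.\<close>

lemma cycle_zero_spreads:
  assumes noleaf: "\<And>u w. {u, w} \<in> E \<Longrightarrow> 0 < m u \<Longrightarrow> 0 < m w \<Longrightarrow> \<exists>x. {u, x} \<in> E \<and> x \<noteq> w \<and> 0 < m x"
    and i0: "m (c i0) = (0::nat)"
  shows "m (c i) = 0 \<or> m (c (Suc i)) = 0"
proof (rule ccontr)
  assume neg: "\<not> ?thesis"
  obtain j where j: "c i = c (i0 + j)" by (rule c_shift_back)
  have "c (Suc i) = c (Suc (i0 + j))" by (metis j p_c)
  then have "0 < m (c (i0 + j)) \<and> 0 < m (c (Suc (i0 + j)))" using neg j by simp
  from LeastI[where P = "\<lambda>j. 0 < m (c (i0 + j)) \<and> 0 < m (c (Suc (i0 + j)))", OF this]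
  obtain k where k: "0 < m (c (i0 + k))" "0 < m (c (Suc (i0 + k)))"
    and least: "\<And>j. j < k \<Longrightarrow> \<not> (0 < m (c (i0 + j)) \<and> 0 < m (c (Suc (i0 + j))))"
    using not_less_Least by blast
  have "k \<noteq> 0" using k i0 by (cases k) auto
  then obtain k' where k': "k = Suc k'" by (cases k) auto
  then have zero: "m (c (i0 + k')) = 0" using least[of k'] k by auto
  have "{c (i0 + k), c (Suc (i0 + k))} \<in> E" by (metis E_eq p_c rangeI)
  then obtain x where x: "{c (i0 + k), x} \<in> E" "x \<noteq> c (Suc (i0 + k))" "0 < m x"
    using noleaf k by blast
  then have px: "p x = c (i0 + k)" using edge_neighbour p_c by metis
  show False
  proof (cases "x \<in> range c")
    case True
    then obtain j where "x = c j" by auto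
    then have "c (Suc j) = c (Suc (i0 + k'))" using px p_c k' by simp
    then have "x = c (i0 + k')" using c_Suc_inj \<open>x = c j\<close> by blast
    then show False using zero x by simp
  next
    case False
    then show False using off_cycle_isolated[of m x] noleaf x px k by auto
  qed
qed


text \<open>Twice the weight of the edge from \<open>c i\<close> to \<open>c (Suc i)\<close> in the
  unique real edge weighting of the cycle with vertex sums \<open>m\<close>; \<open>zsum_add\<close>
  is the equation of that weighting at \<open>c (Suc i)\<close>. The factor 2 keeps the values
  integral.\<close>

definition zsum :: "('v \<Rightarrow> nat) \<Rightarrow> nat \<Rightarrow> int" where
  "zsum m i = (\<Sum>k<2 * n + 1. (-1) ^ k * int (m (c (Suc i + k))))"

lemma zsum_add: "zsum m i + zsum m (Suc i) = 2 * int (m (c (Suc i)))"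
proof -
  let ?g = "\<lambda>k. int (m (c (Suc i + k)))"
  have "zsum m i + zsum m (Suc i) = (\<Sum>k<2 * n + 1. (-1) ^ k * (?g k + ?g (Suc k)))"
    unfolding zsum_def sum.distrib[symmetric] distrib_left by simp
  also have "\<dots> = ?g 0 + ?g (2 * n + 1)" by (subst alternating_telescope) simp
  also have "?g (2 * n + 1) = ?g 0" by (simp only: c_periodic add_0_right)
  finally show ?thesis by simp
qed

lemma zsum_cong: "c i = c j \<Longrightarrow> zsum m i = zsum m j"
proof -
  assume "c i = c j"
  then have "c (Suc i + k) = c (Suc j + k)" for k
    unfolding c_eq_iff using mod_add_cong[of i "2 * n + 1" j "Suc k" "Suc k"] by simp
  then show ?thesis by (simp add: zsum_def)
qed

lemma zsum_max: obtains f where "\<And>i. zsum m i \<le> zsum m f"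
proof -
  let ?Z = "zsum m ` {..<2 * n + 1}"
  have "Max ?Z \<in> ?Z" by (rule Max_in) auto
  then obtain f where f: "zsum m f = Max ?Z" by auto
  have "zsum m i \<le> zsum m f" for i
  proof -
    have "zsum m i = zsum m (i mod (2 * n + 1))" by (rule zsum_cong[OF c_mod[symmetric]])
    also have "\<dots> \<le> Max ?Z" by (intro Max_ge imageI) auto
    finally show ?thesis by (simp add: f)
  qed
  then show ?thesis by (rule that)
qed

text \<open>Twice each weight is a sum of two consecutive values of \<open>zsum\<close>, so partial
  alternating sums telescope. This measures the gain of shifting a cover along a stretch of the
  cycle.\<close>

lemma alternating_sum_zsum:
  "2 * (\<Sum>k<j. (-1) ^ k * int (m (c (f + Suc k)))) = zsum m f - (-1) ^ j * zsum m (f + j)"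
proof -
  have "2 * (\<Sum>k<j. (-1) ^ k * int (m (c (f + Suc k))))
      = (\<Sum>k<j. (-1) ^ k * (zsum m (f + k) + zsum m (f + Suc k)))"
    unfolding sum_distrib_left by (intro sum.cong) (simp_all add: zsum_add)
  also have "\<dots> = zsum m f - (-1) ^ j * zsum m (f + j)"
    using alternating_telescope[of "\<lambda>k. zsum m (f + k)"] by simp
  finally show ?thesis .
qed

text \<open>Position 0 and the odd positions form a cover of the cycle whose only edge with both
  ends in it is the one at \<open>c g\<close>. Its weight is half the total plus the fractional
  weight of that edge, so these covers compare like the values of \<open>zsum\<close>.\<close>

lemma alternating_cover_weight:
  "2 * int (\<Sum>i<2 * n + 1. if odd i \<or> i = 0 then m (c (g + i)) else 0)
     = int (sum m (range c)) + zsum m g"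
proof -
  let ?x = "\<lambda>i. int (m (c (g + i)))"
  have z: "zsum m g = (\<Sum>k<2 * n. (-1) ^ k * ?x (Suc k)) + ?x 0"
    using c_periodic[of g] unfolding zsum_def by simp
  have "int (sum m (range c)) = (\<Sum>i<2 * n + 1. ?x i)" by (simp add: sum_cycle[of _ g])
  also have "\<dots> = ?x 0 + (\<Sum>k<2 * n. ?x (Suc k))" by (simp only: Suc_eq_plus1[symmetric] sum.lessThan_Suc_shift)
  finally have M: "int (sum m (range c)) = ?x 0 + (\<Sum>k<2 * n. ?x (Suc k))" .
  have "int (\<Sum>i<2 * n + 1. if odd i \<or> i = 0 then m (c (g + i)) else 0)
      = (\<Sum>i<Suc (2 * n). if odd i \<or> i = 0 then ?x i else 0)"
    by (simp only: of_nat_sum Suc_eq_plus1) (intro sum.cong, auto)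
  also have "\<dots> = ?x 0 + (\<Sum>k<2 * n. if even k then ?x (Suc k) else 0)"
    by (simp only: sum.lessThan_Suc_shift) simp
  finally have W: "2 * int (\<Sum>i<2 * n + 1. if odd i \<or> i = 0 then m (c (g + i)) else 0)
      = 2 * ?x 0 + (\<Sum>k<2 * n. 2 * (if even k then ?x (Suc k) else 0))"
    by (simp add: sum_distrib_left)
  show ?thesis unfolding W M z
    by (simp add: sum.distrib[symmetric] algebra_simps) (intro sum.cong, auto simp: ac_simps)
qed

lemma cycle_alternates:
  assumes C: "vertex_cover E C" and x1: "c (Suc f) \<in> C"
    and nd: "\<And>i. 1 \<le> i \<Longrightarrow> i < j \<Longrightarrow> \<not> (c (f + i) \<in> C \<and> c (f + Suc i) \<in> C)"
    and i: "1 \<le> i" "i \<le> j"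
  shows "c (f + i) \<in> C \<longleftrightarrow> odd i"
  using i
proof (induction i rule: nat_induct_at_least)
  case base then show ?case using x1 by simp
next
  case (Suc i)
  have "c (f + i) \<in> C \<or> c (f + Suc i) \<in> C"
    using C unfolding cover_iff by (metis add_Suc_right p_c)
  then show ?case using Suc nd[of i] by auto
qed

lemma heavy_cycle_cover_le:
  fixes m :: "'v \<Rightarrow> nat"
  assumes "heavy E s m" and off: "\<And>v. v \<notin> range c \<Longrightarrow> m v = 0 \<or> m (p v) = 0"
    and "\<And>i. i < 2 * n \<Longrightarrow> P i \<or> P (Suc i)" "P (2 * n) \<or> P 0"
  shows "s \<le> (\<Sum>i<2 * n + 1. if P i then m (c (g + i)) else 0)"
proof -
  let ?D = "{v. m v = 0} \<union> {c (g + i) |i. i < 2 * n + 1 \<and> P i}"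
  have "vertex_cover E ?D" by (rule cycle_cover(1)) (use assms in auto)
  then have "s \<le> sum m ?D" using assms(1) by (simp only: heavy_def)
  also have "sum m ?D = (\<Sum>i<2 * n + 1. if P i then m (c (g + i)) else 0)"
    by (rule cycle_cover(2)) (use assms in auto)
  finally show ?thesis .
qed

text \<open>If the support contains the whole cycle but has no leaf, the edge at which \<open>zsum\<close> is maximal can
  be removed: an optimal cover containing both of its ends can be shifted along the cycle, up to its
  next edge with both ends in the cover.\<close>

lemma heavy_remove_max_edge:
  assumes hv: "heavy E (Suc s) m"
    and off: "\<And>v. v \<notin> range c \<Longrightarrow> m v = 0 \<or> m (p v) = 0"
    and pos: "\<And>i. 0 < m (c i)"
    and max: "\<And>i. zsum m i \<le> zsum m f"
    and less: "zsum m g < zsum m f"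
  shows "\<exists>m'. m = add_set m' (ed (c f)) \<and> heavy E s m'"
proof (intro exI conjI)
  let ?x = "\<lambda>i. c (f + i)"
  let ?N = "2 * n + 1"
  let ?m' = "\<lambda>v. m v - of_bool (v \<in> ed (c f))"
  have ed: "ed (c f) = {?x 0, ?x 1}" by (simp add: ed_def p_c)
  show meq: "m = add_set ?m' (ed (c f))"
    using pos[of f] pos[of "Suc f"] by (intro ext) (auto simp: ed)
  show "heavy E s ?m'" unfolding heavy_def
  proof (intro allI impI, rule ccontr)
    fix C assume C: "vertex_cover E C" and lt: "\<not> s \<le> sum ?m' C"
    have sm: "sum m C = sum ?m' C + card (ed (c f) \<inter> C)"
      by (subst meq) (simp only: sum_add_set)
    have ge: "Suc s \<le> sum m C" using hv C by (simp add: heavy_def)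
    have ne: "?x 0 \<noteq> ?x 1" using c_add_eq_iff[of 0 1 f] n by simp
    \<comment> \<open>The weight of \<open>C\<close> drops from at least \<open>Suc s\<close> to
      less than \<open>s\<close> and the edge accounts for at most 2. So both ends lie in
      \<open>C\<close>, and \<open>C\<close> has weight exactly \<open>Suc s\<close>.\<close>
    have "2 \<le> card (ed (c f) \<inter> C)" using sm ge lt by linarith
    then have x01: "?x 0 \<in> C" "?x 1 \<in> C"
      unfolding ed using ne by (cases "?x 0 \<in> C"; cases "?x 1 \<in> C"; simp)+
    have "card (ed (c f) \<inter> C) \<le> 2" unfolding ed by (rule le_trans[OF card_mono[of "{?x 0, ?x 1}"]]) (auto simp: card_insert_if)
    then have le: "sum m C \<le> Suc s" using sm lt by linarith
    have xN: "?x ?N = ?x 0" "?x (Suc ?N) = ?x 1"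
      using c_periodic[of f] c_periodic[of "Suc f"] by simp_all
    \<comment> \<open>After a full turn the edge at \<open>c f\<close> itself qualifies, so
      \<open>j\<close> exists; \<open>j = ?N\<close> means that no other cycle edge has both ends in
      \<open>C\<close>.\<close>
    have ex: "1 \<le> ?N \<and> ?x ?N \<in> C \<and> ?x (Suc ?N) \<in> C" using x01 xN by simp
    define j where "j = (LEAST j. 1 \<le> j \<and> ?x j \<in> C \<and> ?x (Suc j) \<in> C)"
    have j: "1 \<le> j" "?x j \<in> C" "?x (Suc j) \<in> C"
      using LeastI[where P = "\<lambda>j. 1 \<le> j \<and> ?x j \<in> C \<and> ?x (Suc j) \<in> C", OF ex] unfolding j_def by auto
    have jN: "j \<le> ?N" unfolding j_def by (rule Least_le) (rule ex)
    have nd: "\<not> (?x i \<in> C \<and> ?x (Suc i) \<in> C)" if "1 \<le> i" "i < j" for i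
      using not_less_Least[of i "\<lambda>j. 1 \<le> j \<and> ?x j \<in> C \<and> ?x (Suc j) \<in> C"] that unfolding j_def by blast
    have alt: "?x i \<in> C \<longleftrightarrow> odd i" if "1 \<le> i" "i \<le> j" for i
      by (rule cycle_alternates[OF C _ nd]) (use x01 that in auto)
    have oddj: "odd j" using alt[of j] j by simp
    have "(\<Sum>i<?N. if ?x i \<in> C then m (?x i) else 0) = sum m (range c \<inter> C)"
      unfolding sum_cycle[of "\<lambda>v. if v \<in> C then m v else 0" f, symmetric] by (simp add: sum.inter_restrict)
    also have "\<dots> \<le> sum m C" by (rule sum_mono2) auto
    finally have wC: "(\<Sum>i<?N. if ?x i \<in> C then m (?x i) else 0) \<le> Suc s" using le by linarith
    show False
    proof (cases "j = ?N")
      case True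
      \<comment> \<open>On the cycle, \<open>C\<close> is now the alternating cover at
        \<open>f\<close>. It is tight, so the one at \<open>g\<close> cannot weigh less, which
        contradicts the smaller \<open>zsum\<close> at \<open>g\<close>.\<close>
      have "(\<Sum>i<?N. if odd i \<or> i = 0 then m (?x i) else 0) = (\<Sum>i<?N. if ?x i \<in> C then m (?x i) else 0)"
      proof (rule sum.cong)
        fix i assume "i \<in> {..<?N}"
        then have "?x i \<in> C \<longleftrightarrow> odd i \<or> i = 0" using alt[of i] True x01(1) by (cases "i = 0") auto
        then show "(if odd i \<or> i = 0 then m (?x i) else 0) = (if ?x i \<in> C then m (?x i) else 0)" by simp
      qed simp
      then have "(\<Sum>i<?N. if odd i \<or> i = 0 then m (?x i) else 0) \<le> Suc s" using wC by simp
      moreover have "Suc s \<le> (\<Sum>i<?N. if odd i \<or> i = 0 then m (c (g + i)) else 0)"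
        by (rule heavy_cycle_cover_le[where m = m and P = "\<lambda>i. odd i \<or> i = 0" and g = g, OF hv off]) auto
      ultimately show False
        using alternating_cover_weight[of m f] alternating_cover_weight[of m g] less by linarith
    next
      case False
      then have jlt: "j < ?N - 1" using jN oddj by (cases "j = 2 * n") auto
      \<comment> \<open>Membership is swapped on positions 1 to \<open>j\<close>. Positions 0 and
        \<open>j + 1\<close> stay in, so the edges at both ends of the stretch lose only one of
        their two cover vertices.\<close>
      define P where "P i \<longleftrightarrow> (if 1 \<le> i \<and> i \<le> j then even i else ?x i \<in> C)" for i
      have cov: "?x i \<in> C \<or> ?x (Suc i) \<in> C" for i
        using C unfolding cover_iff by (metis add_Suc_right p_c)
      have P: "P i \<or> P (Suc i)" for i
        using cov[of i] j oddj x01 by (cases "i = 0 \<or> i = j") (auto simp: P_def)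
      have "P 0" using x01 by (simp add: P_def)
      then have "Suc s \<le> (\<Sum>i<?N. if P i then m (?x i) else 0)"
        using P by (intro heavy_cycle_cover_le[where m = m and P = P and g = f, OF hv off]) auto
      then have "int (\<Sum>i<?N. if ?x i \<in> C then m (?x i) else 0) \<le> int (\<Sum>i<?N. if P i then m (?x i) else 0)"
        using wC by linarith
      then have "0 \<le> (\<Sum>i<?N. int (if P i then m (?x i) else 0) - int (if ?x i \<in> C then m (?x i) else 0))"
        by (simp add: sum_subtractf)
      also have "\<dots> = (\<Sum>i\<in>{..<?N}. if i \<in> {1..j} then - ((-1) ^ (i - 1) * int (m (?x i))) else 0)"
      proof (rule sum.cong)
        fix i
        show "int (if P i then m (?x i) else 0) - int (if ?x i \<in> C then m (?x i) else 0)
          = (if i \<in> {1..j} then - ((-1) ^ (i - 1) * int (m (?x i))) else 0)"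
          using alt[of i] by (cases "even i") (auto simp: P_def elim!: evenE oddE)
      qed simp
      also have "\<dots> = (\<Sum>i\<in>{..<?N} \<inter> {1..j}. - ((-1) ^ (i - 1) * int (m (?x i))))"
        by (rule sum.inter_restrict[symmetric]) simp
      also have "{..<?N} \<inter> {1..j} = Suc ` {..<j}" using jlt by (auto simp: image_iff Bex_def) presburger
      also have "(\<Sum>i\<in>Suc ` {..<j}. - ((-1) ^ (i - 1) * int (m (?x i)))) = - (\<Sum>k<j. (-1) ^ k * int (m (?x (Suc k))))"
        by (subst sum.reindex) (auto simp: sum_negf)
      \<comment> \<open>The shifted cover is not lighter than the tight cover \<open>C\<close>,
        which bounds \<open>zsum m (f + j)\<close> by the negative of the maximum. Since the weight
        at \<open>c (Suc (f + j))\<close> is positive, \<open>zsum\<close> would exceed the maximum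
        at the next edge.\<close>
      finally have "zsum m f + zsum m (f + j) \<le> 0"
        using alternating_sum_zsum[of m f j] oddj by simp
      moreover have "zsum m (f + j) + zsum m (Suc (f + j)) = 2 * int (m (c (Suc (f + j))))" by (rule zsum_add)
      ultimately show False using pos[of "Suc (f + j)"] max[of "Suc (f + j)"] by linarith
    qed
  qed
qed

text \<open>The alternating cover weighs k (n + 1), and this bounds \<open>Suc s\<close>. After the
  cycle is taken out, every cover still has weight at least (k - 1)(n + 1), hence at least s -
  n.\<close>

lemma heavy_constant_cycle:
  assumes hv: "heavy E (Suc s) m"
    and off: "\<And>v. v \<notin> range c \<Longrightarrow> m v = 0 \<or> m (p v) = 0"
    and pos: "0 < k" and const: "\<And>i. m (c i) = k"
  shows "(\<exists>e\<in>E. \<exists>m'. m = add_set m' e \<and> heavy E s m')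
    \<or> (n \<le> s \<and> (\<exists>m'. m = add_set m' (range c) \<and> heavy E (s - n) m'))"
proof -
  have "zsum m 0 = zsum m (Suc 0)" by (simp only: zsum_def const)
  then have z: "zsum m 0 = int k" using zsum_add[of m 0] const by simp
  have M: "sum m (range c) = (2 * n + 1) * k"
    unfolding sum_cycle[of m 0] by (simp only: const sum_constant card_lessThan of_nat_id)
  define W where "W = (\<Sum>i<2 * n + 1. if odd i \<or> i = 0 then m (c (0 + i)) else 0)"
  have "Suc s \<le> W" unfolding W_def
    by (rule heavy_cycle_cover_le[where m = m and P = "\<lambda>i. odd i \<or> i = 0" and g = 0, OF hv off]) auto
  have "2 * int W = int ((2 * n + 1) * k) + int k"
    unfolding W_def alternating_cover_weight z M ..
  also have "\<dots> = 2 * int (k * (n + 1))" by (simp add: ring_distribs)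
  finally have "W = k * (n + 1)" by presburger
  then have sk: "Suc s \<le> k * (n + 1)" using \<open>Suc s \<le> W\<close> by (simp only:)
  show ?thesis
  proof (cases "n \<le> s")
    case True
    let ?m' = "\<lambda>v. m v - of_bool (v \<in> range c)"
    have "m = add_set ?m' (range c)" using const pos by (intro ext) auto
    moreover have "heavy E (s - n) ?m'" unfolding heavy_def
    proof (intro allI impI)
      fix C assume C: "vertex_cover E C"
      have "s - n \<le> (k - 1) * (n + 1)" using sk pos by (cases k) auto
      also have "\<dots> \<le> (k - 1) * card (range c \<inter> C)" by (intro mult_left_mono card_cover_cycle C) simp
      also have "\<dots> = (\<Sum>v\<in>range c \<inter> C. k - 1)" by simp
      also have "\<dots> = sum ?m' (range c \<inter> C)" using const by (intro sum.cong) auto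
      also have "\<dots> \<le> sum ?m' C" by (rule sum_mono2) auto
      finally show "s - n \<le> sum ?m' C" .
    qed
    ultimately show ?thesis using True by (intro disjI2 conjI exI)
  next
    case False
    let ?m' = "\<lambda>v. m v - of_bool (v \<in> ed (c 0))"
    have meq: "m = add_set ?m' (ed (c 0))"
      using const pos by (intro ext) (auto simp: ed_def p_c)
    have "heavy E s ?m'" unfolding heavy_def
    proof (intro allI impI)
      fix C assume C: "vertex_cover E C"
      \<comment> \<open>Every cover weighs at least n + 1, the edge takes away at most 2, and s + 2
        \<le> n + 1 in this case.\<close>
      have "n + 1 \<le> k * card (range c \<inter> C)"
        using mult_le_mono[of 1 k "n + 1"] card_cover_cycle[OF C] pos by simp
      also have "\<dots> = (\<Sum>v\<in>range c \<inter> C. k)" by simp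
      also have "\<dots> = sum m (range c \<inter> C)" using const by (intro sum.cong) auto
      also have "\<dots> \<le> sum m C" by (rule sum_mono2) auto
      also have "sum m C = sum ?m' C + card (ed (c 0) \<inter> C)"
        by (subst meq) (simp only: sum_add_set)
      also have "card (ed (c 0) \<inter> C) \<le> card (ed (c 0))" by (rule card_mono) auto
      also have "card (ed (c 0)) = 2" by (rule card_edge[OF ed_in_E])
      finally show "s \<le> sum ?m' C" using False by linarith
    qed
    then show ?thesis using meq ed_in_E by (intro disjI1 bexI[of _ "ed (c 0)"] conjI exI)
  qed
qed

lemma heavy_Suc_cases:
  assumes hv: "heavy E (Suc s) m"
  shows "(\<exists>e\<in>E. \<exists>m'. m = add_set m' e \<and> heavy E s m')
    \<or> (n \<le> s \<and> (\<exists>m'. m = add_set m' (range c) \<and> heavy E (s - n) m'))"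
proof (cases "\<exists>u w. {u, w} \<in> E \<and> 0 < m u \<and> 0 < m w \<and> (\<forall>x. {u, x} \<in> E \<longrightarrow> x \<noteq> w \<longrightarrow> m x = 0)")
  case True
  then obtain u w where uw: "{u, w} \<in> E" "0 < m u" "0 < m w"
    "\<And>x. {u, x} \<in> E \<Longrightarrow> x \<noteq> w \<Longrightarrow> m x = 0" by blast
  have "u \<noteq> w" using card_edge[OF uw(1)] by auto
  then show ?thesis using heavy_remove_leaf[OF hv uw(1) _ uw(2,3) card_edge uw(4)] uw(1) by blast
next
  case False
  then have noleaf: "\<And>u w. {u, w} \<in> E \<Longrightarrow> 0 < m u \<Longrightarrow> 0 < m w \<Longrightarrow> \<exists>x. {u, x} \<in> E \<and> x \<noteq> w \<and> 0 < m x"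
    by (metis gr0I)
  have off: "\<And>v. v \<notin> range c \<Longrightarrow> m v = 0 \<or> m (p v) = 0"
    by (rule off_cycle_isolated[OF noleaf])
  have pos: "0 < m (c i)" for i
  proof (rule ccontr)
    assume "\<not> 0 < m (c i)"
    then have on: "m (c j) = 0 \<or> m (c (Suc j)) = 0" for j
      by (intro cycle_zero_spreads[OF noleaf, of i j]) simp_all
    have "vertex_cover E {v. m v = 0}" unfolding cover_iff
    proof
      fix v show "v \<in> {v. m v = 0} \<or> p v \<in> {v. m v = 0}"
      proof (cases "v \<in> range c")
        case True
        then obtain j where "v = c j" by auto
        then show ?thesis using on[of j] by (simp add: p_c)
      qed (use off[of v] in simp)
    qed
    then show False using heavy_zero_set[OF hv] by blast
  qed
  obtain f where f: "\<And>i. zsum m i \<le> zsum m f" by (rule zsum_max) blast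
  show ?thesis
  proof (cases "\<exists>g. zsum m g < zsum m f")
    case True
    then obtain g where g: "zsum m g < zsum m f" by blast
    have "\<exists>m'. m = add_set m' (ed (c f)) \<and> heavy E s m'"
      by (rule heavy_remove_max_edge) (fact hv off pos f g)+
    then show ?thesis using ed_in_E by (intro disjI1 bexI)
  next
    case False
    \<comment> \<open>With \<open>zsum\<close> constant, \<open>zsum_add\<close> forces equal
      weights on the whole cycle.\<close>
    then have z: "zsum m i = zsum m f" for i using f[of i] by (metis le_less)
    have "2 * int (m (c (Suc i))) = 2 * zsum m f" for i using zsum_add[of m i] z[of i] z[of "Suc i"] by simp
    then have *: "m (c (Suc i)) = nat (zsum m f)" for i by (metis mult_cancel_left nat_int zero_neq_numeral)
    have const: "m (c i) = nat (zsum m f)" for i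
      using *[of "i + 2 * n"] c_periodic[of i] by simp
    have "0 < nat (zsum m f)" using pos[of 0] const[of 0] by simp
    then show ?thesis by (rule heavy_constant_cycle[rotated 2]) (fact const hv off)+
  qed
qed

text \<open>Edges are taken out until \<open>s\<close> is used up or the cycle splits off. In the
  second case the edges taken out before return to the heavy remainder, so a single copy of the
  cycle is separated.\<close>

lemma heavy_decompose:
  assumes "heavy E s m"
  shows "packs E s m \<or> (n + 1 \<le> s \<and> (\<exists>m'. m = add_set m' (range c) \<and> heavy E (s - (n + 1)) m'))"
  using assms
proof (induction s arbitrary: m)
  case (Suc s)
  from heavy_Suc_cases[OF Suc.prems] show ?case
  proof (elim disjE bexE exE conjE)
    fix e m' assume e: "e \<in> E" "m = add_set m' e" "heavy E s m'"
    from Suc.IH[OF e(3)] show ?case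
    proof (elim disjE exE conjE)
      assume "packs E s m'" then show ?case using e packs_Suc_iff by blast
    next
      fix m'' assume m'': "n + 1 \<le> s" "m' = add_set m'' (range c)" "heavy E (s - (n + 1)) m''"
      have "m = add_set (add_set m'' e) (range c)" using e(2) m''(2) by (auto simp: fun_eq_iff)
      moreover have "heavy E (Suc (s - (n + 1))) (add_set m'' e)" by (rule heavy_add_edge[OF m''(3) e(1)])
      then have "heavy E (Suc s - (n + 1)) (add_set m'' e)" using m''(1) by (simp add: Suc_diff_Suc)
      ultimately show ?case using m''(1) by (intro disjI2) auto
    qed
  qed auto
qed simp

end

section \<open>Small edge covers of the cycle\<close>

context odd_unicyclic
begin

lemma edge_degree_p:
  "edge_degree E a v = a (ed v) + (\<Sum>w | p w = v. a (ed w))"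
proof -
  have "edge_degree E a v = (\<Sum>w\<in>UNIV. a (ed w) * of_bool (v \<in> ed w))"
    unfolding edge_degree_def by (rule sum_E)
  also have "\<dots> = (\<Sum>w\<in>UNIV. (if w = v then a (ed w) else 0) + (if p w = v then a (ed w) else 0))"
    using p_neq by (intro sum.cong) (auto simp: mem_ed)
  also have "\<dots> = a (ed v) + (\<Sum>w | p w = v. a (ed w))"
    by (simp add: sum.distrib sum.inter_filter[symmetric])
  finally show ?thesis .
qed

text \<open>The incidence matrix of the graph is nonsingular. Off the cycle, a vertex farthest out
  with nonzero value receives nothing from beyond and must itself vanish. On the cycle the values
  then change sign at each step, and an odd number of steps leads back to the start.\<close>

lemma vertex_sums_zero:
  fixes g :: "'v \<Rightarrow> int"
  assumes g: "\<And>v. g v + (\<Sum>w | p w = v. g w) = 0"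
  shows "g v = 0"
proof -
  have off: "g v = 0" if v: "v \<notin> range c" for v
  proof (rule ccontr)
    assume neg: "g v \<noteq> 0"
    let ?B = "{v. v \<notin> range c \<and> g v \<noteq> 0}"
    have "finite (d ` ?B)" "d ` ?B \<noteq> {}" using neg v by auto
    from Max_in[OF this] obtain u where u: "u \<in> ?B" "d u = Max (d ` ?B)" by auto
    have "g w = 0" if w: "p w = u" for w
    proof (rule ccontr)
      assume "g w \<noteq> 0"
      moreover have wc: "w \<notin> range c" using w u(1) p_range by auto
      ultimately have "d w \<le> Max (d ` ?B)" by (intro Max_ge) auto
      then show False using d_p[OF wc] w u(2) by simp
    qed
    then have "g u = 0" using g[of u] by simp
    then show False using u by simp
  qed
  have step: "g (c (Suc i)) = - g (c i)" for i
  proof -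
    have "(\<Sum>w | p w = c (Suc i). g w) = (\<Sum>w\<in>{c i}. g w)"
    proof (rule sum.mono_neutral_right)
      show "\<forall>w\<in>{w. p w = c (Suc i)} - {c i}. g w = 0"
      proof
        fix w assume w: "w \<in> {w. p w = c (Suc i)} - {c i}"
        have "w \<notin> range c"
        proof
          assume "w \<in> range c"
          then obtain j where "w = c j" by auto
          then show False using w c_Suc_inj[of j i] by (simp add: p_c)
        qed
        then show "g w = 0" by (rule off)
      qed
    qed (auto simp: p_c)
    then show ?thesis using g[of "c (Suc i)"] by simp
  qed
  have pow: "g (c i) = (-1) ^ i * g (c 0)" for i by (induction i) (simp_all add: step)
  have "g (c 0) = 0" using pow[of "2 * n + 1"] c_periodic[of 0] by simp
  then have "g (c i) = 0" for i by (simp add: pow[of i])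
  then show ?thesis using off[of v] by (cases "v \<in> range c") auto
qed

lemma edge_degree_inj:
  assumes "edge_degree E a = edge_degree E b" "e \<in> E"
  shows "a e = b e"
proof -
  obtain v where v: "e = ed v" using assms(2) E_ed by auto
  have "int (a (ed v)) - int (b (ed v)) = 0"
  proof (rule vertex_sums_zero)
    fix v
    show "int (a (ed v)) - int (b (ed v)) + (\<Sum>w | p w = v. int (a (ed w)) - int (b (ed w))) = 0"
      using edge_degree_p[of a v] edge_degree_p[of b v] assms(1)
      by (simp add: sum_subtractf flip: of_nat_sum)
  qed
  then show ?thesis by (simp add: v)
qed

text \<open>Membership of \<open>v\<close> is decided by \<open>p v\<close>, which is closer to the
  cycle, so any choice on the cycle extends by recursion on \<open>d\<close>. The rule covers every
  edge \<open>{v, p v}\<close> off the cycle and lets it have both ends in \<open>C\<close> only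
  where \<open>Q v\<close> holds.\<close>

lemma extend_off_cycle:
  assumes "B \<subseteq> range c"
  obtains C where "C \<inter> range c = B"
    and "\<And>v. v \<notin> range c \<Longrightarrow> v \<in> C \<longleftrightarrow> Q v \<or> p v \<notin> C"
proof -
  have "\<exists>C. C \<inter> range c = B \<and> (\<forall>v. v \<notin> range c \<longrightarrow> d v < K \<longrightarrow> (v \<in> C \<longleftrightarrow> Q v \<or> p v \<notin> C))" for K
  proof (induction K)
    case 0
    show ?case using assms by (intro exI[of _ B]) auto
  next
    case (Suc K)
    then obtain C where C: "C \<inter> range c = B"
      "\<And>v. v \<notin> range c \<Longrightarrow> d v < K \<Longrightarrow> v \<in> C \<longleftrightarrow> Q v \<or> p v \<notin> C" by blast
    let ?C = "{v \<in> C. v \<in> range c \<or> d v < K} \<union> {v. v \<notin> range c \<and> d v = K \<and> (Q v \<or> p v \<notin> C)}"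
    have "v \<in> ?C \<longleftrightarrow> Q v \<or> p v \<notin> ?C" if v: "v \<notin> range c" "d v < Suc K" for v
    proof -
      have "p v \<in> ?C \<longleftrightarrow> p v \<in> C" using d_p[OF v(1)] v(2) by auto
      then show ?thesis using C(2)[OF v(1)] v by (cases "d v = K") auto
    qed
    moreover have "?C \<inter> range c = B" using C(1) by auto
    ultimately show ?case by (intro exI[of _ ?C]) blast
  qed
  then obtain C where C: "C \<inter> range c = B"
    "\<And>v. v \<notin> range c \<Longrightarrow> d v < Suc (Max (range d)) \<Longrightarrow> v \<in> C \<longleftrightarrow> Q v \<or> p v \<notin> C" by meson
  have "d v < Suc (Max (range d))" for v by (simp add: less_Suc_eq_le)
  then show ?thesis using that C by blast
qed

section \<open>Covers of the cycle inside the support of a multiset of edges\<close>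

definition covers_cycle :: "'v set set \<Rightarrow> bool" where
  "covers_cycle L \<longleftrightarrow> (\<forall>x\<in>range c. \<exists>e\<in>L. x \<in> e)"

text \<open>For even \<open>i\<close> up to 2n, this is the perfect matching of the path left when
  position \<open>i\<close> is deleted: positions 2k and 2k + 1 are joined below \<open>i\<close>,
  positions 2k + 1 and 2k + 2 above it. One edge through position \<open>i\<close> completes it to a
  cover of the cycle.\<close>

definition near_matching :: "nat \<Rightarrow> nat \<Rightarrow> 'v set set" where
  "near_matching f i = (\<lambda>k. ed (c (f + (if 2 * k < i then 2 * k else 2 * k + 1)))) ` {..<n}"

lemma card_near_matching: "card (near_matching f i) \<le> n"
  unfolding near_matching_def by (rule le_trans[OF card_image_le]) auto

lemma near_matching_covers:
  assumes "even i" "i \<le> 2 * n" "c (f + i) \<in> e"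
  shows "covers_cycle (insert e (near_matching f i))"
  unfolding covers_cycle_def
proof
  fix x assume "x \<in> range c"
  then obtain k where k: "k < 2 * n + 1" "x = c (f + k)" by (rule c_cases)
  obtain i' where i': "i = 2 * i'" using assms(1) by (rule evenE)
  consider "k < i" | "k = i" | "i < k" by linarith
  then show "\<exists>e\<in>insert e (near_matching f i). x \<in> e"
  proof cases
    case 1
    let ?k = "k div 2"
    have lt: "2 * ?k < i" "?k < n" using 1 assms(2) i' by auto
    then have "ed (c (f + 2 * ?k)) \<in> near_matching f i"
      unfolding near_matching_def by (intro image_eqI[of _ _ ?k]) auto
    moreover have "k = 2 * ?k \<or> k = Suc (2 * ?k)" by presburger
    then have "x \<in> ed (c (f + 2 * ?k))" unfolding k(2) ed_def p_c by (metis add_Suc_right insertCI)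
    ultimately show ?thesis by blast
  next
    case 2 then show ?thesis using assms(3) k by blast
  next
    case 3
    let ?k = "(k - 1) div 2"
    have lt: "\<not> 2 * ?k < i" "?k < n" using 3 k i' by auto
    then have "ed (c (f + (2 * ?k + 1))) \<in> near_matching f i"
      unfolding near_matching_def by (intro image_eqI[of _ _ ?k]) auto
    moreover have "k = 2 * ?k + 1 \<or> k = Suc (2 * ?k + 1)" using 3 by presburger
    then have "x \<in> ed (c (f + (2 * ?k + 1)))" unfolding k(2) ed_def p_c by (metis add_Suc_right insertCI)
    ultimately show ?thesis by blast
  qed
qed

lemma card_covers_cycle:
  assumes "L \<subseteq> E" "covers_cycle L"
  shows "n + 1 \<le> card L"
proof -
  have "range c \<subseteq> \<Union>L" using assms(2) by (auto simp: covers_cycle_def)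
  then have "2 * n + 1 \<le> card (\<Union>L)" using card_mono[of "\<Union>L" "range c"] by (simp add: card_range_c)
  also have "\<dots> \<le> sum card L" by (rule card_Union_le_sum_card)
  also have "\<dots> = 2 * card L" using card_edge assms(1) by (simp add: subset_iff)
  finally show ?thesis by linarith
qed

end

lemma sum_of_bool_mem: "finite A \<Longrightarrow> (\<Sum>x\<in>A. of_bool (x \<in> B)) = card (A \<inter> B)"
  by (simp add: of_bool_def sum.If_cases)

context odd_unicyclic
begin

lemma card_cycle_Int: "2 * card (range c \<inter> C) = (\<Sum>k<2 * n + 1. of_bool (c (f + k) \<in> C) + of_bool (c (f + Suc k) \<in> C))"
proof -
  let ?g = "\<lambda>v. of_bool (v \<in> C) :: nat"
  have "card (range c \<inter> C) = sum ?g (range c)" by (simp add: of_bool_def sum.If_cases)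
  then show ?thesis
    using sum_cycle[of ?g f] sum_cycle[of ?g "Suc f"] by (simp add: sum.distrib)
qed

text \<open>The three edges would be the only doubled cycle edges of a cover all of whose doubled edges have
  multiplicity zero; such a cover contains \<open>n + 2\<close> vertices of the cycle, which makes it too light.\<close>

lemma no_three_doubled:
  assumes t: "sum a E = t" "n + 1 \<le> t"
    and a: "edge_degree E a = add_set m' (range c)" "heavy E (t - (n + 1)) m'"
    and ij: "even i" "odd j" "i < j" "j < 2 * n"
    and zero: "a (ed (c (f + i))) = 0" "a (ed (c (f + j))) = 0" "a (ed (c (f + 2 * n))) = 0"
  shows False
proof -
  \<comment> \<open>The parity of the chosen positions changes after \<open>i\<close> and again
    after \<open>j\<close>. So exactly the edges at \<open>i\<close>, \<open>j\<close> and the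
    closing edge at 2n have both ends chosen.\<close>
  define P where "P k \<longleftrightarrow> (if i < k \<and> k \<le> j then odd k else even k)" for k
  define B where "B = {c (f + k) |k. k < 2 * n + 1 \<and> P k}"
  have "B \<subseteq> range c" by (auto simp: B_def)
  then obtain C where C: "C \<inter> range c = B"
    and off: "\<And>v. v \<notin> range c \<Longrightarrow> v \<in> C \<longleftrightarrow> a (ed v) = 0 \<or> p v \<notin> C"
    using extend_off_cycle[of B "\<lambda>v. a (ed v) = 0"] by blast
  have mem: "c (f + k) \<in> C \<longleftrightarrow> P k" if "k < 2 * n + 1" for k
  proof -
    have "c (f + k) \<in> C \<longleftrightarrow> c (f + k) \<in> B" using C by blast
    also have "\<dots> \<longleftrightarrow> P k" unfolding B_def using c_add_eq_iff[OF that] that by auto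
    finally show ?thesis .
  qed
  have last: "c (f + Suc (2 * n)) = c (f + 0)" using c_periodic[of f] by simp
  have P0: "P 0" and Pn: "P (2 * n)" using ij by (auto simp: P_def)
  have memS: "c (f + Suc k) \<in> C \<longleftrightarrow> (if k = 2 * n then True else P (Suc k))" if "k < 2 * n + 1" for k
    using mem[of 0] mem[of "Suc k"] P0 that last by (cases "k = 2 * n") auto
  have PS: "P (Suc k) \<longleftrightarrow> \<not> P k \<or> k = i \<or> k = j" for k
  proof -
    consider "k = i" | "k = j" | "i < Suc k \<longleftrightarrow> i < k" "Suc k \<le> j \<longleftrightarrow> k \<le> j" "k \<noteq> i" "k \<noteq> j" by linarith
    then show ?thesis using ij by cases (simp_all add: P_def)
  qed
  have Pi: "P i" "P j" using ij by (auto simp: P_def)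
  have dbl: "c (f + k) \<in> C \<and> c (f + Suc k) \<in> C \<longleftrightarrow> k \<in> {i, j, 2 * n}"
    and one: "c (f + k) \<in> C \<or> c (f + Suc k) \<in> C" if "k < 2 * n + 1" for k
    using mem[OF that] memS[OF that] PS[of k] Pi Pn by (auto split: if_splits)
  have edc: "v \<in> C \<or> p v \<in> C" for v
  proof (cases "v \<in> range c")
    case True
    then obtain k where "k < 2 * n + 1" "v = c (f + k)" by (rule c_cases)
    then show ?thesis using one[of k] by (simp add: p_c)
  qed (use off in blast)
  then have cov: "vertex_cover E C" by (simp add: cover_iff)
  have dz: "a (ed v) = 0" if "v \<in> C" "p v \<in> C" for v
  proof (cases "v \<in> range c")
    case True
    then obtain k where k: "k < 2 * n + 1" "v = c (f + k)" by (rule c_cases)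
    then have "k \<in> {i, j, 2 * n}" using dbl[OF k(1)] that by (simp add: p_c)
    then show ?thesis using zero k by auto
  qed (use off that in blast)
  \<comment> \<open>Every edge of positive multiplicity meets \<open>C\<close> in one vertex, so by
    double counting \<open>C\<close> has weight exactly \<open>t\<close>.\<close>
  have "a e * card (e \<inter> C) = a e" if eE: "e \<in> E" for e
  proof -
    obtain v where v: "e = ed v" using eE unfolding E_ed by blast
    show ?thesis
    proof (cases "v \<in> C \<and> p v \<in> C")
      case True then show ?thesis using dz v by simp
    next
      case False
      then have "e \<inter> C = {v} \<or> e \<inter> C = {p v}" using edc[of v] by (auto simp: v ed_def)
      then show ?thesis by auto
    qed
  qed
  then have "(\<Sum>e\<in>E. a e * card (e \<inter> C)) = sum a E" by (rule sum.cong[OF refl])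
  then have "sum (edge_degree E a) C = t" by (simp only: sum_edge_degree t(1))
  moreover have "sum (edge_degree E a) C = sum m' C + card (range c \<inter> C)"
    unfolding a(1) by (rule sum_add_set)
  moreover have "t - (n + 1) \<le> sum m' C" using a(2) cov by (simp add: heavy_def)
  \<comment> \<open>All 2n + 1 cycle edges are met and three of them twice, so the cycle vertices in
    \<open>C\<close> are counted at least 2n + 4 times, each of them twice.\<close>
  moreover have "n + 2 \<le> card (range c \<inter> C)"
  proof -
    have sub: "{i, j, 2 * n} \<subseteq> {..<2 * n + 1}" "card {i, j, 2 * n} = 3" using ij by auto
    have "2 * n + 1 + 3 = (\<Sum>k<2 * n + 1. 1 + of_bool (k \<in> {i, j, 2 * n}))"
      unfolding sum.distrib sum_of_bool_mem[OF finite_lessThan] Int_absorb1[OF sub(1)] sub(2) by simp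
    also have "\<dots> \<le> (\<Sum>k<2 * n + 1. of_bool (c (f + k) \<in> C) + of_bool (c (f + Suc k) \<in> C))"
    proof (rule sum_mono)
      fix k assume "k \<in> {..<2 * n + 1}"
      then have "k < 2 * n + 1" by simp
      from dbl[OF this] one[OF this]
      show "1 + of_bool (k \<in> {i, j, 2 * n}) \<le> (of_bool (c (f + k) \<in> C) + of_bool (c (f + Suc k) \<in> C) :: nat)"
        by (cases "c (f + k) \<in> C"; cases "c (f + Suc k) \<in> C") simp_all
    qed
    also have "\<dots> = 2 * card (range c \<inter> C)" by (rule card_cycle_Int[symmetric])
    finally show ?thesis by linarith
  qed
  ultimately show False using t(2) by linarith
qed

text \<open>Let \<open>i\<close> be the first even position whose edge has multiplicity zero, or 2n.
  The edges at even positions below \<open>i\<close> are present by minimality, those at odd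
  positions above \<open>i\<close> by \<open>no_three_doubled\<close>, so the support contains the
  near matching that omits \<open>i\<close>. The vertex at \<open>i\<close> has positive degree
  because the cycle is contained in the degree vector.\<close>

lemma small_cover_in_support:
  assumes t: "sum a E = t" "n + 1 \<le> t"
    and a: "edge_degree E a = add_set m' (range c)" "heavy E (t - (n + 1)) m'"
  shows "\<exists>L\<subseteq>{e \<in> E. 0 < a e}. card L \<le> n + 1 \<and> covers_cycle L"
proof -
  \<comment> \<open>The rotation puts a cycle edge of multiplicity zero, if there is one, on the
    closing edge from position 2n to position 0.\<close>
  obtain f where f: "a (ed (c (f + 2 * n))) = 0 \<or> (\<forall>k. 0 < a (ed (c k)))"
  proof (cases "\<forall>k. 0 < a (ed (c k))")
    case False
    then obtain k where k: "a (ed (c k)) = 0" by auto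
    have "c (Suc k + 2 * n) = c k" using c_periodic[of k] by simp
    then show ?thesis using that[of "Suc k"] k by simp
  next
    case True then show ?thesis using that[of 0] by blast
  qed
  define i where "i = (LEAST i. even i \<and> (i = 2 * n \<or> a (ed (c (f + i))) = 0))"
  have ex: "even (2 * n) \<and> (2 * n = 2 * n \<or> a (ed (c (f + 2 * n))) = 0)" by simp
  have i: "even i" "i = 2 * n \<or> a (ed (c (f + i))) = 0"
    using LeastI[where P = "\<lambda>i. even i \<and> (i = 2 * n \<or> a (ed (c (f + i))) = 0)", OF ex] unfolding i_def by auto
  have i2n: "i \<le> 2 * n" unfolding i_def by (rule Least_le) (rule ex)
  have small: "0 < a (ed (c (f + k)))" if "even k" "k < i" for k
    using not_less_Least[of k "\<lambda>i. even i \<and> (i = 2 * n \<or> a (ed (c (f + i))) = 0)"] that i2n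
    unfolding i_def by auto
  have large: "0 < a (ed (c (f + k)))" if "odd k" "i < k" "k < 2 * n" for k
  proof (rule ccontr)
    assume neg: "\<not> ?thesis"
    from f have "a (ed (c (f + 2 * n))) = 0"
    proof
      assume "\<forall>k. 0 < a (ed (c k))"
      from spec[OF this, of "f + k"] show ?thesis using neg by simp
    qed
    moreover have "a (ed (c (f + i))) = 0" using i(2) that by auto
    ultimately show False using no_three_doubled[OF t a i(1) that] neg by simp
  qed
  have "edge_degree E a (c (f + i)) \<noteq> 0" unfolding a(1) by simp
  then obtain e where e: "e \<in> E" "a e * of_bool (c (f + i) \<in> e) \<noteq> 0"
    unfolding edge_degree_def by (rule sum.not_neutral_contains_not_neutral)
  then have e': "0 < a e" "c (f + i) \<in> e" by (auto split: if_splits)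
  let ?L = "insert e (near_matching f i)"
  have "near_matching f i \<subseteq> {e \<in> E. 0 < a e}"
    unfolding near_matching_def
  proof (rule image_subsetI)
    fix k assume k: "k \<in> {..<n}"
    let ?k = "if 2 * k < i then 2 * k else 2 * k + 1"
    have "0 < a (ed (c (f + ?k)))"
    proof (cases "2 * k < i")
      case True then show ?thesis using small[of "2 * k"] by simp
    next
      case False then show ?thesis using large[of "2 * k + 1"] k by simp
    qed
    then show "ed (c (f + ?k)) \<in> {e \<in> E. 0 < a e}" using ed_in_E by blast
  qed
  then have "?L \<subseteq> {e \<in> E. 0 < a e}" using e e' by blast
  moreover have "card ?L \<le> n + 1"
    using card_insert_le_m1[of "n + 1"] card_near_matching[of f i] by (simp add: card_insert_if near_matching_def)
  ultimately show ?thesis using near_matching_covers[OF i(1) i2n e'(2)] by blast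
qed

text \<open>Take one copy of each edge of \<open>L\<close> out of the multiset. These edges account
  for the cycle, and the at least t - (n + 1) remaining edges pack into what is left.\<close>

lemma cover_in_support_imp:
  assumes t: "sum a E = t" "n + 1 \<le> t"
    and L: "L \<subseteq> {e \<in> E. 0 < a e}" "card L \<le> n + 1" "covers_cycle L"
  shows "\<exists>m'. edge_degree E a = add_set m' (range c) \<and> heavy E (t - (n + 1)) m'"
proof -
  let ?b = "\<lambda>e. of_bool (e \<in> L) :: nat" and ?a = "\<lambda>e. a e - of_bool (e \<in> L)"
  let ?m = "\<lambda>v. edge_degree E a v - of_bool (v \<in> range c)"
  have aeq: "a e = ?a e + ?b e" for e using L(1) by auto
  have deg: "edge_degree E a v = edge_degree E ?a v + edge_degree E ?b v" for v
    unfolding edge_degree_add[symmetric] using aeq by simp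
  have ge: "of_bool (v \<in> range c) \<le> edge_degree E ?b v" for v
  proof (cases "v \<in> range c")
    case True
    then obtain e where e: "e \<in> L" "v \<in> e" using L(3) by (auto simp: covers_cycle_def)
    then have "?b e * of_bool (v \<in> e) \<le> edge_degree E ?b v"
      unfolding edge_degree_def using L(1) by (intro member_le_sum) auto
    then show ?thesis using e by simp
  qed simp
  have "sum a E = sum ?a E + sum ?b E" unfolding sum.distrib[symmetric] using aeq by simp
  also have "sum ?b E = card L"
    using L(1) by (subst sum_of_bool_mem) (auto intro: arg_cong[where f = card])
  finally have "t - (n + 1) \<le> sum ?a E" using t L(2) by linarith
  moreover have "heavy E (sum ?a E) ?m"
  proof (rule packs_imp_heavy)
    have "edge_degree E ?a v \<le> ?m v" for v using deg[of v] ge[of v] by linarith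
    then show "packs E (sum ?a E) ?m" unfolding packs_def by blast
  qed
  ultimately have "heavy E (t - (n + 1)) ?m" unfolding heavy_def using le_trans by blast
  moreover have "edge_degree E a = add_set ?m (range c)"
    using deg ge by (intro ext) (metis le_add_diff_inverse2 trans_le_add2)
  ultimately show ?thesis by (intro exI conjI)
qed

end

section \<open>Minimal exponents\<close>

definition min_elems :: "'a::order set \<Rightarrow> 'a set" where
  "min_elems A = {m \<in> A. \<forall>m'\<in>A. m' \<le> m \<longrightarrow> m' = m}"

lemma min_elems_below:
  fixes A :: "('v::finite \<Rightarrow> nat) set"
  assumes "m \<in> A"
  obtains m0 where "m0 \<in> min_elems A" "m0 \<le> m"
proof -
  have "\<exists>m0\<in>min_elems A. m0 \<le> m"
    using assms
  proof (induction "sum m UNIV" arbitrary: m rule: less_induct)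
    case less
    show ?case
    proof (cases "m \<in> min_elems A")
      case False
      then obtain m' where m': "m' \<in> A" "m' \<le> m" "m' \<noteq> m" using less.prems by (auto simp: min_elems_def)
      then obtain v where "m' v \<noteq> m v" by auto
      then have "m' v < m v" using m'(2) by (simp add: le_fun_def le_neq_implies_less)
      then have "sum m' UNIV < sum m UNIV" using m'(2) by (intro sum_strict_mono_ex1) (auto simp: le_fun_def)
      from less.hyps[OF this m'(1)] show ?thesis using m'(2) order_trans by blast
    qed auto
  qed
  then show ?thesis using that by blast
qed

lemma packs_total:
  assumes two: "\<And>e. e \<in> E \<Longrightarrow> card e = 2" and "packs E s m"
  shows "2 * s \<le> sum m UNIV"
proof -
  obtain a where a: "sum a E = s" "\<And>v. edge_degree E a v \<le> m v"
    using assms(2) unfolding packs_def by blast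
  have "sum (edge_degree E a) UNIV = (\<Sum>e\<in>E. a e * 2)"
    unfolding sum_edge_degree by (intro sum.cong) (simp_all add: two)
  then have "2 * s = sum (edge_degree E a) UNIV" using a(1) by (simp add: sum_distrib_right[symmetric])
  then show ?thesis using sum_mono[of UNIV "edge_degree E a" m] a(2) by simp
qed

lemma finite_bounded_sum: "finite {m :: 'v::finite \<Rightarrow> nat. sum m UNIV \<le> k}"
proof (rule finite_subset)
  have "m v \<le> sum m UNIV" for m :: "'v \<Rightarrow> nat" and v by (rule member_le_sum) auto
  then show "{m :: 'v \<Rightarrow> nat. sum m UNIV \<le> k}
      \<subseteq> {m. \<forall>v. (v \<in> UNIV \<longrightarrow> m v \<in> {..k}) \<and> (v \<notin> UNIV \<longrightarrow> m v = 0)}"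
    using order_trans by fastforce
qed (rule finite_set_of_finite_funs; simp)

text \<open>Multiplicity functions are set to 0 outside \<open>S\<close>, so that equal multisets
  are equal functions and can be counted.\<close>

definition multisets_on :: "'a set \<Rightarrow> nat \<Rightarrow> ('a \<Rightarrow> nat) set" where
  "multisets_on S t = {a. sum a S = t \<and> (\<forall>e. e \<notin> S \<longrightarrow> a e = 0)}"

section \<open>Minimal exponents of the symbolic powers and of the defect\<close>

context odd_unicyclic
begin

definition defect_set :: "nat \<Rightarrow> ('v \<Rightarrow> nat) set" where
  "defect_set s = {m. heavy E s m \<and> \<not> packs E s m}"

lemma heavy_add_cycle:
  assumes "heavy E r m" "s \<le> r + (n + 1)"
  shows "heavy E s (add_set m (range c))"
  unfolding heavy_def sum_add_set
proof (intro allI impI)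
  fix C assume C: "vertex_cover E C"
  then have "r \<le> sum m C" using assms(1) by (simp add: heavy_def)
  then show "s \<le> sum m C + card (range c \<inter> C)" using card_cover_cycle[OF C] assms(2) by linarith
qed

lemma add_cycle_le_iff: "add_set m (range c) \<le> add_set m' (range c) \<longleftrightarrow> m \<le> m'"
  by (simp add: le_fun_def)

lemma add_cycle_eq_iff: "add_set m (range c) = add_set m' (range c) \<longleftrightarrow> m = m'"
  by (simp add: fun_eq_iff)

lemma sum_add_cycle: "sum (add_set m (range c)) UNIV = sum m UNIV + (2 * n + 1)"
  by (simp only: sum_add_set Int_UNIV_right card_range_c)

lemma edge_degree_heavy: "sum a E = t \<Longrightarrow> heavy E t (edge_degree E a)"
  by (rule packs_imp_heavy) (auto simp: packs_def)

lemma sum_edge_degree_UNIV: "sum (edge_degree E a) UNIV = 2 * sum a E"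
proof -
  have "sum (edge_degree E a) UNIV = (\<Sum>e\<in>E. a e * 2)"
    unfolding sum_edge_degree by (intro sum.cong) (simp_all add: card_edge)
  then show ?thesis by (simp add: sum_distrib_right[symmetric])
qed

lemma min_heavy_cases:
  assumes m: "m \<in> min_elems {m. heavy E t m}"
  shows "(\<exists>a. sum a E = t \<and> m = edge_degree E a) \<or>
    (n + 1 \<le> t \<and> (\<exists>m'\<in>min_elems {m. heavy E (t - (n + 1)) m}. m = add_set m' (range c)))"
proof -
  have hv: "heavy E t m" and min: "\<And>m'. heavy E t m' \<Longrightarrow> m' \<le> m \<Longrightarrow> m' = m"
    using m by (auto simp: min_elems_def)
  from heavy_decompose[OF hv] show ?thesis
  proof
    assume "packs E t m"
    then obtain a where a: "sum a E = t" "edge_degree E a \<le> m" by (auto simp: packs_def le_fun_def)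
    then show ?thesis using min[OF edge_degree_heavy] by blast
  next
    assume "n + 1 \<le> t \<and> (\<exists>m'. m = add_set m' (range c) \<and> heavy E (t - (n + 1)) m')"
    then obtain m' where m': "n + 1 \<le> t" "m = add_set m' (range c)" "heavy E (t - (n + 1)) m'" by blast
    have "m'' = m'" if "heavy E (t - (n + 1)) m''" "m'' \<le> m'" for m''
    proof -
      have "add_set m'' (range c) = m"
        by (rule min[OF heavy_add_cycle[OF that(1)]]) (use that(2) m' in \<open>auto simp: le_fun_def\<close>)
      then show ?thesis using m'(2) add_cycle_eq_iff by simp
    qed
    then have "m' \<in> min_elems {m. heavy E (t - (n + 1)) m}" using m'(3) by (auto simp: min_elems_def)
    then show ?thesis using m' by blast
  qed
qed

text \<open>A step from t - (n + 1) to t allows 2n + 2 more units of degree, and the cycle uses only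
  2n + 1 of them.\<close>

lemma min_heavy_total: "m \<in> min_elems {m. heavy E t m} \<Longrightarrow> sum m UNIV \<le> 2 * t"
proof (induction t arbitrary: m rule: less_induct)
  case (less t)
  from min_heavy_cases[OF less.prems] show ?case
  proof (elim disjE conjE exE bexE)
    fix m' assume "n + 1 \<le> t" "m' \<in> min_elems {m. heavy E (t - (n + 1)) m}" "m = add_set m' (range c)"
    then show ?thesis using less.IH[of "t - (n + 1)" m'] sum_add_cycle[of m'] by simp
  qed (simp add: sum_edge_degree_UNIV)
qed

lemma finite_min_heavy: "finite (min_elems {m. heavy E t m})"
  by (rule finite_subset[OF _ finite_bounded_sum[of "2 * t"]]) (use min_heavy_total in auto)

lemma add_cycle_not_packs:
  assumes "m \<in> min_elems {m. heavy E t m}"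
  shows "\<not> packs E (t + (n + 1)) (add_set m (range c))"
proof
  assume "packs E (t + (n + 1)) (add_set m (range c))"
  from packs_total[OF card_edge this] show False
    using min_heavy_total[OF assms] sum_add_cycle[of m] by simp
qed

text \<open>Vectors below one that does not pack do not pack either, so minimality within the defect
  is minimality among all heavy vectors.\<close>

lemma min_defect_set:
  "min_elems (defect_set s) = {m \<in> min_elems {m. heavy E s m}. \<not> packs E s m}"
proof -
  have "m' \<notin> {m. packs E s m}" if "\<not> packs E s m" "m' \<le> m" for m m'
    using that packs_mono[of E s m' m] by (auto simp: le_fun_def)
  then show ?thesis unfolding min_elems_def defect_set_def by blast
qed

lemma defect_set_empty: "s \<le> n \<Longrightarrow> defect_set s = {}"
  using heavy_decompose by (fastforce simp: defect_set_def)

lemma min_defect_set_shift: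
  assumes "n + 1 \<le> s"
  shows "min_elems (defect_set s) = (\<lambda>m. add_set m (range c)) ` min_elems {m. heavy E (s - (n + 1)) m}"
proof (intro equalityI subsetI)
  fix m assume m: "m \<in> min_elems (defect_set s)"
  then have np: "\<not> packs E s m" and "m \<in> min_elems {m. heavy E s m}" by (auto simp: min_defect_set)
  from min_heavy_cases[OF this(2)] np show "m \<in> (\<lambda>m. add_set m (range c)) ` min_elems {m. heavy E (s - (n + 1)) m}"
    by (auto simp: packs_def)
next
  fix m assume "m \<in> (\<lambda>m. add_set m (range c)) ` min_elems {m. heavy E (s - (n + 1)) m}"
  then obtain w where w: "w \<in> min_elems {m. heavy E (s - (n + 1)) m}" "m = add_set w (range c)" by blast
  have np: "\<not> packs E s m" using add_cycle_not_packs[OF w(1)] w(2) assms by simp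
  have "heavy E s m" using w heavy_add_cycle[of "s - (n + 1)" w s] by (auto simp: min_elems_def)
  moreover have "m' = m" if m': "heavy E s m'" "m' \<le> m" for m'
  proof -
    \<comment> \<open>Anything heavy below \<open>m\<close> does not pack either and so contains the
      cycle; the comparison descends to \<open>w'\<close> and \<open>w\<close>.\<close>
    have "\<not> packs E s m'" using np packs_mono[of E s m' m] m'(2) by (auto simp: le_fun_def)
    then obtain w' where w': "m' = add_set w' (range c)" "heavy E (s - (n + 1)) w'"
      using heavy_decompose[OF m'(1)] by blast
    have "w' \<le> w" using m'(2) unfolding w'(1) w(2) add_cycle_le_iff .
    then have "w' = w" using w(1) w'(2) by (auto simp: min_elems_def)
    then show ?thesis using w w' by simp
  qed
  ultimately show "m \<in> min_elems (defect_set s)" using np unfolding min_defect_set by (auto simp: min_elems_def)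
qed

lemma card_min_defect_set_shift:
  assumes "n + 1 \<le> s"
  shows "card (min_elems (defect_set s)) = card (min_elems {m. heavy E (s - (n + 1)) m})"
  unfolding min_defect_set_shift[OF assms]
  by (rule card_image) (auto simp: inj_on_def add_cycle_eq_iff)

text \<open>A cycle plus a minimal vector below the product would have degree at most 2t - 1, so the
  product is not minimal. Conversely, a heavy vector below the product either packs, and then has
  the same degree 2t, or contains the cycle, and then so does the product.\<close>

lemma edge_degree_min_iff:
  assumes "sum a E = t"
  shows "edge_degree E a \<in> min_elems {m. heavy E t m} \<longleftrightarrow>
    \<not> (n + 1 \<le> t \<and> (\<exists>m'. edge_degree E a = add_set m' (range c) \<and> heavy E (t - (n + 1)) m'))"
    (is "?min \<longleftrightarrow> \<not> ?bad")
proof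
  assume ?min
  show "\<not> ?bad"
  proof
    assume ?bad
    then obtain m' where m': "n + 1 \<le> t" "edge_degree E a = add_set m' (range c)" "heavy E (t - (n + 1)) m'" by blast
    obtain w where w: "w \<in> min_elems {m. heavy E (t - (n + 1)) m}" "w \<le> m'"
      using min_elems_below[of m' "{m. heavy E (t - (n + 1)) m}"] m'(3) by auto
    have "heavy E t (add_set w (range c))" using heavy_add_cycle[of "t - (n + 1)" w t] w(1) by (auto simp: min_elems_def)
    moreover have "add_set w (range c) \<le> edge_degree E a" unfolding m'(2) add_cycle_le_iff by (rule w(2))
    ultimately have "add_set w (range c) = edge_degree E a" using \<open>?min\<close> by (auto simp: min_elems_def)
    then have "2 * t = sum w UNIV + (2 * n + 1)"
      by (metis sum_add_cycle sum_edge_degree_UNIV assms)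
    then show False using min_heavy_total[OF w(1)] m'(1) by linarith
  qed
next
  assume good: "\<not> ?bad"
  have "m' = edge_degree E a" if m': "heavy E t m'" "m' \<le> edge_degree E a" for m'
  proof -
    have "packs E t m'"
    proof (rule ccontr)
      assume "\<not> packs E t m'"
      then obtain w where w: "n + 1 \<le> t" "m' = add_set w (range c)" "heavy E (t - (n + 1)) w"
        using heavy_decompose[OF m'(1)] by blast
      let ?w = "\<lambda>v. edge_degree E a v - of_bool (v \<in> range c)"
      have le: "w v + of_bool (v \<in> range c) \<le> edge_degree E a v" for v
        using le_funD[OF m'(2), of v] w(2) by simp
      have "edge_degree E a = add_set ?w (range c)"
        by (intro ext le_add_diff_inverse2[symmetric] add_leD2[OF le])
      moreover have "heavy E (t - (n + 1)) ?w"
        by (rule heavy_mono[OF w(3)]) (rule add_le_imp_le_diff[OF le])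
      ultimately show False using good w(1) by simp
    qed
    from packs_total[OF card_edge this] have "2 * t \<le> sum m' UNIV" .
    then have eq: "sum m' UNIV = sum (edge_degree E a) UNIV"
      using sum_mono[of UNIV m' "edge_degree E a"] m'(2) sum_edge_degree_UNIV[of a] assms
      by (simp add: le_fun_def)
    show ?thesis
    proof (rule ccontr)
      assume "m' \<noteq> edge_degree E a"
      then obtain v where "m' v \<noteq> edge_degree E a v" by auto
      then have "m' v < edge_degree E a v" using m'(2) by (simp add: le_fun_def le_neq_implies_less)
      then have "sum m' UNIV < sum (edge_degree E a) UNIV"
        using m'(2) by (intro sum_strict_mono_ex1) (auto simp: le_fun_def)
      then show False using eq by simp
    qed
  qed
  then show ?min using edge_degree_heavy[OF assms] by (auto simp: min_elems_def)
qed

lemma min_heavy_packs: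
  "{m \<in> min_elems {m. heavy E t m}. packs E t m} =
    edge_degree E ` {a \<in> multisets_on E t. \<not> (n + 1 \<le> t \<and>
      (\<exists>L\<subseteq>{e \<in> E. 0 < a e}. card L \<le> n + 1 \<and> covers_cycle L))}"
proof -
  let ?bad = "\<lambda>a. n + 1 \<le> t \<and> (\<exists>m'. edge_degree E a = add_set m' (range c) \<and> heavy E (t - (n + 1)) m')"
  have bad: "?bad a \<longleftrightarrow> n + 1 \<le> t \<and> (\<exists>L\<subseteq>{e \<in> E. 0 < a e}. card L \<le> n + 1 \<and> covers_cycle L)"
    if "sum a E = t" for a
    using small_cover_in_support[OF that] cover_in_support_imp[OF that] by blast
  have "{m \<in> min_elems {m. heavy E t m}. packs E t m} = edge_degree E ` {a \<in> multisets_on E t. \<not> ?bad a}"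
  proof (intro equalityI subsetI)
    fix m assume m: "m \<in> {m \<in> min_elems {m. heavy E t m}. packs E t m}"
    then obtain a where a: "sum a E = t" "edge_degree E a \<le> m" by (auto simp: packs_def le_fun_def)
    then have meq: "edge_degree E a = m" using m edge_degree_heavy[OF a(1)] by (auto simp: min_elems_def)
    \<comment> \<open>Multiplicities outside \<open>E\<close> do not influence degrees and are reset
      to 0, as \<open>multisets_on\<close> requires.\<close>
    let ?a = "\<lambda>e. if e \<in> E then a e else 0"
    have s: "sum ?a E = t" using a(1) by simp
    have e: "edge_degree E ?a = m" unfolding meq[symmetric] edge_degree_def by (intro ext sum.cong) auto
    have "\<not> ?bad ?a" using edge_degree_min_iff[OF s] e m by simp
    moreover have "?a \<in> multisets_on E t" using s by (simp add: multisets_on_def)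
    ultimately show "m \<in> edge_degree E ` {a \<in> multisets_on E t. \<not> ?bad a}"
      using e by (intro image_eqI[of _ _ ?a]) auto
  next
    fix m assume "m \<in> edge_degree E ` {a \<in> multisets_on E t. \<not> ?bad a}"
    then obtain a where a: "sum a E = t" "\<not> ?bad a" "m = edge_degree E a" by (auto simp: multisets_on_def)
    then have "m \<in> min_elems {m. heavy E t m}" using edge_degree_min_iff[OF a(1)] by simp
    moreover have "packs E t m" using a by (auto simp: packs_def)
    ultimately show "m \<in> {m \<in> min_elems {m. heavy E t m}. packs E t m}" by simp
  qed
  also have "{a \<in> multisets_on E t. \<not> ?bad a} = {a \<in> multisets_on E t. \<not> (n + 1 \<le> t \<and>
      (\<exists>L\<subseteq>{e \<in> E. 0 < a e}. card L \<le> n + 1 \<and> covers_cycle L))}"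
    using bad by (auto simp: multisets_on_def)
  finally show ?thesis .
qed

text \<open>Minimal vectors that do not pack are the minimal defect; those that pack are degree
  vectors, and a degree vector determines its multiset. Together with
  \<open>card_min_defect_set_shift\<close> this is the recursion for the symbolic defect.\<close>

lemma card_min_heavy:
  "card (min_elems {m. heavy E t m}) = card (min_elems (defect_set t)) +
    card {a \<in> multisets_on E t. \<not> (n + 1 \<le> t \<and>
      (\<exists>L\<subseteq>{e \<in> E. 0 < a e}. card L \<le> n + 1 \<and> covers_cycle L))}" (is "_ = _ + card ?A")
proof -
  let ?M = "min_elems {m. heavy E t m}"
  have "inj_on (edge_degree E) ?A"
  proof (rule inj_onI)
    fix a b assume ab: "a \<in> ?A" "b \<in> ?A" "edge_degree E a = edge_degree E b"
    show "a = b"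
    proof
      fix e show "a e = b e"
        using edge_degree_inj[OF ab(3), of e] ab(1,2) by (cases "e \<in> E") (auto simp: multisets_on_def)
    qed
  qed
  then have c1: "card {m \<in> ?M. packs E t m} = card ?A"
    unfolding min_heavy_packs by (rule card_image)
  have "?M = {m \<in> ?M. \<not> packs E t m} \<union> {m \<in> ?M. packs E t m}" by auto
  then have "card ?M = card {m \<in> ?M. \<not> packs E t m} + card {m \<in> ?M. packs E t m}"
    using finite_min_heavy[of t] by (subst card_Un_disjoint[symmetric]) auto
  then show ?thesis unfolding c1 min_defect_set[symmetric] .
qed

end

section \<open>Counting multisets by their support\<close>

lemma finite_multisets_on: "finite S \<Longrightarrow> finite (multisets_on S t)"
proof (rule finite_subset)
  assume S: "finite S"
  show "multisets_on S t \<subseteq> {a. \<forall>e. (e \<in> S \<longrightarrow> a e \<in> {..t}) \<and> (e \<notin> S \<longrightarrow> a e = 0)}"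
    using S by (auto simp: multisets_on_def intro: member_le_sum)
  show "finite {a. \<forall>e. (e \<in> S \<longrightarrow> a e \<in> {..t}) \<and> (e \<notin> S \<longrightarrow> a e = 0)}"
    by (rule finite_set_of_finite_funs) (use S in simp_all)
qed

text \<open>Stars and bars: along an enumeration of \<open>S\<close>, multiplicity functions become
  lists of given length and sum.\<close>

lemma card_multisets_on:
  assumes "finite S"
  shows "card (multisets_on S t) = multichoose (card S) (int t)"
proof -
  obtain es where es: "set es = S" "distinct es" using finite_distinct_list[OF assms] by blast
  have len: "length es = card S" using es distinct_card by metis
  have sum: "sum a S = sum_list (map a es)" for a :: "'a \<Rightarrow> nat"
    using es sum_list_distinct_conv_sum_set by metis
  have "bij_betw (\<lambda>a. map a es) (multisets_on S t) {l. length l = card S \<and> sum_list l = t}"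
    unfolding bij_betw_def
  proof (intro conjI equalityI subsetI)
    show "inj_on (\<lambda>a. map a es) (multisets_on S t)"
    proof (rule inj_onI)
      fix a b assume ab: "a \<in> multisets_on S t" "b \<in> multisets_on S t" "map a es = map b es"
      show "a = b"
      proof
        fix e show "a e = b e" using ab es by (cases "e \<in> S") (auto simp: multisets_on_def)
      qed
    qed
    show "l \<in> {l. length l = card S \<and> sum_list l = t}" if "l \<in> (\<lambda>a. map a es) ` multisets_on S t" for l
      using that sum len by (auto simp: multisets_on_def)
    show "l \<in> (\<lambda>a. map a es) ` multisets_on S t" if "l \<in> {l. length l = card S \<and> sum_list l = t}" for l
    proof -
      let ?a = "\<lambda>e. case map_of (zip es l) e of None \<Rightarrow> 0 | Some k \<Rightarrow> k"
      have l: "length es = length l" "sum_list l = t" using that len by auto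
      have "map ?a es = l"
        using l es(2) by (intro nth_equalityI) (simp_all add: map_of_zip_nth)
      moreover have "map_of (zip es l) e = None" if "e \<notin> S" for e
        using that es l by simp
      then have "?a \<in> multisets_on S t" using sum[of ?a] l(2) \<open>map ?a es = l\<close> by (simp add: multisets_on_def)
      ultimately show ?thesis by (intro image_eqI[of _ _ ?a]) auto
    qed
  qed
  then have "card (multisets_on S t) = card {l. length l = card S \<and> sum_list l = t}" by (rule bij_betw_same_card)
  then show ?thesis by (simp add: card_length_sum_list multichoose_def add.commute)
qed

text \<open>One copy of every element is forced and the rest is free. If \<open>S\<close> has more
  than \<open>t\<close> elements the negative argument makes \<open>multichoose\<close> vanish, in
  agreement with the count.\<close>

lemma card_multisets_support:
  assumes "finite S"
  shows "card {a \<in> multisets_on S t. {e. 0 < a e} = S} = multichoose (card S) (int t - int (card S))"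
proof (cases "card S \<le> t")
  case False
  have "card S \<le> sum a S" if "{e. 0 < a e} = S" for a :: "'a \<Rightarrow> nat"
    using that sum_mono[of S "\<lambda>_. 1" a] by auto
  then have "{a \<in> multisets_on S t. {e. 0 < a e} = S} = {}" using False by (auto simp: multisets_on_def)
  then show ?thesis using False unfolding multichoose_def by (simp only: card.empty) simp
next
  case True
  let ?f = "\<lambda>a e. a e + of_bool (e \<in> S) :: nat"
  have "bij_betw ?f (multisets_on S (t - card S)) {a \<in> multisets_on S t. {e. 0 < a e} = S}"
    unfolding bij_betw_def
  proof (intro conjI equalityI subsetI)
    show "inj_on ?f (multisets_on S (t - card S))" by (auto simp: inj_on_def fun_eq_iff)
    show "a \<in> {a \<in> multisets_on S t. {e. 0 < a e} = S}" if "a \<in> ?f ` multisets_on S (t - card S)" for a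
      using that True by (auto simp: multisets_on_def sum_Suc split: if_splits)
    show "a \<in> ?f ` multisets_on S (t - card S)" if "a \<in> {a \<in> multisets_on S t. {e. 0 < a e} = S}" for a
    proof (rule image_eqI)
      let ?b = "\<lambda>e. a e - of_bool (e \<in> S)"
      have pos: "0 < a e \<longleftrightarrow> e \<in> S" for e using that by auto
      show a: "a = ?f ?b" using pos by (intro ext) (auto simp: Suc_le_eq)
      have "sum a S = sum ?b S + card S" by (subst a) (simp add: sum_Suc)
      moreover have "sum a S = t" "\<And>e. e \<notin> S \<Longrightarrow> a e = 0" using that by (simp_all add: multisets_on_def)
      ultimately show "?b \<in> multisets_on S (t - card S)" unfolding multisets_on_def by simp
    qed
  qed
  from bij_betw_same_card[OF this]
  show ?thesis using True by (simp add: card_multisets_on[OF assms] of_nat_diff)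
qed

text \<open>Multisets are grouped by support and supports by size, which ranges from n + 1 up to the
  number of edges. This produces the sum in \<open>script_G\<close>.\<close>

lemma card_multisets_family:
  assumes E: "finite E" "card E = n + 1 + (n + l)" and F: "F \<subseteq> Pow E" "\<And>S. S \<in> F \<Longrightarrow> n + 1 \<le> card S"
  shows "card {a \<in> multisets_on E t. {e. 0 < a e} \<in> F} =
    (\<Sum>i=0..n + l. card {S \<in> F. card S = n + 1 + i} * multichoose (n + 1 + i) (int t - int (n + 1) - int i))"
proof -
  let ?A = "\<lambda>S. {a \<in> multisets_on S t. {e. 0 < a e} = S}"
  let ?g = "\<lambda>j. multichoose j (int t - int j)"
  have finF: "finite F" using F(1) E(1) by (metis finite_Pow_iff finite_subset)
  have finS: "finite S" if "S \<in> F" for S using that F(1) E(1) by (meson PowD finite_subset subsetD)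
  have finA: "finite (?A S)" if "S \<in> F" for S
    by (rule finite_subset[OF _ finite_multisets_on[OF finS[OF that]]]) blast
  have eq: "a \<in> multisets_on E t \<longleftrightarrow> a \<in> multisets_on {e. 0 < a e} t" if "{e. 0 < a e} \<subseteq> E" for a
  proof -
    have "sum a E = sum a {e. 0 < a e}" using that E(1) by (intro sum.mono_neutral_right) auto
    then show ?thesis using that by (auto simp: multisets_on_def)
  qed
  have "a \<in> {a \<in> multisets_on E t. {e. 0 < a e} \<in> F} \<longleftrightarrow> a \<in> (\<Union>S\<in>F. ?A S)" for a
  proof (cases "{e. 0 < a e} \<in> F")
    case True
    then have "{e. 0 < a e} \<subseteq> E" using F(1) by blast
    from eq[OF this] show ?thesis using True by simp
  qed auto
  then have "{a \<in> multisets_on E t. {e. 0 < a e} \<in> F} = (\<Union>S\<in>F. ?A S)" by (rule set_eqI)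
  then have "card {a \<in> multisets_on E t. {e. 0 < a e} \<in> F} = (\<Sum>S\<in>F. card (?A S))"
    using finA by (simp only:, intro card_UN_disjoint finF) auto
  also have "\<dots> = (\<Sum>S\<in>F. ?g (card S))"
    by (intro sum.cong refl card_multisets_support finS)
  also have "\<dots> = (\<Sum>j\<in>(+) (n + 1) ` {0..n + l}. \<Sum>S\<in>{S \<in> F. card S = j}. ?g (card S))"
  proof (rule sum.group[symmetric])
    have "card S \<le> n + 1 + (n + l)" if "S \<in> F" for S
      using that F(1) E card_mono[of E S] by auto
    then show "card ` F \<subseteq> (+) (n + 1) ` {0..n + l}"
      using F(2) by (auto simp: image_iff Bex_def) (metis le_Suc_ex nat_add_left_cancel_le add_Suc)
  qed (use finF in auto)
  also have "\<dots> = (\<Sum>j\<in>(+) (n + 1) ` {0..n + l}. card {S \<in> F. card S = j} * ?g j)"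
    by (intro sum.cong) auto
  also have "\<dots> = (\<Sum>i=0..n + l. card {S \<in> F. card S = n + 1 + i} * ?g (n + 1 + i))"
    by (subst sum.reindex) (auto simp: inj_on_def)
  also have "\<dots> = (\<Sum>i=0..n + l. card {S \<in> F. card S = n + 1 + i} * multichoose (n + 1 + i) (int t - int (n + 1) - int i))"
    by (intro sum.cong) (simp_all add: algebra_simps)
  finally show ?thesis .
qed

section \<open>Minimum edge covers of the cycle and the numbers \<open>cover_count\<close>\<close>

context odd_unicyclic
begin

lemma cycle_edge_cover_iff:
  "set xs = range c \<Longrightarrow> cycle_edge_cover E xs L \<longleftrightarrow> L \<subseteq> E \<and> covers_cycle L"
  by (simp add: cycle_edge_cover_def covers_cycle_def)

lemma near_matching_cycle: "near_matching f i \<subseteq> ed ` range c"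
  by (auto simp: near_matching_def)

lemma small_type_I_cover: "\<exists>L\<subseteq>ed ` range c. covers_cycle L \<and> card L \<le> n + 1"
proof (intro exI conjI)
  let ?L = "insert (ed (c 0)) (near_matching 0 0)"
  show "?L \<subseteq> ed ` range c" using near_matching_cycle by auto
  show "covers_cycle ?L" by (rule near_matching_covers) (auto simp: mem_ed)
  show "card ?L \<le> n + 1"
    using card_near_matching[of 0 0] by (simp add: card_insert_if near_matching_def)
qed

lemma off_cycle_entry: 
  assumes "v \<notin> range c"
  shows "\<exists>w. w \<notin> range c \<and> p w \<in> range c"
  using assms
proof (induction "d v" arbitrary: v rule: less_induct)
  case less
  show ?case
  proof (cases "p v \<in> range c")
    case False then show ?thesis using less.hyps[OF d_p[OF less.prems]] by blast
  qed (use less.prems in blast)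
qed

lemma ed_cycle_iff: "ed v \<in> ed ` range c \<longleftrightarrow> v \<in> range c"
  using inj_ed by (simp add: inj_image_mem_iff)

text \<open>If there are edges off the cycle, one of them is attached to it. That edge covers one
  cycle vertex, and a near matching covers the other 2n.\<close>

lemma small_type_II_cover:
  assumes "E - ed ` range c \<noteq> {}"
  shows "\<exists>L\<subseteq>E. covers_cycle L \<and> L \<inter> (E - ed ` range c) \<noteq> {} \<and> card L \<le> n + 1"
proof -
  obtain v where "ed v \<notin> ed ` range c" using assms E_ed by auto
  then obtain w f where w: "w \<notin> range c" "p w = c f" using off_cycle_entry[of v] by (auto simp: ed_cycle_iff)
  let ?L = "insert (ed w) (near_matching f 0)"
  have "ed w \<in> E - ed ` range c" using w(1) ed_in_E by (simp add: ed_cycle_iff)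
  moreover have "?L \<subseteq> E" using near_matching_cycle[of f 0] ed_in_E by auto
  moreover have "covers_cycle ?L" by (rule near_matching_covers) (auto simp: mem_ed w)
  moreover have "card ?L \<le> n + 1"
    using card_near_matching[of f 0] by (simp add: card_insert_if near_matching_def)
  ultimately show ?thesis by blast
qed

text \<open>Every cover needs n + 1 edges, and each type attains this number as soon as it has any
  cover at all. So both minima agree, and the type of a cover of that size only records whether it
  stays inside the cycle.\<close>

lemma min_cover_iff:
  assumes xs: "set xs = range c" "cycle_edges xs = ed ` range c"
  shows "type_I_min_cover E xs L \<or> type_II_min_cover E xs L \<longleftrightarrow> L \<subseteq> E \<and> covers_cycle L \<and> card L \<le> n + 1"
    (is "?lhs \<longleftrightarrow> ?rhs")
proof
  assume ?lhs
  then show ?rhs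
  proof
    assume L: "type_I_min_cover E xs L"
    obtain M where M: "M \<subseteq> ed ` range c" "covers_cycle M" "card M \<le> n + 1" using small_type_I_cover by blast
    then have "type_I_cover E xs M" using ed_in_E by (auto simp: type_I_cover_def cycle_edge_cover_iff[OF xs(1)] xs(2))
    then have "card L \<le> card M" using L unfolding type_I_min_cover_def is_arg_min_def by (meson not_less)
    then show ?rhs using L M(3) by (auto simp: type_I_min_cover_def is_arg_min_def type_I_cover_def cycle_edge_cover_iff[OF xs(1)])
  next
    assume L: "type_II_min_cover E xs L"
    then have "E - ed ` range c \<noteq> {}" by (auto simp: type_II_min_cover_def is_arg_min_def type_II_cover_def xs(2))
    then obtain M where M: "M \<subseteq> E" "covers_cycle M" "M \<inter> (E - ed ` range c) \<noteq> {}" "card M \<le> n + 1"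
      using small_type_II_cover by blast
    then have "type_II_cover E xs M" by (simp add: type_II_cover_def cycle_edge_cover_iff[OF xs(1)] xs(2))
    then have "card L \<le> card M" using L unfolding type_II_min_cover_def is_arg_min_def by (meson not_less)
    then show ?rhs using L M(4) by (auto simp: type_II_min_cover_def is_arg_min_def type_II_cover_def cycle_edge_cover_iff[OF xs(1)])
  qed
next
  assume L: ?rhs
  have min: "\<not> card M < card L" if "cycle_edge_cover E xs M" for M
    using that card_covers_cycle[of M] L by (simp add: cycle_edge_cover_iff[OF xs(1)])
  show ?lhs
  proof (cases "L \<subseteq> ed ` range c")
    case True
    then have "type_I_min_cover E xs L" using L min
      by (auto simp: type_I_min_cover_def is_arg_min_def type_I_cover_def cycle_edge_cover_iff[OF xs(1)] xs(2))
    then show ?thesis ..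
  next
    case False
    then have "type_II_min_cover E xs L" using L min
      by (auto simp: type_II_min_cover_def is_arg_min_def type_II_cover_def cycle_edge_cover_iff[OF xs(1)] xs(2))
    then show ?thesis ..
  qed
qed

lemma card_min_heavy_script_G:
  assumes xs: "set xs = range c" "cycle_edges xs = ed ` range c" and l: "l = card (E - cycle_edges xs)"
  shows "int (card (min_elems {m. heavy E t m})) = script_G E xs n l t + int (card (min_elems (defect_set t)))"
proof -
  let ?F = "{S. S \<subseteq> E \<and> (\<exists>L\<subseteq>S. card L \<le> n + 1 \<and> covers_cycle L)}"
  have "card (ed ` range c) = 2 * n + 1"
    using card_image[OF inj_on_subset[OF inj_ed subset_UNIV], of "range c"] card_range_c by simp
  moreover have "ed ` range c \<subseteq> E" using ed_in_E by auto
  ultimately have cE: "card E = n + 1 + (n + l)"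
    using card_Diff_subset[of "ed ` range c" E] card_mono[of E "ed ` range c"] l xs(2) by simp
  then have cE': "card E = 2 * n + 1 + l" by simp
  have cc: "cover_count E xs j = card {S \<in> ?F. card S = j}" for j
    unfolding cover_count_def min_cover_iff[OF xs] by (rule arg_cong[where f = card]) auto
  have supp: "{e \<in> E. 0 < a e} = {e. 0 < a e}" if "a \<in> multisets_on E t" for a
    using that by (auto simp: multisets_on_def)
  let ?good = "{a \<in> multisets_on E t. \<not> (n + 1 \<le> t \<and> (\<exists>L\<subseteq>{e \<in> E. 0 < a e}. card L \<le> n + 1 \<and> covers_cycle L))}"
  \<comment> \<open>For \<open>t \<le> n\<close> nothing is excluded. Otherwise the excluded
    multisets are those whose support lies in \<open>?F\<close>.\<close>
  have "int (card ?good) = script_G E xs n l t"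
  proof (cases "t \<le> n")
    case True
    then show ?thesis by (simp add: script_G_def card_multisets_on cE')
  next
    case False
    have "?good = multisets_on E t - {a \<in> multisets_on E t. {e. 0 < a e} \<in> ?F}"
    proof (rule set_eqI)
      fix a
      show "a \<in> ?good \<longleftrightarrow> a \<in> multisets_on E t - {a \<in> multisets_on E t. {e. 0 < a e} \<in> ?F}"
      proof (cases "a \<in> multisets_on E t")
        case True
        moreover have "{e. 0 < a e} \<subseteq> E" unfolding supp[OF True, symmetric] by blast
        ultimately show ?thesis using False by (simp add: supp)
      qed simp
    qed
    then have "card ?good = card (multisets_on E t) - card {a \<in> multisets_on E t. {e. 0 < a e} \<in> ?F}"
      using finite_multisets_on[of E t] by (simp add: card_Diff_subset)
    moreover have "card {a \<in> multisets_on E t. {e. 0 < a e} \<in> ?F} \<le> card (multisets_on E t)"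
      using finite_multisets_on[of E t] by (intro card_mono) auto
    moreover have "card {a \<in> multisets_on E t. {e. 0 < a e} \<in> ?F} =
        (\<Sum>i=0..n + l. card {S \<in> ?F. card S = n + 1 + i} * multichoose (n + 1 + i) (int t - int (n + 1) - int i))"
    proof (rule card_multisets_family[OF _ cE])
      fix S assume S: "S \<in> ?F"
      then obtain L where "L \<subseteq> S" "S \<subseteq> E" "covers_cycle L" by auto
      then show "n + 1 \<le> card S"
        using card_covers_cycle[of L] card_mono[of S L] order_trans[of L S E] by simp
    qed auto
    ultimately have "int (card ?good) = int (card (multisets_on E t)) -
        int (\<Sum>i=0..n + l. cover_count E xs (n + 1 + i) * multichoose (n + 1 + i) (int t - int (n + 1) - int i))"
      unfolding cc by linarith
    then show ?thesis using False by (simp add: script_G_def card_multisets_on cE')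
  qed
  then show ?thesis using card_min_heavy[of t] by simp
qed

end

section \<open>The structure of unicyclic graphs\<close>

text \<open>When the next vertex of the walk is already on the path, the path is cut back to that
  vertex instead of being extended.\<close>

lemma rtrancl_simple_path:
  assumes "(a, b) \<in> R\<^sup>*"
  shows "\<exists>ys. distinct ys \<and> ys \<noteq> [] \<and> hd ys = a \<and> last ys = b \<and>
    (\<forall>i. Suc i < length ys \<longrightarrow> (ys ! i, ys ! Suc i) \<in> R)"
  using assms
proof (induction rule: rtrancl_induct)
  case base
  show ?case by (intro exI[of _ "[a]"]) simp
next
  case (step y z)
  then obtain ys where ys: "distinct ys" "ys \<noteq> []" "hd ys = a" "last ys = y"
    "\<And>i. Suc i < length ys \<Longrightarrow> (ys ! i, ys ! Suc i) \<in> R" by blast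
  show ?case
  proof (cases "z \<in> set ys")
    case True
    then obtain k where k: "k < length ys" "z = ys ! k" by (metis in_set_conv_nth)
    show ?thesis
    proof (intro exI[of _ "take (Suc k) ys"] conjI allI impI)
      show "last (take (Suc k) ys) = z" using k by (simp add: take_Suc_conv_app_nth)
    qed (use ys k in auto)
  next
    case False
    show ?thesis
    proof (intro exI[of _ "ys @ [z]"] conjI allI impI)
      fix i assume i: "Suc i < length (ys @ [z])"
      show "((ys @ [z]) ! i, (ys @ [z]) ! Suc i) \<in> R"
      proof (cases "Suc i < length ys")
        case True then show ?thesis using ys(5) by (simp add: nth_append)
      next
        case False
        then have "i = length ys - 1" "Suc i = length ys" using i by auto
        then show ?thesis using ys(2,4) step.hyps(2) by (simp add: nth_append last_conv_nth)
      qed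
    qed (use ys False in auto)
  qed
qed

text \<open>A simple path inside \<open>T\<close> from \<open>a\<close> to \<open>b\<close> is
  closed by the edge between them. It has at least 3 vertices, since with 2 the edge would belong to
  \<open>T\<close>.\<close>

lemma cycle_through_edge:
  assumes "(a, b) \<in> {(x, y). {x, y} \<in> T}\<^sup>*" "a \<noteq> b" "{a, b} \<notin> T" "T \<subseteq> E" "{a, b} \<in> E"
  obtains ys where "is_cycle E ys" "{a, b} \<in> cycle_edges ys"
proof -
  obtain ys where ys: "distinct ys" "ys \<noteq> []" "hd ys = a" "last ys = b"
    "\<And>i. Suc i < length ys \<Longrightarrow> {ys ! i, ys ! Suc i} \<in> T"
    using rtrancl_simple_path[OF assms(1)] by auto
  have a: "a = ys ! 0" and b: "b = ys ! (length ys - 1)" using ys(2-4) by (auto simp: hd_conv_nth last_conv_nth)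
  have "length ys \<noteq> 1" using a b assms(2) by auto
  moreover have "length ys \<noteq> 2" using a b assms(3) ys(5)[of 0] by auto
  moreover have "length ys \<noteq> 0" using ys(2) by simp
  ultimately have len: "3 \<le> length ys" by linarith
  have close: "{ys ! (length ys - 1), ys ! (Suc (length ys - 1) mod length ys)} = {a, b}"
  proof -
    have "Suc (length ys - 1) mod length ys = 0" using len by (cases ys) auto
    then show ?thesis using a b by (simp add: insert_commute)
  qed
  have "{ys ! i, ys ! (Suc i mod length ys)} \<in> E" if "i < length ys" for i
  proof (cases "Suc i < length ys")
    case True then show ?thesis using ys(5)[OF True] assms(4) by auto
  next
    case False
    then have "i = length ys - 1" using that by simp
    then show ?thesis using close assms(5) by simp
  qed
  then have "is_cycle E ys" using ys(1) len by (auto simp: is_cycle_def cycle_edges_def)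
  moreover have "{a, b} \<in> cycle_edges ys" unfolding cycle_edges_def close[symmetric] using len by (auto intro!: exI[of _ "length ys - 1"])
  ultimately show ?thesis by (rule that)
qed

text \<open>Besides the cycle, keep for each other vertex one edge to a vertex closer to the cycle.
  The kept edges connect all vertices, so a further edge would close a second cycle.\<close>

lemma unicyclic_odd_structure:
  fixes E :: "'v::finite set set"
  assumes uni: "unicyclic E" and cyc: "is_cycle E xs" and len: "length xs = 2 * n + 1" and n: "1 \<le> n"
  obtains c p d where "odd_unicyclic E c n p d" "set xs = range c"
    "cycle_edges xs = (\<lambda>v. {v, p v}) ` range c"
proof -
  let ?N = "2 * n + 1"
  let ?R = "{(a, b). {a, b} \<in> E}"
  define c where "c i = xs ! (i mod ?N)" for i
  have simple: "\<And>e. e \<in> E \<Longrightarrow> card e = 2" and conn: "\<And>u v. (u, v) \<in> ?R\<^sup>*"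
    using uni by (auto simp: unicyclic_def simple_graph_def connected_graph_def)
  have dist: "distinct xs" and sub: "cycle_edges xs \<subseteq> E" using cyc by (auto simp: is_cycle_def)
  have c_eq_iff: "c i = c j \<longleftrightarrow> i mod ?N = j mod ?N" for i j
    unfolding c_def using len by (intro nth_eq_iff_index_eq[OF dist]) auto
  have range_c: "range c = set xs"
  proof (intro equalityI subsetI)
    fix v assume "v \<in> set xs"
    then obtain i where "i < ?N" "v = xs ! i" using len by (metis in_set_conv_nth)
    then have "v = c i" by (simp add: c_def)
    then show "v \<in> range c" by simp
  qed (auto simp: c_def len)
  \<comment> \<open>The distance to the cycle: the first step of a shortest walk leads strictly
    closer.\<close>
  define d where "d v = (LEAST k. \<exists>x\<in>set xs. (v, x) \<in> ?R ^^ k)" for v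
  have dex: "\<exists>k. \<exists>x\<in>set xs. (v, x) \<in> ?R ^^ k" for v
  proof -
    have "(v, c 0) \<in> ?R\<^sup>*" by (rule conn)
    then obtain k where "(v, c 0) \<in> ?R ^^ k" by (auto simp: rtrancl_power)
    then show ?thesis using range_c by blast
  qed
  have step: "\<exists>w. {v, w} \<in> E \<and> d w < d v" if v: "v \<notin> set xs" for v
  proof -
    obtain x where x: "x \<in> set xs" "(v, x) \<in> ?R ^^ d v" using LeastI_ex[OF dex[of v]] unfolding d_def by blast
    have "d v \<noteq> 0" using x v by (metis relpow_0_E)
    then obtain k where k: "d v = Suc k" by (cases "d v") auto
    obtain w where w: "(v, w) \<in> ?R" "(w, x) \<in> ?R ^^ k" using x(2) unfolding k by (rule relpow_Suc_E2)
    have "d w \<le> k" unfolding d_def by (rule Least_le) (use w x in blast)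
    then show ?thesis using w k by auto
  qed
  \<comment> \<open>The index chosen by \<open>SOME\<close> is determined modulo the cycle length,
    which is enough to determine the next vertex.\<close>
  define p where "p v = (if v \<in> set xs then c (Suc (SOME i. v = c i)) else (SOME w. {v, w} \<in> E \<and> d w < d v))" for v
  have p_off: "{v, p v} \<in> E \<and> d (p v) < d v" if "v \<notin> set xs" for v
    using someI_ex[OF step[OF that]] that by (simp add: p_def)
  have p_c: "p (c i) = c (Suc i)" for i
  proof -
    have "c i = c (SOME j. c i = c j)" by (rule someI[of _ i]) simp
    then have "c (Suc i) = c (Suc (SOME j. c i = c j))"
      unfolding c_eq_iff by (metis mod_Suc_eq)
    moreover have "c i \<in> set xs" using range_c by auto
    ultimately show ?thesis by (simp add: p_def)
  qed
  let ?T = "range (\<lambda>v. {v, p v})"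
  have ce: "cycle_edges xs = (\<lambda>v. {v, p v}) ` range c"
  proof -
    have "(\<lambda>v. {v, p v}) ` range c = range (\<lambda>i. {c i, c (Suc i)})" by (auto simp: image_image p_c)
    also have "\<dots> = {{c i, c (Suc i)} |i. i < ?N}"
    proof (intro equalityI subsetI)
      fix e assume "e \<in> range (\<lambda>i. {c i, c (Suc i)})"
      then obtain i where "e = {c i, c (Suc i)}" by auto
      then have "e = {c (i mod ?N), c (Suc (i mod ?N))}" by (simp add: c_def mod_Suc_eq)
      moreover have "i mod ?N < ?N" by simp
      ultimately show "e \<in> {{c i, c (Suc i)} |i. i < ?N}" by blast
    qed auto
    also have "\<dots> = cycle_edges xs" unfolding cycle_edges_def len c_def by (intro Collect_cong) (metis mod_less)
    finally show ?thesis by simp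
  qed
  have T_sub: "?T \<subseteq> E"
  proof
    fix e assume "e \<in> ?T"
    then obtain v where "e = {v, p v}" by auto
    then show "e \<in> E" using p_off[of v] sub ce range_c by (cases "v \<in> set xs") auto
  qed
  let ?RT = "{(a, b). {a, b} \<in> ?T}"
  have sym: "sym (?RT\<^sup>*)" by (rule sym_rtrancl) (auto simp: sym_def insert_commute)
  have c0: "(c 0, c i) \<in> ?RT\<^sup>*" for i
  proof (induction i)
    case (Suc i)
    have "{c i, c (Suc i)} = {c i, p (c i)}" by (simp only: p_c)
    then have "(c i, c (Suc i)) \<in> ?RT" by blast
    with Suc show ?case by (rule rtrancl.rtrancl_into_rtrancl)
  qed simp
  have toc0: "(v, c 0) \<in> ?RT\<^sup>*" for v
  proof (induction "d v" arbitrary: v rule: less_induct)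
    case less
    show ?case
    proof (cases "v \<in> set xs")
      case True
      then have "v \<in> range c" by (simp only: range_c)
      then obtain i where "v = c i" by auto
      then show ?thesis using symD[OF sym c0[of i]] by simp
    next
      case False
      then have "(p v, c 0) \<in> ?RT\<^sup>*" using less p_off by blast
      moreover have "(v, p v) \<in> ?RT" by auto
      ultimately show ?thesis by (rule converse_rtrancl_into_rtrancl[rotated])
    qed
  qed
  have "E \<subseteq> ?T"
  proof
    fix e assume e: "e \<in> E"
    then obtain a b where ab: "e = {a, b}" "a \<noteq> b" using simple[OF e] by (auto simp: card_2_iff)
    show "e \<in> ?T"
    proof (rule ccontr)
      assume "e \<notin> ?T"
      moreover have "(a, b) \<in> ?RT\<^sup>*" using toc0 symD[OF sym toc0] by (rule rtrancl_trans)
      ultimately obtain ys where ys: "is_cycle E ys" "e \<in> cycle_edges ys"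
        using cycle_through_edge[of a b ?T E] ab e T_sub by auto
      then have "cycle_edges ys = cycle_edges xs" using uni cyc unfolding unicyclic_def by blast
      then show False using ys(2) ce \<open>e \<notin> ?T\<close> by auto
    qed
  qed
  then have "odd_unicyclic E c n p d"
    using n c_eq_iff T_sub p_c p_off range_c by unfold_locales auto
  then show ?thesis using that range_c ce by auto
qed

section \<open>Monomial ideals\<close>

abbreviation lookup where "lookup \<equiv> Poly_Mapping.lookup"

text \<open>A monomial ideal given by a condition on exponents rather than by generators; it is an
  ideal when \<open>P\<close> is upward closed. Membership can then be tested monomial by
  monomial.\<close>

definition mono_ideal :: "(('v \<Rightarrow> nat) \<Rightarrow> bool) \<Rightarrow> ('v, 'k::field) mpoly set" where
  "mono_ideal P = {f. \<forall>m\<in>Poly_Mapping.keys f. P (lookup m)}"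

lemma lookup_surj:
  fixes f :: "'v::finite \<Rightarrow> nat"
  obtains m where "lookup m = f"
proof
  show "lookup (Abs_poly_mapping f) = f" by (rule lookup_Abs_poly_mapping) simp
qed

lemma lookup_add_fun: "lookup (a + b) = (\<lambda>v. lookup a v + lookup b v)"
  by (simp add: fun_eq_iff lookup_add)

lemma poly_mapping_sum_singles:
  "f = (\<Sum>m\<in>Poly_Mapping.keys f. Poly_Mapping.single m (lookup f m))"
proof (rule poly_mapping_eqI)
  fix k
  have "lookup (\<Sum>m\<in>Poly_Mapping.keys f. Poly_Mapping.single m (lookup f m)) k
      = (\<Sum>m\<in>Poly_Mapping.keys f. if k = m then lookup f k else 0)"
    unfolding lookup_sum by (intro sum.cong) (auto simp: lookup_single when_def)
  then show "lookup f k = lookup (\<Sum>m\<in>Poly_Mapping.keys f. Poly_Mapping.single m (lookup f m)) k"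
    by (simp add: in_keys_iff)
qed

lemma single_mem_mono_ideal: "P (lookup m) \<Longrightarrow> Poly_Mapping.single m c \<in> mono_ideal P"
  by (simp add: mono_ideal_def)

lemma mono_ideal_induct:
  fixes J :: "('v, 'k::field) mpoly set"
  assumes J: "\<And>f g. f \<in> J \<Longrightarrow> g \<in> J \<Longrightarrow> f + g \<in> J" "0 \<in> J"
    and sing: "\<And>m c. P (lookup m) \<Longrightarrow> Poly_Mapping.single m c \<in> J"
  shows "mono_ideal P \<subseteq> J"
proof
  fix f :: "('v, 'k) mpoly" assume f: "f \<in> mono_ideal P"
  have "(\<Sum>m\<in>M. Poly_Mapping.single m (lookup f m)) \<in> J" if "finite M" "M \<subseteq> Poly_Mapping.keys f" for M
    using that
  proof (induction M rule: finite_induct)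
    case (insert m M)
    then have "P (lookup m)" using f by (auto simp: mono_ideal_def)
    then show ?case using insert by (simp add: J sing)
  qed (simp add: J)
  from this[of "Poly_Mapping.keys f"] show "f \<in> J"
    using poly_mapping_sum_singles[of f] by simp
qed

lemma mono_ideal_subset_subspace:
  fixes J :: "('v, 'k::field) mpoly set"
  assumes J: "ideal.subspace J" and sing: "\<And>m. P (lookup m) \<Longrightarrow> Poly_Mapping.single m 1 \<in> J"
  shows "mono_ideal P \<subseteq> J"
proof (rule mono_ideal_induct)
  fix m and c :: 'k assume "P (lookup m)"
  then have "Poly_Mapping.single 0 c * Poly_Mapping.single m 1 \<in> J"
    by (intro ideal.subspace_scale[OF J] sing)
  then show "Poly_Mapping.single m c \<in> J" by (simp add: mult_single)
qed (use ideal.subspace_add[OF J] ideal.subspace_0[OF J] in auto)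

lemma subspace_mono_ideal:
  assumes up: "\<And>m m'. P m \<Longrightarrow> m \<le> m' \<Longrightarrow> P m'"
  shows "ideal.subspace (mono_ideal P :: ('v, 'k::field) mpoly set)"
proof (rule ideal.subspaceI)
  show "0 \<in> mono_ideal P" by (simp add: mono_ideal_def)
  fix f g :: "('v, 'k) mpoly" assume f: "f \<in> mono_ideal P"
  show "g * f \<in> mono_ideal P" unfolding mono_ideal_def
  proof (intro CollectI ballI)
    fix m assume "m \<in> Poly_Mapping.keys (g * f)"
    then obtain a b where "m = a + b" "b \<in> Poly_Mapping.keys f" using keys_mult[of g f] by blast
    then show "P (lookup m)" using f up[of "lookup b" "lookup m"]
      by (auto simp: mono_ideal_def lookup_add_fun le_fun_def)
  qed
  assume g: "g \<in> mono_ideal P"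
  show "f + g \<in> mono_ideal P" using f g keys_add[of f g] by (auto simp: mono_ideal_def)
qed

lemma mono_ideal_prod:
  fixes P Q :: "('v::finite \<Rightarrow> nat) \<Rightarrow> bool"
  assumes up: "\<And>m m'. P m \<Longrightarrow> m \<le> m' \<Longrightarrow> P m'" "\<And>m m'. Q m \<Longrightarrow> m \<le> m' \<Longrightarrow> Q m'"
  shows "ideal_prod (mono_ideal P) (mono_ideal Q :: ('v, 'k::field) mpoly set)
    = mono_ideal (\<lambda>m. \<exists>a b. m = (\<lambda>v. a v + b v) \<and> P a \<and> Q b)" (is "_ = mono_ideal ?R")
proof
  have "?R m'" if R: "?R m" and le: "m \<le> m'" for m m'
  proof -
    obtain a b where ab: "m = (\<lambda>v. a v + b v)" "P a" "Q b" using R by blast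
    have ge: "a v + b v \<le> m' v" for v using le_funD[OF le, of v] ab(1) by simp
    \<comment> \<open>The surplus of \<open>m'\<close> goes to the second factor, where
      \<open>Q\<close> is upward closed.\<close>
    have "m' = (\<lambda>v. a v + (m' v - a v))" by (intro ext le_add_diff_inverse[symmetric] add_leD1[OF ge])
    moreover have "Q (\<lambda>v. m' v - a v)"
    proof (rule up(2)[OF ab(3)], rule le_funI)
      fix v show "b v \<le> m' v - a v" using ge[of v] by linarith
    qed
    ultimately show ?thesis using ab(2) by (intro exI conjI)
  qed
  then have "ideal.subspace (mono_ideal ?R :: ('v, 'k) mpoly set)" by (rule subspace_mono_ideal)
  moreover have "{f * g |f g. f \<in> mono_ideal P \<and> g \<in> mono_ideal Q} \<subseteq> (mono_ideal ?R :: ('v, 'k) mpoly set)"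
  proof (intro subsetI)
    fix h :: "('v, 'k) mpoly" assume "h \<in> {f * g |f g. f \<in> mono_ideal P \<and> g \<in> mono_ideal Q}"
    then obtain f g where fg: "h = f * g" "f \<in> mono_ideal P" "g \<in> mono_ideal Q" by blast
    show "h \<in> mono_ideal ?R" unfolding mono_ideal_def
    proof (intro CollectI ballI)
      fix m assume "m \<in> Poly_Mapping.keys h"
      then obtain a b where "m = a + b" "a \<in> Poly_Mapping.keys f" "b \<in> Poly_Mapping.keys g"
        using keys_mult[of f g] fg by blast
      then show "?R (lookup m)" using fg unfolding mono_ideal_def
        by (intro exI[of _ "lookup a"] exI[of _ "lookup b"]) (auto simp: lookup_add_fun)
    qed
  qed
  ultimately show "ideal_prod (mono_ideal P) (mono_ideal Q) \<subseteq> (mono_ideal ?R :: ('v, 'k) mpoly set)"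
    unfolding ideal_prod_def by (intro ideal.span_minimal)
  show "(mono_ideal ?R :: ('v, 'k) mpoly set) \<subseteq> ideal_prod (mono_ideal P) (mono_ideal Q)"
  proof (rule mono_ideal_subset_subspace)
    show "ideal.subspace (ideal_prod (mono_ideal P) (mono_ideal Q :: ('v, 'k) mpoly set))"
      unfolding ideal_prod_def by (rule ideal.subspace_span)
    fix m :: "'v \<Rightarrow>\<^sub>0 nat" assume "?R (lookup m)"
    then obtain a b where ab: "lookup m = (\<lambda>v. a v + b v)" "P a" "Q b" by blast
    obtain a' where a': "lookup a' = a" by (rule lookup_surj)
    obtain b' where b': "lookup b' = b" by (rule lookup_surj)
    have "m = a' + b'" using ab(1) a' b' by (intro poly_mapping_eqI) (simp add: lookup_add)
    then have "Poly_Mapping.single m 1 = Poly_Mapping.single a' 1 * Poly_Mapping.single b' (1::'k)"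
      by (simp add: mult_single)
    then show "Poly_Mapping.single m 1 \<in> ideal_prod (mono_ideal P) (mono_ideal Q :: ('v, 'k) mpoly set)"
      unfolding ideal_prod_def using ab(2,3) a' b'
      by (intro ideal.span_base) (metis (mono_tags, lifting) mem_Collect_eq single_mem_mono_ideal)
  qed
qed

lemma Var_mult_Var:
  "Var u * Var v = Poly_Mapping.single (Poly_Mapping.single u 1 + Poly_Mapping.single v 1) (1::'k::field)"
  by (simp add: Var_def mult_single)

lemma lookup_edge_monomial:
  "u \<noteq> v \<Longrightarrow> lookup (Poly_Mapping.single u 1 + Poly_Mapping.single v (1::nat)) = (\<lambda>w. of_bool (w \<in> {u, v}))"
  by (auto simp: fun_eq_iff lookup_add lookup_single when_def)

lemma packs_le_mono: "packs E s m \<Longrightarrow> m \<le> m' \<Longrightarrow> packs E s m'"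
  using packs_mono[of E s m m'] by (simp add: le_fun_def)

lemma heavy_le_mono: "heavy E s m \<Longrightarrow> m \<le> m' \<Longrightarrow> heavy E s m'"
  using heavy_mono[of E s m m'] by (simp add: le_fun_def)

lemma packs_1_iff: "packs E 1 m \<longleftrightarrow> (\<exists>e\<in>E. \<exists>m'. m = add_set m' e)"
  using packs_Suc_iff[of E 0 m] by simp

lemma edge_ideal_eq:
  fixes E :: "'v::finite set set"
  assumes two: "\<And>e. e \<in> E \<Longrightarrow> card e = 2"
  shows "(edge_ideal E :: ('v, 'k::field) mpoly set) = mono_ideal (packs E 1)"
proof
  have ne: "u \<noteq> v" if "{u, v} \<in> E" for u v using two[OF that] by auto
  show "(edge_ideal E :: ('v, 'k) mpoly set) \<subseteq> mono_ideal (packs E 1)"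
    unfolding edge_ideal_def
  proof (rule ideal.span_minimal)
    show "ideal.subspace (mono_ideal (packs E 1) :: ('v, 'k) mpoly set)"
      by (rule subspace_mono_ideal) (rule packs_le_mono)
    show "{Var u * Var v |u v. {u, v} \<in> E} \<subseteq> (mono_ideal (packs E 1) :: ('v, 'k) mpoly set)"
    proof (intro subsetI)
      fix h :: "('v, 'k) mpoly" assume "h \<in> {Var u * Var v |u v. {u, v} \<in> E}"
      then obtain u v where uv: "h = Var u * Var v" "{u, v} \<in> E" by blast
      have "packs E 1 (\<lambda>w. of_bool (w \<in> {u, v}))"
        unfolding packs_1_iff using uv(2) by (intro bexI[of _ "{u, v}"] exI[of _ "\<lambda>_. 0"]) auto
      then show "h \<in> mono_ideal (packs E 1)"
        unfolding uv(1) Var_mult_Var by (intro single_mem_mono_ideal) (simp only: lookup_edge_monomial[OF ne[OF uv(2)]])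
    qed
  qed
  show "mono_ideal (packs E 1) \<subseteq> (edge_ideal E :: ('v, 'k) mpoly set)"
  proof (rule mono_ideal_subset_subspace)
    show "ideal.subspace (edge_ideal E :: ('v, 'k) mpoly set)"
      unfolding edge_ideal_def by (rule ideal.subspace_span)
    fix m :: "'v \<Rightarrow>\<^sub>0 nat" assume "packs E 1 (lookup m)"
    then obtain e m' where e: "e \<in> E" "lookup m = add_set m' e" unfolding packs_1_iff by blast
    obtain u v where uv: "e = {u, v}" using two[OF e(1)] by (auto simp: card_2_iff)
    have uvn: "u \<noteq> v" using ne e(1) uv by blast
    obtain k where k: "lookup k = m'" by (rule lookup_surj)
    have "m = k + (Poly_Mapping.single u 1 + Poly_Mapping.single v 1)"
    proof (rule poly_mapping_eqI)
      fix w
      show "lookup m w = lookup (k + (Poly_Mapping.single u 1 + Poly_Mapping.single v 1)) w"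
        unfolding lookup_add[of k] lookup_edge_monomial[OF uvn] e(2) k uv by simp
    qed
    then have "Poly_Mapping.single m 1 = Poly_Mapping.single k 1 * (Var u * Var v :: ('v, 'k) mpoly)"
      by (simp add: Var_mult_Var mult_single)
    also have "\<dots> \<in> edge_ideal E" unfolding edge_ideal_def
      by (intro ideal.span_scale ideal.span_base) (use e(1) uv in blast)
    finally show "Poly_Mapping.single m 1 \<in> (edge_ideal E :: ('v, 'k) mpoly set)" .
  qed
qed

lemma ideal_power_edge_ideal:
  fixes E :: "'v::finite set set"
  assumes two: "\<And>e. e \<in> E \<Longrightarrow> card e = 2"
  shows "ideal_power (edge_ideal E :: ('v, 'k::field) mpoly set) s = mono_ideal (packs E s)"
proof (induction s)
  case 0
  show ?case by (simp add: mono_ideal_def)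
next
  case (Suc s)
  have "(\<exists>a b. m = (\<lambda>v. a v + b v) \<and> packs E 1 a \<and> packs E s b) \<longleftrightarrow> packs E (Suc s) m" for m
  proof
    assume "\<exists>a b. m = (\<lambda>v. a v + b v) \<and> packs E 1 a \<and> packs E s b"
    then obtain a b e a' where *: "m = (\<lambda>v. a v + b v)" "packs E s b" "e \<in> E" "a = add_set a' e"
      unfolding packs_1_iff by (elim exE conjE bexE)
    have "m = add_set (\<lambda>v. a' v + b v) e" using * by (simp add: fun_eq_iff)
    moreover have "packs E s (\<lambda>v. a' v + b v)" using packs_mono[OF *(2)] by simp
    ultimately show "packs E (Suc s) m" unfolding packs_Suc_iff using *(3) by (intro bexI exI conjI)
  next
    assume "packs E (Suc s) m"
    then obtain e m' where *: "e \<in> E" "m = add_set m' e" "packs E s m'" unfolding packs_Suc_iff by blast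
    have "packs E 1 (\<lambda>v. of_bool (v \<in> e))"
      unfolding packs_1_iff using *(1) by (intro bexI[of _ e] exI[of _ "\<lambda>_. 0"]) auto
    then show "\<exists>a b. m = (\<lambda>v. a v + b v) \<and> packs E 1 a \<and> packs E s b"
      using *(2,3) by (intro exI[of _ "\<lambda>v. of_bool (v \<in> e)"] exI[of _ m'] conjI) (simp_all add: fun_eq_iff)
  qed
  note packs_split = this
  have "ideal_prod (mono_ideal (packs E 1)) (mono_ideal (packs E s) :: ('v, 'k) mpoly set)
      = mono_ideal (packs E (Suc s))"
    by (subst mono_ideal_prod) (auto intro: packs_le_mono simp only: packs_split)
  then show ?case unfolding ideal_power.simps Suc.IH by (simp only: edge_ideal_eq[OF two])
qed

section \<open>Symbolic powers of edge ideals\<close>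

lemma digits_unique:
  fixes f g :: "nat \<Rightarrow> nat"
  assumes "\<And>i. f i < K" "\<And>i. g i < K" "(\<Sum>i<N. f i * K ^ i) = (\<Sum>i<N. g i * K ^ i)" "i < N"
  shows "f i = g i"
  using assms
proof (induction N arbitrary: f g i)
  case (Suc N)
  have split: "(\<Sum>i<Suc N. h i * K ^ i) = h 0 + K * (\<Sum>i<N. h (Suc i) * K ^ i)" for h :: "nat \<Rightarrow> nat"
    unfolding sum.lessThan_Suc_shift by (simp add: sum_distrib_left algebra_simps)
  have eq: "f 0 + K * (\<Sum>i<N. f (Suc i) * K ^ i) = g 0 + K * (\<Sum>i<N. g (Suc i) * K ^ i)"
    using Suc.prems(3) unfolding split .
  have "f 0 = (f 0 + K * (\<Sum>i<N. f (Suc i) * K ^ i)) mod K" using Suc.prems(1)[of 0] by simp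
  also have "\<dots> = g 0" unfolding eq using Suc.prems(2)[of 0] by simp
  finally have 0: "f 0 = g 0" .
  then have "(\<Sum>i<N. f (Suc i) * K ^ i) = (\<Sum>i<N. g (Suc i) * K ^ i)"
    using eq Suc.prems(1)[of 0] by simp
  then have "f (Suc j) = g (Suc j)" if "j < N" for j
    using Suc.IH[of "\<lambda>i. f (Suc i)" "\<lambda>i. g (Suc i)" j] Suc.prems(1,2) that by blast
  then show ?case using 0 Suc.prems(4) by (cases i) auto
qed simp

text \<open>Exponents are read as digits in a base larger than every exponent that occurs in
  \<open>F\<close>.\<close>

lemma separating_weight:
  fixes F :: "('v::finite \<Rightarrow>\<^sub>0 nat) set"
  assumes "finite F"
  shows "\<exists>w :: ('v \<Rightarrow>\<^sub>0 nat) \<Rightarrow> nat. (\<forall>a b. w (a + b) = w a + w b) \<and> inj_on w F"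
proof -
  obtain g where g: "bij_betw g {0..<card (UNIV :: 'v set)} (UNIV :: 'v set)"
    using ex_bij_betw_nat_finite[OF finite] by blast
  let ?N = "card (UNIV :: 'v set)"
  let ?K = "Suc (\<Sum>m\<in>F. \<Sum>v\<in>UNIV. lookup m v)"
  let ?w = "\<lambda>m. \<Sum>i<?N. lookup m (g i) * ?K ^ i"
  have bound: "lookup m v < ?K" if "m \<in> F" for m v
  proof -
    have "lookup m v \<le> (\<Sum>v\<in>UNIV. lookup m v)" by (rule member_le_sum) auto
    also have "\<dots> \<le> (\<Sum>m\<in>F. \<Sum>v\<in>UNIV. lookup m v)" by (rule member_le_sum) (use assms that in auto)
    finally show ?thesis by simp
  qed
  have "inj_on ?w F"
  proof (rule inj_onI)
    fix a b assume ab: "a \<in> F" "b \<in> F" "?w a = ?w b"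
    show "a = b"
    proof (rule poly_mapping_eqI)
      fix v
      have "v \<in> g ` {0..<?N}" using g by (simp add: bij_betw_def)
      then obtain i where i: "i < ?N" "v = g i" by auto
      show "lookup a v = lookup b v" unfolding i(2)
        by (rule digits_unique[OF _ _ ab(3) i(1)]) (rule bound[OF ab(1)], rule bound[OF ab(2)])
    qed
  qed
  moreover have "\<forall>a b. ?w (a + b) = ?w a + ?w b"
    by (simp add: lookup_add add_mult_distrib sum.distrib)
  ultimately show ?thesis by (intro exI[of _ ?w] conjI)
qed

lemma lookup_mult_sum:
  fixes f g :: "('v, 'k::field) mpoly"
  shows "lookup (f * g) k = (\<Sum>a\<in>Poly_Mapping.keys f. \<Sum>b\<in>Poly_Mapping.keys g.
    if a + b = k then lookup f a * lookup g b else 0)"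
proof -
  have "f * g = (\<Sum>a\<in>Poly_Mapping.keys f. Poly_Mapping.single a (lookup f a)) *
      (\<Sum>b\<in>Poly_Mapping.keys g. Poly_Mapping.single b (lookup g b))"
    using poly_mapping_sum_singles[of f] poly_mapping_sum_singles[of g] by simp
  also have "\<dots> = (\<Sum>a\<in>Poly_Mapping.keys f. \<Sum>b\<in>Poly_Mapping.keys g.
      Poly_Mapping.single (a + b) (lookup f a * lookup g b))"
    by (simp only: sum_product mult_single)
  finally have fg: "f * g = (\<Sum>a\<in>Poly_Mapping.keys f. \<Sum>b\<in>Poly_Mapping.keys g.
      Poly_Mapping.single (a + b) (lookup f a * lookup g b))" .
  show ?thesis unfolding fg lookup_sum by (simp add: lookup_single when_def)
qed

text \<open>A monomial that arises from only one pair of terms cannot be cancelled.\<close>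

lemma lookup_mult_unique:
  fixes f g :: "('v, 'k::field) mpoly"
  assumes "a \<in> Poly_Mapping.keys f" "b \<in> Poly_Mapping.keys g"
    and uniq: "\<And>a' b'. a' \<in> Poly_Mapping.keys f \<Longrightarrow> b' \<in> Poly_Mapping.keys g \<Longrightarrow> a' + b' = a + b \<Longrightarrow> a' = a \<and> b' = b"
  shows "lookup (f * g) (a + b) = lookup f a * lookup g b"
proof -
  have "lookup (f * g) (a + b) = (\<Sum>a'\<in>Poly_Mapping.keys f. \<Sum>b'\<in>Poly_Mapping.keys g.
      if a' = a then (if b' = b then lookup f a * lookup g b else 0) else 0)"
    unfolding lookup_mult_sum using uniq by (intro sum.cong refl) auto
  also have "\<dots> = (\<Sum>a'\<in>Poly_Mapping.keys f. if a' = a then lookup f a * lookup g b else 0)"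
    using assms(2) by (intro sum.cong refl) (simp add: sum.delta)
  also have "\<dots> = lookup f a * lookup g b" using assms(1) by (simp add: sum.delta)
  finally show ?thesis .
qed

text \<open>The polynomial ring is graded by \<open>\<delta>\<close> and has no zero divisors, so the lowest \<open>\<delta>\<close>-component of
  a product is the product of the lowest components. A separating weight breaks ties between
  monomials of the same \<open>\<delta>\<close>-degree.\<close>

lemma lowest_degree_mult:
  fixes t r :: "('v::finite, 'k::field) mpoly" and \<delta> :: "('v \<Rightarrow>\<^sub>0 nat) \<Rightarrow> nat"
  assumes add: "\<And>a b. \<delta> (a + b) = \<delta> a + \<delta> b"
    and t: "a0 \<in> Poly_Mapping.keys t" "\<delta> a0 = 0"
    and tr: "\<And>m. m \<in> Poly_Mapping.keys (t * r) \<Longrightarrow> s \<le> \<delta> m"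
    and r: "b0 \<in> Poly_Mapping.keys r"
  shows "s \<le> \<delta> b0"
proof -
  let ?F = "Poly_Mapping.keys t \<union> Poly_Mapping.keys r"
  have "finite ?F" by simp
  then obtain w :: "('v \<Rightarrow>\<^sub>0 nat) \<Rightarrow> nat" where w: "\<forall>a b. w (a + b) = w a + w b" "inj_on w ?F"
    using separating_weight by metis
  obtain b1 where b1: "b1 \<in> Poly_Mapping.keys r" "\<And>b. b \<in> Poly_Mapping.keys r \<Longrightarrow> \<delta> b1 \<le> \<delta> b"
    using ex_has_least_nat[of "\<lambda>b. b \<in> Poly_Mapping.keys r" b0 \<delta>] r by blast
  obtain a where a: "a \<in> Poly_Mapping.keys t" "\<delta> a = 0"
    "\<And>a'. a' \<in> Poly_Mapping.keys t \<Longrightarrow> \<delta> a' = 0 \<Longrightarrow> w a \<le> w a'"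
    using ex_has_least_nat[of "\<lambda>a. a \<in> Poly_Mapping.keys t \<and> \<delta> a = 0" a0 w] t by blast
  obtain b where b: "b \<in> Poly_Mapping.keys r" "\<delta> b = \<delta> b1"
    "\<And>b'. b' \<in> Poly_Mapping.keys r \<Longrightarrow> \<delta> b' = \<delta> b1 \<Longrightarrow> w b \<le> w b'"
    using ex_has_least_nat[of "\<lambda>b. b \<in> Poly_Mapping.keys r \<and> \<delta> b = \<delta> b1" b1 w] b1(1) by blast
  \<comment> \<open>Another pair with the same product has the same \<open>\<delta>\<close>-degrees,
    since both are lowest; then the same weights, since both are lightest; and \<open>w\<close> is
    injective.\<close>
  have "a' = a \<and> b' = b" if ab: "a' \<in> Poly_Mapping.keys t" "b' \<in> Poly_Mapping.keys r" "a' + b' = a + b" for a' b'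
  proof -
    have "\<delta> a' + \<delta> b' = \<delta> a + \<delta> b" using ab(3) add by metis
    then have "\<delta> a' = 0" "\<delta> b' = \<delta> b1" using a(2) b(2) b1(2)[OF ab(2)] by auto
    then have "w a \<le> w a'" "w b \<le> w b'" using a(3) b(3) ab by auto
    moreover have "w a' + w b' = w a + w b" using ab(3) w(1) by metis
    ultimately have "w a' = w a" "w b' = w b" by auto
    then show ?thesis using inj_onD[OF w(2)] ab a(1) b(1) by blast
  qed
  then have "lookup (t * r) (a + b) = lookup t a * lookup r b"
    using a(1) b(1) by (intro lookup_mult_unique) auto
  then have "a + b \<in> Poly_Mapping.keys (t * r)" using a(1) b(1) by (simp add: in_keys_iff)
  then have "s \<le> \<delta> b1" using tr add a(2) b(2) by fastforce
  then show ?thesis using b1(2)[OF r] by simp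
qed

section \<open>Localization and the primes of vertex covers\<close>

lemma prime_one_notin: "is_prime_ideal p \<Longrightarrow> 1 \<notin> p"
proof
  assume p: "is_prime_ideal p" "1 \<in> p"
  then have "r * 1 \<in> p" for r unfolding is_prime_ideal_def by (blast intro: ideal.subspace_scale)
  then show False using p(1) by (auto simp: is_prime_ideal_def)
qed

text \<open>The factor \<open>w\<close> in the equality of fractions is absorbed into the multiplier
  \<open>w * t\<close>, which avoids \<open>p\<close> by primality. Afterwards symbolic powers can
  be handled without fractions.\<close>

lemma loc_contract_loc_ideal:
  assumes p: "is_prime_ideal p" and J: "ideal.subspace J"
  shows "r \<in> loc_contract p (loc_ideal p J) \<longleftrightarrow> (\<exists>t. t \<notin> p \<and> t * r \<in> J)"
proof
  have one: "1 \<notin> p" by (rule prime_one_notin[OF p])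
  have mult: "a * b \<notin> p" if "a \<notin> p" "b \<notin> p" for a b
    using p that by (auto simp: is_prime_ideal_def)
  {
    assume "r \<in> loc_contract p (loc_ideal p J)"
    then obtain a t where at: "loc_frac p r 1 = loc_frac p a t" "a \<in> J" "t \<notin> p"
      by (auto simp: loc_contract_def loc_ideal_def)
    have "(a, t) \<in> loc_frac p a t" using at(3) one by (auto simp: loc_frac_def loc_rel_def)
    then have "(a, t) \<in> loc_frac p r 1" using at(1) by simp
    then obtain w where w: "w \<notin> p" "w * (r * t - a * 1) = 0" by (auto simp: loc_frac_def loc_rel_def)
    have "(w * t) * r - w * a = w * (r * t - a * 1)" by (simp only: right_diff_distrib mult_1_right mult_1_left ac_simps)
    then have "(w * t) * r = w * a" unfolding w(2) by (simp only: right_minus_eq)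
    then have "(w * t) * r \<in> J" using ideal.subspace_scale[OF J at(2), of w] by (simp only:)
    then show "\<exists>t. t \<notin> p \<and> t * r \<in> J" using mult[OF w(1) at(3)] by blast
  }
  assume "\<exists>t. t \<notin> p \<and> t * r \<in> J"
  then obtain t where t: "t \<notin> p" "t * r \<in> J" by blast
  have "(\<exists>w. w \<notin> p \<and> w * (r * u - b * 1) = 0) \<longleftrightarrow> (\<exists>w. w \<notin> p \<and> w * (t * r * u - b * t) = 0)" for b u
  proof
    assume "\<exists>w. w \<notin> p \<and> w * (r * u - b * 1) = 0"
    then obtain w where w: "w \<notin> p" "w * (r * u - b * 1) = 0" by blast
    have "w * (t * r * u - b * t) = t * (w * (r * u - b * 1))"
      by (simp only: right_diff_distrib mult_1_right mult_1_left ac_simps)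
    then have "w * (t * r * u - b * t) = 0" unfolding w(2) by (simp only: mult_zero_right)
    then show "\<exists>w. w \<notin> p \<and> w * (t * r * u - b * t) = 0" using w(1) by blast
  next
    assume "\<exists>w. w \<notin> p \<and> w * (t * r * u - b * t) = 0"
    then obtain w where w: "w \<notin> p" "w * (t * r * u - b * t) = 0" by blast
    have "(w * t) * (r * u - b * 1) = w * (t * r * u - b * t)"
      by (simp only: right_diff_distrib mult_1_right mult_1_left ac_simps)
    then have "(w * t) * (r * u - b * 1) = 0" unfolding w(2) .
    then show "\<exists>w. w \<notin> p \<and> w * (r * u - b * 1) = 0" using mult[OF w(1) t(1)] by blast
  qed
  then have "loc_frac p r 1 = loc_frac p (t * r) t"
    using t(1) one by (auto simp: loc_frac_def loc_rel_def)
  then show "r \<in> loc_contract p (loc_ideal p J)"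
    using t by (auto simp: loc_contract_def loc_ideal_def)
qed

text \<open>The ideal generated by the variables in \<open>C\<close>.\<close>

definition cover_prime :: "'v::finite set \<Rightarrow> ('v, 'k::field) mpoly set" where
  "cover_prime C = mono_ideal (\<lambda>m. 1 \<le> sum m C)"

lemma sum_lookup_add: "sum (lookup (a + b)) C = sum (lookup a) C + sum (lookup b) (C :: 'v::finite set)"
  by (simp add: lookup_add sum.distrib)

lemma not_cover_prime: 
  assumes "t \<notin> cover_prime C"
  obtains a where "a \<in> Poly_Mapping.keys t" "sum (lookup a) C = 0"
  using assms by (auto simp: cover_prime_def mono_ideal_def not_le)

text \<open>Powers of an ideal generated by variables are primary: by
  \<open>lowest_degree_mult\<close> for the degree in the variables of \<open>C\<close>, a factor
  with a term of degree 0 can be cancelled. The case \<open>s = 1\<close> is primality of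
  \<open>cover_prime C\<close>.\<close>

lemma mult_mem_deg_ideal:
  fixes t r :: "('v::finite, 'k::field) mpoly"
  assumes "t \<notin> cover_prime C" "t * r \<in> mono_ideal (\<lambda>m. s \<le> sum m C)"
  shows "r \<in> mono_ideal (\<lambda>m. s \<le> sum m C)"
proof -
  obtain a where a: "a \<in> Poly_Mapping.keys t" "sum (lookup a) C = 0" using assms(1) by (rule not_cover_prime)
  show ?thesis unfolding mono_ideal_def
  proof (intro CollectI ballI)
    fix m assume "m \<in> Poly_Mapping.keys r"
    then show "s \<le> sum (lookup m) C"
      using lowest_degree_mult[of "\<lambda>m. sum (lookup m) C" a t r s m, OF sum_lookup_add a] assms(2)
      by (auto simp: mono_ideal_def)
  qed
qed

lemma sum_le_mono: "s \<le> sum m C \<Longrightarrow> m \<le> m' \<Longrightarrow> s \<le> sum m' C" for m m' :: "'v::finite \<Rightarrow> nat"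
  using sum_mono[of C m m'] by (simp add: le_fun_def)

lemma is_prime_cover_prime: "is_prime_ideal (cover_prime C :: ('v::finite, 'k::field) mpoly set)"
  unfolding is_prime_ideal_def
proof (intro conjI allI impI)
  show "ideal.subspace (cover_prime C :: ('v, 'k) mpoly set)"
    unfolding cover_prime_def by (rule subspace_mono_ideal) (rule sum_le_mono)
  have "(1 :: ('v, 'k) mpoly) \<notin> cover_prime C" by (simp add: cover_prime_def mono_ideal_def)
  then show "(cover_prime C :: ('v, 'k) mpoly set) \<noteq> UNIV" by blast
  fix a b :: "('v, 'k) mpoly" assume "a * b \<in> cover_prime C"
  then show "a \<in> cover_prime C \<or> b \<in> cover_prime C"
    using mult_mem_deg_ideal[of a C b 1] unfolding cover_prime_def by blast
qed

lemma packs_1_edge: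
  assumes "e \<in> E" "\<And>v. v \<in> e \<Longrightarrow> 1 \<le> m v"
  shows "packs E 1 m"
proof (rule packs_mono)
  show "packs E 1 (\<lambda>v. of_bool (v \<in> e))"
    unfolding packs_1_iff using assms(1) by (intro bexI[of _ e] exI[of _ "\<lambda>_. 0"]) auto
  show "of_bool (v \<in> e) \<le> m v" for v using assms(2)[of v] by auto
qed

text \<open>The witness is the product of all variables outside \<open>C\<close>. A variable in
  \<open>C\<close> has a neighbour among its factors, so it multiplies the witness into the ideal.
  Conversely the witness has degree 0 in \<open>C\<close>, so any degree in \<open>C\<close> must
  come from \<open>r\<close>.\<close>

lemma cover_prime_Ass:
  fixes E :: "'v::finite set set"
  assumes two: "\<And>e. e \<in> E \<Longrightarrow> card e = 2" and C: "vertex_cover E C"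
    and min: "\<And>v. v \<in> C \<Longrightarrow> \<exists>u. u \<notin> C \<and> {u, v} \<in> E"
  shows "(cover_prime C :: ('v, 'k::field) mpoly set) \<in> Ass (edge_ideal E)"
proof -
  obtain k where k: "lookup k = (\<lambda>v. of_bool (v \<notin> C) :: nat)" by (rule lookup_surj)
  let ?f = "Poly_Mapping.single k (1::'k)"
  have "cover_prime C = {r. r * ?f \<in> mono_ideal (packs E 1)}"
  proof (intro equalityI subsetI CollectI)
    fix r :: "('v, 'k) mpoly" assume r: "r \<in> cover_prime C"
    show "r * ?f \<in> mono_ideal (packs E 1)" unfolding mono_ideal_def
    proof (intro CollectI ballI)
      fix m assume "m \<in> Poly_Mapping.keys (r * ?f)"
      then obtain a where a: "m = a + k" "a \<in> Poly_Mapping.keys r" using keys_mult[of r ?f] by auto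
      then have "1 \<le> sum (lookup a) C" using r unfolding cover_prime_def mono_ideal_def by blast
      then have "sum (lookup a) C \<noteq> 0" by linarith
      then obtain v where v: "v \<in> C" "lookup a v \<noteq> 0" by (meson sum.neutral)
      obtain u where u: "u \<notin> C" "{u, v} \<in> E" using min[OF v(1)] by blast
      show "packs E 1 (lookup m)"
        by (rule packs_1_edge[OF u(2)]) (use a(1) u(1) v k in \<open>auto simp: lookup_add_fun\<close>)
    qed
  next
    fix r :: "('v, 'k) mpoly" assume "r \<in> {r. r * ?f \<in> mono_ideal (packs E 1)}"
    then have r: "r * ?f \<in> mono_ideal (packs E 1)" by simp
    show "r \<in> cover_prime C" unfolding cover_prime_def mono_ideal_def
    proof (intro CollectI ballI)
      fix a assume a: "a \<in> Poly_Mapping.keys r"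
      have "lookup (r * ?f) (a + k) = lookup r a * lookup ?f k"
        by (rule lookup_mult_unique) (use a in auto)
      then have "a + k \<in> Poly_Mapping.keys (r * ?f)" using a by (simp add: in_keys_iff)
      then have "heavy E 1 (lookup (a + k))" using r packs_imp_heavy by (auto simp: mono_ideal_def)
      then have "1 \<le> sum (lookup (a + k)) C" using C by (simp add: heavy_def)
      also have "\<dots> = sum (lookup a) C" by (intro sum.cong) (simp_all add: lookup_add k)
      finally show "1 \<le> sum (lookup a) C" .
    qed
  qed
  moreover have "(edge_ideal E :: ('v, 'k) mpoly set) = mono_ideal (packs E 1)"
    by (rule edge_ideal_eq) (rule two)
  ultimately show ?thesis unfolding Ass_def
    by (intro CollectI conjI exI[of _ ?f] is_prime_cover_prime) simp
qed

lemma minimal_cover: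
  fixes E :: "'v::finite set set"
  assumes two: "\<And>e. e \<in> E \<Longrightarrow> card e = 2" and "vertex_cover E C"
  obtains D where "D \<subseteq> C" "vertex_cover E D" "\<And>v. v \<in> D \<Longrightarrow> \<exists>u. u \<notin> D \<and> {u, v} \<in> E"
proof -
  obtain D where D: "D \<subseteq> C" "vertex_cover E D" "\<And>D'. D' \<subseteq> C \<Longrightarrow> vertex_cover E D' \<Longrightarrow> card D \<le> card D'"
    using ex_has_least_nat[of "\<lambda>D. D \<subseteq> C \<and> vertex_cover E D" C card] assms(2) by auto
  have "\<exists>u. u \<notin> D \<and> {u, v} \<in> E" if v: "v \<in> D" for v
  proof -
    have "card (D - {v}) < card D" using v by (intro psubset_card_mono) auto
    then have "\<not> vertex_cover E (D - {v})" using D(1) D(3)[of "D - {v}"] by fastforce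
    then obtain e where e: "e \<in> E" "e \<inter> (D - {v}) = {}" by (auto simp: vertex_cover_def)
    have "e \<inter> D \<noteq> {}" using D(2) e(1) by (simp add: vertex_cover_def)
    then have "v \<in> e" using e(2) by blast
    moreover obtain x y where "e = {x, y}" "x \<noteq> y" using two[OF e(1)] by (auto simp: card_2_iff)
    ultimately obtain u where "e = {u, v}" "u \<noteq> v" by auto
    then show ?thesis using e by blast
  qed
  then show ?thesis using that D by blast
qed

text \<open>One inclusion tests \<open>f\<close> at the primes of minimal covers. For the other, let
  \<open>C\<close> be the variables in an associated prime \<open>p\<close>: variables outside
  \<open>C\<close> are invertible at \<open>p\<close>, and each variable of \<open>C\<close> has
  such a neighbour, so it lies in the localized edge ideal.\<close>

lemma symbolic_power_edge_ideal:
  fixes E :: "'v::finite set set"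
  assumes two: "\<And>e. e \<in> E \<Longrightarrow> card e = 2"
  shows "symbolic_power (edge_ideal E :: ('v, 'k::field) mpoly set) s = mono_ideal (heavy E s)"
proof -
  let ?I = "edge_ideal E :: ('v, 'k) mpoly set"
  have I1: "?I = mono_ideal (packs E 1)" by (rule edge_ideal_eq) (rule two)
  have Is: "ideal_power ?I s = mono_ideal (packs E s)" for s
    by (rule ideal_power_edge_ideal) (rule two)
  have sub: "ideal.subspace (mono_ideal (packs E s) :: ('v, 'k) mpoly set)" for s
    by (rule subspace_mono_ideal) (rule packs_le_mono)
  have sym: "symbolic_power ?I s = {f. \<forall>p\<in>Ass ?I. \<exists>t. t \<notin> p \<and> t * f \<in> mono_ideal (packs E s)}"
  proof -
    have "p \<in> Ass ?I \<Longrightarrow> is_prime_ideal p" for p by (simp add: Ass_def)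
    then show ?thesis unfolding symbolic_power_def Is by (auto simp: loc_contract_loc_ideal[OF _ sub])
  qed
  show ?thesis
  proof (intro equalityI subsetI)
    fix f assume f: "f \<in> symbolic_power ?I s"
    show "f \<in> mono_ideal (heavy E s)" unfolding mono_ideal_def heavy_def
    proof (intro CollectI ballI allI impI)
      fix m C assume m: "m \<in> Poly_Mapping.keys f" and C: "vertex_cover E C"
      obtain D where D: "D \<subseteq> C" "vertex_cover E D" "\<And>v. v \<in> D \<Longrightarrow> \<exists>u. u \<notin> D \<and> {u, v} \<in> E"
        using minimal_cover[OF two C] by blast
      obtain t where t: "t \<notin> (cover_prime D :: ('v, 'k) mpoly set)" "t * f \<in> mono_ideal (packs E s)"
        using f cover_prime_Ass[OF two D(2,3)] unfolding sym by blast
      have "t * f \<in> mono_ideal (\<lambda>m. s \<le> sum m D)"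
        using t(2) packs_imp_heavy[of E s] D(2) by (auto simp: mono_ideal_def heavy_def)
      then have "s \<le> sum (lookup m) D" using mult_mem_deg_ideal[OF t(1)] m by (auto simp: mono_ideal_def)
      also have "\<dots> \<le> sum (lookup m) C" using D(1) by (intro sum_mono2) auto
      finally show "s \<le> sum (lookup m) C" .
    qed
  next
    fix f :: "('v, 'k) mpoly" assume f: "f \<in> mono_ideal (heavy E s)"
    show "f \<in> symbolic_power ?I s" unfolding sym
    proof (intro CollectI ballI)
      fix p assume p: "p \<in> Ass ?I"
      then obtain g where pr: "is_prime_ideal p" and pg: "p = {r. r * g \<in> ?I}" by (auto simp: Ass_def)
      have one: "1 \<notin> p" by (rule prime_one_notin[OF pr])
      have mult: "a * b \<notin> p" if "a \<notin> p" "b \<notin> p" for a b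
        using pr that by (auto simp: is_prime_ideal_def)
      have subI: "ideal.subspace ?I" unfolding edge_ideal_def by (rule ideal.subspace_span)
      define C where "C = {v. Var v \<in> p}"
      have edgeI: "Var u * Var v \<in> ?I" if "{u, v} \<in> E" for u v
        unfolding edge_ideal_def using that by (intro ideal.span_base) blast
      have "vertex_cover E C" unfolding vertex_cover_def
      proof
        fix e assume e: "e \<in> E"
        obtain u v where uv: "e = {u, v}" using two[OF e] by (auto simp: card_2_iff)
        have "g * (Var u * Var v) \<in> ?I" 
          by (rule ideal.subspace_scale[OF subI edgeI]) (use e uv in simp)
        then have "Var u * Var v \<in> p" unfolding pg by (simp only: mem_Collect_eq mult.commute[of g])
        then have "Var u \<in> p \<or> Var v \<in> p" using pr by (auto simp: is_prime_ideal_def)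
        then show "e \<inter> C \<noteq> {}" by (auto simp: uv C_def)
      qed
      note cover = this
      \<comment> \<open>With \<open>p\<close> the annihilator of \<open>g\<close>, some monomial
        \<open>b\<close> of \<open>g\<close> contains no edge, yet \<open>Var u\<close> times
        \<open>b\<close> contains one for each \<open>u\<close> in \<open>C\<close>. So
        \<open>b\<close> contains a neighbour of each such \<open>u\<close>, and a neighbour inside
        \<open>C\<close> would put an edge into \<open>b\<close>.\<close>
      have nbr: "\<exists>w. w \<notin> C \<and> {w, v} \<in> E" if v: "v \<in> C" for v
      proof -
        have "g \<notin> mono_ideal (packs E 1)" using one unfolding pg I1 by simp
        then obtain b where b: "b \<in> Poly_Mapping.keys g" "\<not> packs E 1 (lookup b)" by (auto simp: mono_ideal_def)
        have step: "packs E 1 (lookup (Poly_Mapping.single u 1 + b))" if "u \<in> C" for u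
        proof -
          have "Var u * g \<in> mono_ideal (packs E 1)" using that unfolding C_def pg I1 by simp
          moreover have "lookup (Var u * g) (Poly_Mapping.single u 1 + b) = lookup (Var u :: ('v, 'k) mpoly) (Poly_Mapping.single u 1) * lookup g b"
            by (rule lookup_mult_unique) (use b in \<open>auto simp: Var_def\<close>)
          then have "Poly_Mapping.single u 1 + b \<in> Poly_Mapping.keys (Var u * g)"
            using b(1) by (simp add: in_keys_iff Var_def)
          ultimately show ?thesis by (auto simp: mono_ideal_def)
        qed
        have find: "\<exists>w. {w, u} \<in> E \<and> w \<noteq> u \<and> 1 \<le> lookup b w" if u: "u \<in> C" for u
        proof -
          obtain e m' where e: "e \<in> E" "lookup (Poly_Mapping.single u 1 + b) = add_set m' e"
            using step[OF u] unfolding packs_1_iff by blast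
          have ge: "1 \<le> lookup (Poly_Mapping.single u 1 + b) x" if "x \<in> e" for x using e(2) that by simp
          have "u \<in> e"
          proof (rule ccontr)
            assume "u \<notin> e"
            then have "1 \<le> lookup b x" if "x \<in> e" for x
              using ge[OF that] that by (auto simp: lookup_add lookup_single when_def split: if_splits)
            then show False using packs_1_edge[OF e(1)] b(2) by blast
          qed
          then obtain w where w: "e = {w, u}" "w \<noteq> u" using two[OF e(1)] by (auto simp: card_2_iff)
          then have "1 \<le> lookup b w" using ge[of w] by (auto simp: lookup_add lookup_single when_def)
          then show ?thesis using w e(1) by blast
        qed
        obtain w where w: "{w, v} \<in> E" "1 \<le> lookup b w" using find[OF v] by blast
        have "w \<notin> C"
        proof
          assume "w \<in> C"
          then obtain x where "{x, w} \<in> E" "1 \<le> lookup b x" using find by blast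
          then have "packs E 1 (lookup b)" using w(2) by (intro packs_1_edge[of "{x, w}"]) auto
          then show False using b(2) by simp
        qed
        then show ?thesis using w(1) by blast
      qed
      \<comment> \<open>Each unit of weight in \<open>C\<close> is completed to an edge: a variable
        \<open>v\<close> of \<open>C\<close> is paired with a neighbour \<open>w\<close> outside
        \<open>C\<close>, and \<open>Var w\<close> joins the multiplier without bringing it into
        \<open>p\<close>.\<close>
      have mono: "\<exists>t. t \<notin> p \<and> t * Poly_Mapping.single m 1 \<in> mono_ideal (packs E s)"
        if "s \<le> sum (lookup m) C" for m s
      proof -
        have "\<exists>k. Poly_Mapping.single k 1 \<notin> p \<and> packs E s (lookup (k + m))"
          using that
        proof (induction s arbitrary: m)
          case 0
          show ?case using one by (intro exI[of _ 0]) simp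
        next
          case (Suc s)
          then have "sum (lookup m) C \<noteq> 0" by linarith
          then obtain v where v: "v \<in> C" "lookup m v \<noteq> 0" by (meson sum.neutral)
          obtain w where w: "w \<notin> C" "{w, v} \<in> E" using nbr[OF v(1)] by blast
          obtain m' where m': "lookup m' = (\<lambda>x. lookup m x - of_bool (x = v))" by (rule lookup_surj)
          have mm: "m = m' + Poly_Mapping.single v 1"
            using v(2) by (intro poly_mapping_eqI) (auto simp: lookup_add m' lookup_single when_def)
          have "sum (lookup (Poly_Mapping.single v (1::nat))) C = 1"
            using v(1) by (simp add: lookup_single when_def)
          then have "s \<le> sum (lookup m') C" using Suc.prems unfolding mm sum_lookup_add by simp
          then obtain k where k: "Poly_Mapping.single k 1 \<notin> p" "packs E s (lookup (k + m'))" using Suc.IH by blast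
          let ?k = "k + Poly_Mapping.single w 1"
          have "Poly_Mapping.single ?k 1 = Poly_Mapping.single k 1 * (Var w :: ('v, 'k) mpoly)"
            by (simp add: Var_def mult_single)
          then have "Poly_Mapping.single ?k 1 \<notin> p" using mult[OF k(1), of "Var w"] w(1) by (simp add: C_def)
          moreover have "packs E (Suc s) (lookup (?k + m))" unfolding packs_Suc_iff
          proof (intro bexI[OF _ w(2)] exI conjI)
            show "packs E s (lookup (k + m'))" by (rule k(2))
            show "lookup (?k + m) = add_set (lookup (k + m')) {w, v}"
              using w(1) v(1) unfolding mm by (auto simp: fun_eq_iff lookup_add lookup_single when_def)
          qed
          ultimately show ?case by blast
        qed
        then obtain k where k: "Poly_Mapping.single k 1 \<notin> p" "packs E s (lookup (k + m))" by blast
        have "Poly_Mapping.single k 1 * Poly_Mapping.single m (1::'k) \<in> mono_ideal (packs E s)"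
          unfolding mult_single by (rule single_mem_mono_ideal) (rule k(2))
        then show ?thesis using k(1) by blast
      qed
      let ?J = "{f. \<exists>t. t \<notin> p \<and> t * f \<in> (mono_ideal (packs E s) :: ('v, 'k) mpoly set)}"
      have "mono_ideal (heavy E s) \<subseteq> ?J"
      proof (rule mono_ideal_subset_subspace)
        show "ideal.subspace ?J"
        proof (rule ideal.subspaceI)
          show "0 \<in> ?J" using one ideal.subspace_0[OF sub] by auto
          fix f1 f2 assume "f1 \<in> ?J"
          then obtain t1 where t1: "t1 \<notin> p" "t1 * f1 \<in> mono_ideal (packs E s)" by blast
          have "t1 * (h * f1) \<in> mono_ideal (packs E s)" for h
            using ideal.subspace_scale[OF sub t1(2), of h] by (simp only: mult.left_commute)
          then show "f2 * f1 \<in> ?J" using t1(1) by blast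
          assume "f2 \<in> ?J"
          then obtain t2 where t2: "t2 \<notin> p" "t2 * f2 \<in> mono_ideal (packs E s)" by blast
          have "(t1 * t2) * (f1 + f2) = t2 * (t1 * f1) + t1 * (t2 * f2)" by (simp only: ring_distribs ac_simps)
          also have "\<dots> \<in> mono_ideal (packs E s)"
            by (intro ideal.subspace_add[OF sub] ideal.subspace_scale[OF sub] t1 t2)
          finally show "f1 + f2 \<in> ?J" using mult[OF t1(1) t2(1)] by blast
        qed
        fix m assume "heavy E s (lookup m)"
        then have "s \<le> sum (lookup m) C" using cover by (simp add: heavy_def)
        then show "Poly_Mapping.single m 1 \<in> ?J" using mono by blast
      qed
      then show "\<exists>t. t \<notin> p \<and> t * f \<in> mono_ideal (packs E s)" using f by blast
    qed
  qed
qed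

section \<open>Generators of quotients of monomial ideals\<close>

lemma coset_eq_iff:
  assumes "ideal.subspace N"
  shows "a +o N = b +o N \<longleftrightarrow> a - b \<in> N"
proof
  assume "a +o N = b +o N"
  moreover have "a \<in> a +o N" using ideal.subspace_0[OF assms] by (force simp: elt_set_plus_def)
  ultimately have "a \<in> b +o N" by simp
  then show "a - b \<in> N" by (auto simp: elt_set_plus_def)
next
  assume ab: "a - b \<in> N"
  have sub: "x +o N \<subseteq> y +o N" if "x - y \<in> N" for x y
  proof
    fix z assume "z \<in> x +o N"
    then obtain m where "m \<in> N" "z = x + m" by (auto simp: elt_set_plus_def)
    then have "(x - y) + m \<in> N" "z = y + ((x - y) + m)" using ideal.subspace_add[OF assms that] by auto
    then show "z \<in> y +o N" unfolding elt_set_plus_def by blast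
  qed
  have "b - a \<in> N" using ideal.subspace_neg[OF assms ab] by simp
  then show "a +o N = b +o N" using sub ab by blast
qed

lemma subspace_plus_self:
  assumes "ideal.subspace N" shows "N + N = N"
proof
  show "N + N \<subseteq> N" using ideal.subspace_add[OF assms] by (auto simp: set_plus_def)
  show "N \<subseteq> N + N" using ideal.subspace_0[OF assms] by (force simp: set_plus_def)
qed

lemma coset_add:
  assumes "ideal.subspace N" shows "(a +o N) + (b +o N) = (a + b) +o N"
  by (simp only: set_plus_rearrange subspace_plus_self[OF assms])

text \<open>The summand \<open>N\<close> in \<open>quot_scale\<close> fills the multiple of
  \<open>N\<close> by \<open>r\<close> up to the whole of \<open>N\<close>.\<close>

lemma coset_scale:
  assumes N: "ideal.subspace N" shows "quot_scale N r (a +o N) = (r * a) +o N"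
proof (intro equalityI subsetI)
  fix z assume "z \<in> quot_scale N r (a +o N)"
  then obtain m m' where m: "m \<in> N" "m' \<in> N" "z = r * (a + m) + m'"
    by (auto simp: quot_scale_def set_plus_def elt_set_times_def elt_set_plus_def)
  have "z = r * a + (r * m + m')" using m(3) by (simp only: distrib_left add.assoc)
  moreover have "r * m + m' \<in> N" by (intro ideal.subspace_add[OF N] ideal.subspace_scale[OF N] m)
  ultimately show "z \<in> (r * a) +o N" unfolding elt_set_plus_def by blast
next
  fix z assume "z \<in> (r * a) +o N"
  then obtain m where m: "m \<in> N" "z = r * a + m" by (auto simp: elt_set_plus_def)
  have "a \<in> a +o N" using ideal.subspace_0[OF N] by (force simp: elt_set_plus_def)
  then show "z \<in> quot_scale N r (a +o N)"
    using m unfolding quot_scale_def set_plus_def elt_set_times_def by blast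
qed

lemma coset_zero: "0 +o N = (N :: 'a::comm_ring_1 set)"
  by (auto simp: elt_set_plus_def)

lemma quot_span_subset:
  assumes N: "ideal.subspace N" and M: "ideal.subspace M" and B: "B \<subseteq> quot_module M N"
  shows "quot_span N B \<subseteq> quot_module M N"
proof
  fix X assume "X \<in> quot_span N B"
  then show "X \<in> quot_module M N"
  proof induction
    case zero
    have "N = 0 +o N" by (simp only: coset_zero)
    then show ?case using ideal.subspace_0[OF M] unfolding quot_module_def by blast
  next
    case (add X Y)
    then obtain x y where "x \<in> M" "y \<in> M" "X = x +o N" "Y = y +o N" by (auto simp: quot_module_def)
    then have "X + Y = (x + y) +o N" "x + y \<in> M" using coset_add[OF N] ideal.subspace_add[OF M] by auto
    then show ?case unfolding quot_module_def by blast
  next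
    case (scale X r)
    then obtain x where "x \<in> M" "X = x +o N" by (auto simp: quot_module_def)
    then have "quot_scale N r X = (r * x) +o N" "r * x \<in> M"
      using coset_scale[OF N] ideal.subspace_scale[OF M] by auto
    then show ?case unfolding quot_module_def by blast
  qed (use B in blast)
qed

lemma inj_lookup: "inj (lookup :: ('v \<Rightarrow>\<^sub>0 nat) \<Rightarrow> _)"
  by (rule injI) (rule poly_mapping_eq_iff[THEN iffD2])

text \<open>A monomial of \<open>M\<close> either vanishes modulo \<open>N\<close> or is a multiple
  of a minimal one. Distinct minimal monomials stay distinct modulo \<open>N\<close> because each
  survives in their difference.\<close>

lemma monomials_generate:
  fixes P Q :: "('v::finite \<Rightarrow> nat) \<Rightarrow> bool"
  assumes upP: "\<And>m m'. P m \<Longrightarrow> m \<le> m' \<Longrightarrow> P m'" and upQ: "\<And>m m'. Q m \<Longrightarrow> m \<le> m' \<Longrightarrow> Q m'"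
    and G: "\<And>g. lookup g \<in> min_elems {m. P m \<and> \<not> Q m} \<longleftrightarrow> g \<in> G"
  defines "M \<equiv> (mono_ideal P :: ('v, 'k::field) mpoly set)" and "N \<equiv> mono_ideal Q"
  defines "B \<equiv> (\<lambda>g. Poly_Mapping.single g 1 +o N) ` G"
  shows "quot_span N B = quot_module M N" "B \<subseteq> quot_module M N" "card B = card G"
proof -
  have N: "ideal.subspace N" unfolding N_def by (rule subspace_mono_ideal) (rule upQ)
  have M: "ideal.subspace M" unfolding M_def by (rule subspace_mono_ideal) (rule upP)
  have PG: "P (lookup g)" "\<not> Q (lookup g)" if "g \<in> G" for g using G[of g] that by (auto simp: min_elems_def)
  show BM: "B \<subseteq> quot_module M N"
    unfolding B_def quot_module_def M_def using PG(1) single_mem_mono_ideal by blast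
  have "inj_on (\<lambda>g. Poly_Mapping.single g (1::'k) +o N) G"
  proof (rule inj_onI, rule ccontr)
    fix g h assume gh: "g \<in> G" "h \<in> G" "Poly_Mapping.single g (1::'k) +o N = Poly_Mapping.single h 1 +o N" "g \<noteq> h"
    then have "Poly_Mapping.single g (1::'k) - Poly_Mapping.single h 1 \<in> N" by (simp only: coset_eq_iff[OF N])
    moreover have "g \<in> Poly_Mapping.keys (Poly_Mapping.single g (1::'k) - Poly_Mapping.single h 1)"
      using gh(4) by (simp add: in_keys_iff lookup_minus lookup_single)
    ultimately show False using PG(2)[OF gh(1)] by (auto simp: N_def mono_ideal_def)
  qed
  then show "card B = card G" unfolding B_def by (rule card_image)
  let ?J = "{f. f +o N \<in> quot_span N B}"
  have "M \<subseteq> ?J" unfolding M_def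
  proof (rule mono_ideal_subset_subspace)
    show "ideal.subspace ?J"
    proof (rule ideal.subspaceI)
      show "0 \<in> ?J" by (simp add: coset_zero quot_span.zero)
      fix f g assume f: "f \<in> ?J"
      show "g * f \<in> ?J" using quot_span.scale[of "f +o N" N B g] f by (simp add: coset_scale[OF N])
      assume g: "g \<in> ?J"
      show "f + g \<in> ?J" using quot_span.add[of "f +o N" N B "g +o N"] f g by (simp add: coset_add[OF N])
    qed
    fix m assume m: "P (lookup m)"
    show "Poly_Mapping.single m 1 \<in> ?J"
    proof (cases "Q (lookup m)")
      case True
      then have "Poly_Mapping.single m (1::'k) - 0 \<in> N" by (simp add: N_def single_mem_mono_ideal)
      then have "Poly_Mapping.single m (1::'k) +o N = 0 +o N" by (simp only: coset_eq_iff[OF N])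
      then show ?thesis by (simp add: coset_zero quot_span.zero)
    next
      case False
      then obtain g0 where g0: "g0 \<in> min_elems {m. P m \<and> \<not> Q m}" "g0 \<le> lookup m"
        using min_elems_below[of "lookup m" "{m. P m \<and> \<not> Q m}"] m by auto
      obtain g where g: "lookup g = g0" by (rule lookup_surj)
      obtain k where k: "lookup k = (\<lambda>v. lookup m v - g0 v)" by (rule lookup_surj)
      have "m = k + g" using g0(2) g k by (intro poly_mapping_eqI) (simp add: lookup_add le_fun_def)
      then have eq: "Poly_Mapping.single m (1::'k) = Poly_Mapping.single k 1 * Poly_Mapping.single g 1"
        by (simp add: mult_single)
      have "Poly_Mapping.single g 1 +o N \<in> quot_span N B"
        using G[of g] g0(1) g unfolding B_def by (intro quot_span.gen imageI) simp
      from quot_span.scale[OF this, of "Poly_Mapping.single k 1"] show ?thesis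
        unfolding coset_scale[OF N] eq by simp
    qed
  qed
  then have "quot_module M N \<subseteq> quot_span N B" by (auto simp: quot_module_def)
  then show "quot_span N B = quot_module M N" using quot_span_subset[OF N M BM] by blast
qed

text \<open>Constants act as scalars here; this gives access to the dimension bound for independent
  sets.\<close>

lemma vector_space_mpoly:
  "vector_space (\<lambda>c (f :: ('v, 'k::field) mpoly). Poly_Mapping.single 0 c * f)"
  by unfold_locales
    (simp_all only: distrib_left single_add distrib_right mult.assoc[symmetric] mult_single add_0_left single_one mult_1_left)

text \<open>The coefficients at the minimal monomials outside \<open>Q\<close> are compatible with addition, vanish on
  \<open>mono_ideal Q\<close>, and turn scaling by \<open>r\<close> into scaling by the constant term of \<open>r\<close>.\<close>

lemma generators_lower_bound:
  fixes P Q :: "('v::finite \<Rightarrow> nat) \<Rightarrow> bool"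
  assumes upP: "\<And>m m'. P m \<Longrightarrow> m \<le> m' \<Longrightarrow> P m'" and upQ: "\<And>m m'. Q m \<Longrightarrow> m \<le> m' \<Longrightarrow> Q m'"
    and G: "\<And>g. lookup g \<in> min_elems {m. P m \<and> \<not> Q m} \<longleftrightarrow> g \<in> G" and finG: "finite G"
  defines "M \<equiv> (mono_ideal P :: ('v, 'k::field) mpoly set)" and "N \<equiv> mono_ideal Q"
  assumes B: "B \<subseteq> quot_module M N" "finite B" "quot_span N B = quot_module M N"
  shows "card G \<le> card B"
proof -
  interpret V: vector_space "\<lambda>c (f :: ('v, 'k) mpoly). Poly_Mapping.single 0 c * f"
    by (rule vector_space_mpoly)
  have N: "ideal.subspace N" unfolding N_def by (rule subspace_mono_ideal) (rule upQ)
  have M: "ideal.subspace M" unfolding M_def by (rule subspace_mono_ideal) (rule upP)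
  have PG: "P (lookup g)" "\<not> Q (lookup g)" "\<And>m. P m \<Longrightarrow> m \<le> lookup g \<Longrightarrow> m = lookup g" if "g \<in> G" for g
    using G[of g] that upQ by (auto simp: min_elems_def)
  define \<pi> :: "('v, 'k) mpoly \<Rightarrow> ('v, 'k) mpoly" where
    "\<pi> f = (\<Sum>g\<in>G. Poly_Mapping.single g (lookup f g))" for f
  have \<pi>_add: "\<pi> (f + h) = \<pi> f + \<pi> h" for f h
    by (simp add: \<pi>_def lookup_add single_add sum.distrib)
  have \<pi>_N: "\<pi> f = 0" if "f \<in> N" for f
  proof -
    have "lookup f g = 0" if "g \<in> G" for g
      using PG(2)[OF that] \<open>f \<in> N\<close> by (auto simp: N_def mono_ideal_def in_keys_iff)
    then show ?thesis by (simp add: \<pi>_def)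
  qed
  have \<pi>_cong: "\<pi> f = \<pi> h" if "f +o N = h +o N" for f h
  proof -
    have "\<pi> f = \<pi> (h + (f - h))" by simp
    also have "\<dots> = \<pi> h + \<pi> (f - h)" by (rule \<pi>_add)
    also have "\<pi> (f - h) = 0" using that by (intro \<pi>_N) (simp only: coset_eq_iff[OF N])
    finally show ?thesis by simp
  qed
  have \<pi>_scale: "\<pi> (r * f) = Poly_Mapping.single 0 (lookup r 0) * \<pi> f" if f: "f \<in> M" for r f
  proof -
    have coeff: "lookup (r * f) g = lookup r 0 * lookup f g" if g: "g \<in> G" for g
    proof -
      \<comment> \<open>The monomials of \<open>f\<close> satisfy \<open>P\<close>, and nothing
        strictly below the minimal \<open>g\<close> does, so only the constant term of
        \<open>r\<close> contributes.\<close>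
      have "a = 0 \<and> b = g" if ab: "b \<in> Poly_Mapping.keys f" "a + b = g" for a b
      proof -
        have "lookup b \<le> lookup g" using ab(2) by (auto simp: le_fun_def lookup_add)
        moreover have "P (lookup b)" using f ab(1) by (auto simp: M_def mono_ideal_def)
        ultimately have "lookup b = lookup g" by (intro PG(3)[OF g])
        then have "b = g" by (rule poly_mapping_eq_iff[THEN iffD2])
        then show ?thesis using ab(2) by simp
      qed
      then have "lookup (r * f) g = (\<Sum>a\<in>Poly_Mapping.keys r. \<Sum>b\<in>Poly_Mapping.keys f.
          if a = 0 then (if b = g then lookup r 0 * lookup f g else 0) else 0)"
        unfolding lookup_mult_sum by (intro sum.cong refl) auto
      also have "\<dots> = (\<Sum>a\<in>Poly_Mapping.keys r. if a = 0 then lookup r 0 * lookup f g else 0)"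
        by (intro sum.cong refl) (auto simp: sum.delta in_keys_iff)
      also have "\<dots> = lookup r 0 * lookup f g" by (auto simp: sum.delta in_keys_iff)
      finally show ?thesis .
    qed
    show ?thesis unfolding \<pi>_def sum_distrib_left mult_single
      by (intro sum.cong refl) (simp add: coeff)
  qed
  define rep where "rep X = (SOME f. f \<in> M \<and> X = f +o N)" for X
  have rep: "rep X \<in> M \<and> X = rep X +o N" if "X \<in> B" for X
    unfolding rep_def by (rule someI_ex) (use that B(1) in \<open>auto simp: quot_module_def\<close>)
  let ?T = "(\<lambda>X. \<pi> (rep X)) ` B"
  have span: "\<pi> f \<in> V.span ?T" if "X \<in> quot_span N B" "X = f +o N" for X f
    using that
  proof (induction arbitrary: f)
    case zero
    then have "f +o N = 0 +o N" by (simp only: coset_zero)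
    then have "\<pi> f = \<pi> 0" by (rule \<pi>_cong)
    also have "\<pi> 0 = 0" by (rule \<pi>_N) (rule ideal.subspace_0[OF N])
    finally show ?case by (simp only: V.span_zero)
  next
    case (gen X)
    have "\<pi> f = \<pi> (rep X)" by (rule \<pi>_cong) (use rep[OF gen(1)] gen(2) in simp)
    moreover have "\<pi> (rep X) \<in> V.span ?T" by (intro V.span_base imageI) (rule gen(1))
    ultimately show ?case by simp
  next
    case (add X Y)
    obtain x where x: "X = x +o N" using add.hyps(1) unfolding B(3) by (auto simp: quot_module_def)
    obtain y where y: "Y = y +o N" using add.hyps(2) unfolding B(3) by (auto simp: quot_module_def)
    have "f +o N = (x + y) +o N" using add.prems unfolding x y coset_add[OF N] by simp
    then have "\<pi> f = \<pi> x + \<pi> y" using \<pi>_cong[of f "x + y"] \<pi>_add by simp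
    then show ?case using V.span_add[OF add.IH(1)[OF x] add.IH(2)[OF y]] by simp
  next
    case (scale X r)
    obtain x where x: "X = x +o N" "x \<in> M" using scale.hyps(1) unfolding B(3) by (auto simp: quot_module_def)
    have "f +o N = (r * x) +o N" using scale.prems unfolding x coset_scale[OF N] by simp
    then have "\<pi> f = Poly_Mapping.single 0 (lookup r 0) * \<pi> x" using \<pi>_cong[of f "r * x"] \<pi>_scale[OF x(2)] by simp
    then show ?case using V.span_scale[OF scale.IH[OF x(1)]] by simp
  qed
  let ?S = "(\<lambda>g. Poly_Mapping.single g (1::'k)) ` G"
  have inj: "inj_on (\<lambda>g. Poly_Mapping.single g (1::'k)) G"
  proof (rule inj_onI)
    fix g h assume "Poly_Mapping.single g (1::'k) = Poly_Mapping.single h 1"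
    then have "Poly_Mapping.keys (Poly_Mapping.single g (1::'k)) = Poly_Mapping.keys (Poly_Mapping.single h (1::'k))"
      by simp
    then show "g = h" by simp
  qed
  have "?S \<subseteq> V.span ?T"
  proof (rule image_subsetI)
    fix g assume g: "g \<in> G"
    have "Poly_Mapping.single g (1::'k) \<in> M" unfolding M_def by (rule single_mem_mono_ideal) (rule PG(1)[OF g])
    then have "Poly_Mapping.single g (1::'k) +o N \<in> quot_span N B" unfolding B(3) quot_module_def by blast
    from span[OF this refl] have "\<pi> (Poly_Mapping.single g 1) \<in> V.span ?T" .
    also have "\<pi> (Poly_Mapping.single g 1) = (\<Sum>h\<in>G. if h = g then Poly_Mapping.single g 1 else 0)"
      unfolding \<pi>_def by (intro sum.cong refl) (auto simp: lookup_single when_def)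
    also have "\<dots> = Poly_Mapping.single g 1" using g finG by simp
    finally show "Poly_Mapping.single g 1 \<in> V.span ?T" .
  qed
  moreover have "V.independent ?S"
  proof (rule V.independent_if_scalars_zero)
    fix u x assume u: "(\<Sum>x\<in>?S. Poly_Mapping.single 0 (u x) * x) = 0" and x: "x \<in> ?S"
    obtain g where g: "g \<in> G" "x = Poly_Mapping.single g 1" using x by auto
    have "0 = (\<Sum>h\<in>G. Poly_Mapping.single h (u (Poly_Mapping.single h 1)))"
      using u unfolding sum.reindex[OF inj] by (simp add: mult_single)
    then have "0 = lookup (\<Sum>h\<in>G. Poly_Mapping.single h (u (Poly_Mapping.single h 1))) g"
      using lookup_zero by metis
    also have "\<dots> = (\<Sum>h\<in>G. if h = g then u x else 0)"
      unfolding lookup_sum g(2) by (intro sum.cong refl) (auto simp: lookup_single when_def)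
    also have "\<dots> = u x" using g(1) finG by simp
    finally show "u x = 0" by simp
  qed (use finG in simp)
  \<comment> \<open>The images under \<open>\<pi>\<close> of representatives of \<open>B\<close>
    span all minimal monomials, which are linearly independent.\<close>
  ultimately have "card ?S \<le> card ?T" using V.independent_span_bound[of ?T ?S] B(2) by blast
  also have "card ?T \<le> card B" by (rule card_image_le[OF B(2)])
  finally show ?thesis unfolding card_image[OF inj] .
qed

lemma min_num_gens_mono_ideal:
  fixes P Q :: "('v::finite \<Rightarrow> nat) \<Rightarrow> bool"
  assumes upP: "\<And>m m'. P m \<Longrightarrow> m \<le> m' \<Longrightarrow> P m'" and upQ: "\<And>m m'. Q m \<Longrightarrow> m \<le> m' \<Longrightarrow> Q m'"
    and fin: "finite (min_elems {m. P m \<and> \<not> Q m})"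
  shows "min_num_gens (mono_ideal P) (mono_ideal Q :: ('v, 'k::field) mpoly set)
    = card (min_elems {m. P m \<and> \<not> Q m})"
proof -
  let ?G = "lookup -` min_elems {m. P m \<and> \<not> Q m} :: ('v \<Rightarrow>\<^sub>0 nat) set"
  have G: "\<And>g. lookup g \<in> min_elems {m. P m \<and> \<not> Q m} \<longleftrightarrow> g \<in> ?G" by simp
  have finG: "finite ?G" by (rule finite_vimageI[OF fin inj_lookup])
  have "lookup ` ?G = min_elems {m. P m \<and> \<not> Q m}"
  proof (intro equalityI subsetI)
    fix m assume "m \<in> min_elems {m. P m \<and> \<not> Q m}"
    moreover obtain g :: "'v \<Rightarrow>\<^sub>0 nat" where "lookup g = m" by (rule lookup_surj)
    ultimately show "m \<in> lookup ` ?G" by auto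
  qed auto
  then have card: "card ?G = card (min_elems {m. P m \<and> \<not> Q m})"
    using card_image[OF inj_on_subset[OF inj_lookup subset_UNIV], of ?G] by simp
  let ?N = "mono_ideal Q :: ('v, 'k) mpoly set"
  let ?M = "mono_ideal P :: ('v, 'k) mpoly set"
  let ?B = "(\<lambda>g. Poly_Mapping.single g 1 +o ?N) ` ?G"
  show ?thesis unfolding min_num_gens_def card[symmetric]
  proof (rule Least_equality)
    have "quot_span ?N ?B = quot_module ?M ?N" "?B \<subseteq> quot_module ?M ?N" "card ?B = card ?G"
      by (rule monomials_generate; (rule upP upQ G; assumption?))+
    then show "\<exists>B\<subseteq>quot_module ?M ?N. finite B \<and> card B = card ?G \<and> quot_span ?N B = quot_module ?M ?N"
      using finG by (intro exI[of _ ?B]) simp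
  next
    fix k assume "\<exists>B\<subseteq>quot_module ?M ?N. finite B \<and> card B = k \<and> quot_span ?N B = quot_module ?M ?N"
    then obtain B where B: "B \<subseteq> quot_module ?M ?N" "finite B" "card B = k" "quot_span ?N B = quot_module ?M ?N"
      by blast
    have "card ?G \<le> card B"
      by (rule generators_lower_bound[where P = P and Q = Q and 'k = 'k])
        (use upP upQ finG B in \<open>auto\<close>)
    then show "card ?G \<le> k" using B(3) by simp
  qed
qed

section \<open>The symbolic defect of an odd unicyclic graph\<close>

context odd_unicyclic
begin

lemma finite_min_defect_set: "finite (min_elems (defect_set s))"
  unfolding min_defect_set by (rule finite_subset[OF _ finite_min_heavy[of s]]) blast

lemma sdefect_edge_ideal:
  "sdefect (edge_ideal E :: ('v, 'k::field) mpoly set) s = card (min_elems (defect_set s))"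
proof -
  have I: "ideal_power (edge_ideal E :: ('v, 'k) mpoly set) s = mono_ideal (packs E s)"
    by (rule ideal_power_edge_ideal) (rule card_edge)
  have S: "symbolic_power (edge_ideal E :: ('v, 'k) mpoly set) s = mono_ideal (heavy E s)"
    by (rule symbolic_power_edge_ideal) (rule card_edge)
  show ?thesis unfolding sdefect_def I S defect_set_def
    by (rule min_num_gens_mono_ideal)
      (erule (1) heavy_le_mono packs_le_mono, erule (1) heavy_le_mono packs_le_mono,
       rule finite_min_defect_set[unfolded defect_set_def])
qed

end

theorem theorem4p8:
  fixes E :: "'v::finite set set"
    and xs :: "'v list"
    and n l s :: nat
    and I :: "('v, 'k::field) mpoly set"
  assumes "unicyclic E"
    and "is_cycle E xs"
    and "length xs = 2 * n + 1"
    and "n \<ge> 1"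
    and "l = card (E - cycle_edges xs)"
    and "I = edge_ideal E"
  shows "(n + 1 \<le> s \<and> s \<le> 2 * n + 1 \<longrightarrow>
            int (sdefect I s) = script_G E xs n l (s - (n + 1)) \<and>
            script_G E xs n l (s - (n + 1)) =
              int (multichoose (2 * n + 1 + l) (int s - int (n + 1)))) \<and>
         (s \<ge> 2 * n + 2 \<longrightarrow>
            int (sdefect I s) =
              script_G E xs n l (s - (n + 1)) + int (sdefect I (s - (n + 1))))"
proof -
  obtain c p d where struct: "odd_unicyclic E c n p d" and xs: "set xs = range c"
    and ce: "cycle_edges xs = (\<lambda>v. {v, p v}) ` range c"
    by (rule unicyclic_odd_structure[OF assms(1-4)])
  interpret odd_unicyclic E c n p d by (rule struct)
  have ce': "cycle_edges xs = ed ` range c" unfolding ce by (simp add: ed_def)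
  \<comment> \<open>The recursion holds from n + 1 on; for \<open>s \<le> 2 * n + 1\<close> its last
    term is a symbolic defect of index at most n, which vanishes.\<close>
  have rec: "int (sdefect I s) = script_G E xs n l (s - (n + 1)) + int (sdefect I (s - (n + 1)))"
    if "n + 1 \<le> s" for s
    unfolding assms(6) sdefect_edge_ideal card_min_defect_set_shift[OF that]
    by (rule card_min_heavy_script_G[OF xs ce' assms(5)])
  have zero: "sdefect I t = 0" if "t \<le> n" for t
    unfolding assms(6) sdefect_edge_ideal defect_set_empty[OF that] by (simp add: min_elems_def)
  have small: "script_G E xs n l (s - (n + 1)) = int (multichoose (2 * n + 1 + l) (int s - int (n + 1)))"
    if "n + 1 \<le> s" "s \<le> 2 * n + 1"
  proof -
    have "s - (n + 1) \<le> n" "int (s - (n + 1)) = int s - int (n + 1)" using that by linarith+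
    then show ?thesis by (simp only: script_G_def if_True)
  qed
  show ?thesis using rec[of s] zero[of "s - (n + 1)"] small by auto
qed

end
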